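(* Let $1\le k\le n$, let $p\in H^n$ and let $\rho_0>0$. Let $P\subset T_pH^n$ be a $k$-dimensional linear subspace and let $N_0=\exp_p(P)\cap B_p(\rho_0)$, a totally geodesic $k$-dimensional submanifold of $H^n$ through $p$. Suppose $M$ is a compact $k$-dimensional (immersed, smooth) minimal submanifold of $H^n$ passing through $p$ whose boundary $\partial M$ lies on $\partial B_p(\rho_0)$. Then the area of $M$ is no less than the area of $N_0$, i.e. $|M|\ge |N_0|$.
   Context: $H^n$ is the $n$-dimensional hyperbolic space of constant sectional curvature $-1$. $B_p(\rho_0)$ denotes the geodesic ball in $H^n$ with center $p$ and radius $\rho_0$, and $\partial B_p(\rho_0)$ is the geodesic sphere of radius $\rho_0$ about $p$. $\exp_p:T_pH^n\to H^n$ is the exponential map. A submanifold is minimal if its mean curvature vector vanishes identically. $|\cdot|$ denotes $k$-dimensional area, i.e. the $k$-dimensional Riemannian volume with respect to the metric induced from $H^n$ (for an immersed submanifold, the volume of the pulled-back metric). *)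

theory Defs
  imports "HOL-Analysis.Analysis"
begin

section \<open>Smooth maps\<close>

text \<open>Meant for open \<open>S\<close>; there it says that \<open>f\<close> is of class \<open>C\<^sup>m\<close>.\<close>

primrec Ck_on :: "nat \<Rightarrow> 'a::real_normed_vector set \<Rightarrow> ('a \<Rightarrow> 'b::real_normed_vector) \<Rightarrow> bool" where
  "Ck_on 0 S f \<longleftrightarrow> continuous_on S f"
| "Ck_on (Suc m) S f \<longleftrightarrow>
     (\<forall>x\<in>S. f differentiable (at x)) \<and> (\<forall>v. Ck_on m S (\<lambda>x. frechet_derivative f (at x) v))"

text \<open>Smoothness on an arbitrary set: local existence of smooth extensions to open sets.\<close>

definition smooth_on :: "'a::real_normed_vector set \<Rightarrow> ('a \<Rightarrow> 'b::real_normed_vector) \<Rightarrow> bool" where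
  "smooth_on S f \<longleftrightarrow>
     (\<forall>x\<in>S. \<exists>W g. open W \<and> x \<in> W \<and> (\<forall>m. Ck_on m W g) \<and> (\<forall>y\<in>W \<inter> S. g y = f y))"

text \<open>The derivative is taken within \<open>V\<close>, so that it also makes sense at boundary points when \<open>V\<close> is
  a relatively open subset of a closed half-space (where it is still unique).\<close>

definition partial :: "(real^'k) set \<Rightarrow> 'k \<Rightarrow> (real^'k \<Rightarrow> 'b::real_normed_vector) \<Rightarrow> real^'k \<Rightarrow> 'b" where
  "partial V i f x = frechet_derivative f (at x within V) (axis i 1)"

definition immersion_on :: "(real^'k) set \<Rightarrow> (real^'k \<Rightarrow> 'b::real_normed_vector) \<Rightarrow> bool" where
  "immersion_on V f \<longleftrightarrow> smooth_on V f \<and> (\<forall>x\<in>V. inj (frechet_derivative f (at x within V)))"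


section \<open>Smooth manifolds with boundary\<close>

text \<open>The choice of the distinguished coordinate is immaterial.\<close>

definition half_index :: "'k::finite" where
  "half_index = (SOME i. True)"

definition half_space :: "(real^'k) set" where
  "half_space = {x. 0 \<le> x $ half_index}"

type_synonym ('m, 'k) chart = "'m set \<times> ('m \<Rightarrow> real^'k)"

definition chart_of :: "'m::topological_space set \<Rightarrow> ('m, 'k::finite) chart \<Rightarrow> bool" where
  "chart_of M = (\<lambda>(U, \<phi>).
     openin (top_of_set M) U \<and> openin (top_of_set half_space) (\<phi> ` U) \<and>
     homeomorphism U (\<phi> ` U) \<phi> (inv_into U \<phi>))"

definition compatible_charts :: "('m, 'k::finite) chart \<Rightarrow> ('m, 'k) chart \<Rightarrow> bool" where
  "compatible_charts = (\<lambda>(U, \<phi>) (U', \<phi>'). smooth_on (\<phi> ` (U \<inter> U')) (\<phi>' \<circ> inv_into U \<phi>))"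

text \<open>\<open>A\<close> is a smooth atlas on the subspace \<open>M\<close>, of dimension \<open>CARD('k)\<close>. The Hausdorff property
  comes from the type class; second countability is automatic for the compact \<open>M\<close> considered.\<close>

definition smooth_manifold :: "'m::t2_space set \<Rightarrow> ('m, 'k::finite) chart set \<Rightarrow> bool" where
  "smooth_manifold M A \<longleftrightarrow>
     (\<forall>c\<in>A. chart_of M c) \<and> (\<Union>c\<in>A. fst c) = M \<and> (\<forall>c\<in>A. \<forall>d\<in>A. compatible_charts c d)"

definition manifold_boundary :: "('m, 'k::finite) chart set \<Rightarrow> 'm set" where
  "manifold_boundary A = {x. \<exists>(U, \<phi>)\<in>A. x \<in> U \<and> \<phi> x $ half_index = 0}"


section \<open>The hyperboloid model of hyperbolic space\<close>

definition mink :: "(real^'n) \<times> real \<Rightarrow> (real^'n) \<times> real \<Rightarrow> real" where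
  "mink x y = fst x \<bullet> fst y - snd x * snd y"

definition hyperbolic_space :: "((real^'n) \<times> real) set" where
  "hyperbolic_space = {x. mink x x = -1 \<and> 0 < snd x}"

definition tangent_space :: "(real^'n) \<times> real \<Rightarrow> ((real^'n) \<times> real) set" where
  "tangent_space p = {v. mink p v = 0}"

definition hnorm :: "(real^'n) \<times> real \<Rightarrow> real" where
  "hnorm v = sqrt (mink v v)"

text \<open>For \<open>q\<close> on the hyperboloid this is the \<open>mink\<close>-orthogonal projection onto the tangent space
  at \<open>q\<close>; the Levi-Civita connection of the hyperboloid is the flat derivative followed by it.\<close>

definition tangent_proj :: "(real^'n) \<times> real \<Rightarrow> (real^'n) \<times> real \<Rightarrow> (real^'n) \<times> real" where
  "tangent_proj q w = w + mink q w *\<^sub>R q"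

definition geodesic :: "(real \<Rightarrow> (real^'n) \<times> real) \<Rightarrow> bool" where
  "geodesic \<gamma> \<longleftrightarrow> smooth_on UNIV \<gamma> \<and> range \<gamma> \<subseteq> hyperbolic_space \<and>
     (\<forall>t. tangent_proj (\<gamma> t) (vector_derivative (\<lambda>s. vector_derivative \<gamma> (at s)) (at t)) = 0)"

definition hexp :: "(real^'n) \<times> real \<Rightarrow> (real^'n) \<times> real \<Rightarrow> (real^'n) \<times> real" where
  "hexp p v = (THE q. \<exists>\<gamma>. geodesic \<gamma> \<and> \<gamma> 0 = p \<and> vector_derivative \<gamma> (at 0) = v \<and> \<gamma> 1 = q)"

definition geodesic_ball :: "(real^'n) \<times> real \<Rightarrow> real \<Rightarrow> ((real^'n) \<times> real) set" where
  "geodesic_ball p r = hexp p ` {v \<in> tangent_space p. hnorm v < r}"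

definition geodesic_sphere :: "(real^'n) \<times> real \<Rightarrow> real \<Rightarrow> ((real^'n) \<times> real) set" where
  "geodesic_sphere p r = hexp p ` {v \<in> tangent_space p. hnorm v = r}"


section \<open>Immersed submanifolds of hyperbolic space\<close>

definition induced_metric ::
  "(real^'k) set \<Rightarrow> (real^'k \<Rightarrow> (real^'n) \<times> real) \<Rightarrow> real^'k \<Rightarrow> real^'k^'k" where
  "induced_metric V f x = (\<chi> i j. mink (partial V i f x) (partial V j f x))"

definition normal_part ::
  "(real^'k) set \<Rightarrow> (real^'k \<Rightarrow> (real^'n) \<times> real) \<Rightarrow> real^'k \<Rightarrow> (real^'n) \<times> real \<Rightarrow> (real^'n) \<times> real" where
  "normal_part V f x w =
     w - (\<Sum>i\<in>UNIV. \<Sum>j\<in>UNIV.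
            (matrix_inv (induced_metric V f x) $ i $ j * mink w (partial V i f x)) *\<^sub>R partial V j f x)"

definition second_fundamental_form ::
  "(real^'k) set \<Rightarrow> (real^'k \<Rightarrow> (real^'n) \<times> real) \<Rightarrow> real^'k \<Rightarrow> 'k \<Rightarrow> 'k \<Rightarrow> (real^'n) \<times> real" where
  "second_fundamental_form V f x i j =
     normal_part V f x (tangent_proj (f x) (partial V i (partial V j f) x))"

definition mean_curvature ::
  "(real^'k) set \<Rightarrow> (real^'k \<Rightarrow> (real^'n) \<times> real) \<Rightarrow> real^'k \<Rightarrow> (real^'n) \<times> real" where
  "mean_curvature V f x =
     (\<Sum>i\<in>UNIV. \<Sum>j\<in>UNIV.
        matrix_inv (induced_metric V f x) $ i $ j *\<^sub>R second_fundamental_form V f x i j)"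

definition hyperbolic_immersion ::
  "'m set \<Rightarrow> ('m, 'k::finite) chart set \<Rightarrow> ('m \<Rightarrow> (real^'n) \<times> real) \<Rightarrow> bool" where
  "hyperbolic_immersion M A F \<longleftrightarrow>
     F ` M \<subseteq> hyperbolic_space \<and> (\<forall>(U, \<phi>)\<in>A. immersion_on (\<phi> ` U) (F \<circ> inv_into U \<phi>))"

definition minimal :: "('m, 'k::finite) chart set \<Rightarrow> ('m \<Rightarrow> (real^'n) \<times> real) \<Rightarrow> bool" where
  "minimal A F \<longleftrightarrow>
     (\<forall>(U, \<phi>)\<in>A. \<forall>x\<in>\<phi> ` U. mean_curvature (\<phi> ` U) (F \<circ> inv_into U \<phi>) x = 0)"

text \<open>Riemannian volume, for the pulled-back metric, of the part \<open>B\<close> of a chart domain.\<close>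

definition chart_area ::
  "('m \<Rightarrow> (real^'n) \<times> real) \<Rightarrow> ('m, 'k::finite) chart \<Rightarrow> 'm set \<Rightarrow> ennreal" where
  "chart_area F = (\<lambda>(U, \<phi>) B.
     \<integral>\<^sup>+x\<in>\<phi> ` B. ennreal (sqrt (det (induced_metric (\<phi> ` U) (F \<circ> inv_into U \<phi>) x))) \<partial>lborel)"

text \<open>Finite disjoint families of Borel pieces, each inside a chart domain. The total volume of the
  pieces is independent of the charts used and depends only on their union, so the supremum below
  is the value for any such family that exhausts the manifold (for a compact manifold: any finite
  Borel partition subordinate to the charts).\<close>

definition borel_pieces :: "('m, 'k::finite) chart set \<Rightarrow> (('m, 'k) chart \<times> 'm set) set set" where
  "borel_pieces A = {\<F>. finite \<F> \<and> disjoint_family_on snd \<F> \<and>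
     (\<forall>((U, \<phi>), B)\<in>\<F>. (U, \<phi>) \<in> A \<and> B \<subseteq> U \<and> \<phi> ` B \<in> sets borel)}"

definition area :: "('m, 'k::finite) chart set \<Rightarrow> ('m \<Rightarrow> (real^'n) \<times> real) \<Rightarrow> ennreal" where
  "area A F = (SUP \<F>\<in>borel_pieces A. \<Sum>(c, B)\<in>\<F>. chart_area F c B)"

text \<open>The smooth structure induced on an embedded submanifold \<open>N\<close> of the ambient vector space:
  the charts are the inverses of regular smooth local parametrisations.\<close>

definition induced_atlas :: "'b::real_normed_vector set \<Rightarrow> ('b, 'k::finite) chart set" where
  "induced_atlas N =
     {(U, \<phi>). chart_of N (U, \<phi>) \<and> immersion_on (\<phi> ` U) (inv_into U \<phi>)}"

end

theory Submission imports Defs "HOL-Real_Asymp.Real_Asymp" begin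

text \<open>
  Let \<open>u q = - mink p q\<close>, the hyperbolic cosine of the distance from \<open>p\<close> to \<open>q\<close>. On a \<open>k\<close>-dimensional minimal
  submanifold \<open>u\<close> satisfies \<open>div (\<nabla>u) = k u\<close> and \<open>|\<nabla>u|\<^sup>2 \<le> u\<^sup>2 - 1\<close>, with equality on totally geodesic ones
  through \<open>p\<close>. For \<open>w \<ge> 0\<close> supported in \<open>{1..cosh \<rho>\<^sub>0}\<close> with \<open>w \<le> (u\<^sup>2 - 1)\<^bsup>k/2-1\<^esup>\<close>, put
  \<open>\<Psi> u = \<integral> w\<close> over \<open>{u..cosh \<rho>\<^sub>0}\<close> and \<open>g u = - \<Psi> u (u\<^sup>2 - 1 + \<epsilon>\<^sup>2)\<^bsup>-k/2\<^esup>\<close>. The field \<open>g (u) \<nabla>u\<close> vanishes near the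
  boundary, so its divergence has integral zero; as \<open>g' \<ge> 0\<close>, the divergence is at most \<open>1 - \<kappa>\<close> with
  \<open>\<kappa> = k u \<Psi> u \<epsilon>\<^sup>2 (u\<^sup>2 - 1 + \<epsilon>\<^sup>2)\<^bsup>-k/2-1\<^esup>\<close>. Hence the area is at least the integral of \<open>\<kappa>\<close>. Rescaling a
  chart around a preimage of \<open>p\<close> by \<open>\<epsilon>\<close> and applying Fatou's lemma bounds the area below by \<open>k \<omega>\<^sub>k \<Psi> 1\<close>,
  where \<open>\<omega>\<^sub>k\<close> is the volume of the Euclidean unit ball. The supremum over \<open>w\<close> is the integral of
  \<open>(1 + |y|\<^sup>2)\<^bsup>-1/2\<^esup>\<close> over the Euclidean ball of radius \<open>sinh \<rho>\<^sub>0\<close>, which is the area of the totally geodesic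
  disc parametrised as the graph of \<open>sqrt (1 + |y|\<^sup>2)\<close> over \<open>P\<close>.
\<close>

text \<open>For \<epsilon> = 0 write t^2 = u^2 - 1 and take w = t^(k-2). On a totally geodesic disc
  through p the field - \<Psi>(u) t^(-k) grad u then has divergence exactly 1 away from p and
  vanishes at the rim, so the area of the disc is the flux k omega_k \<Psi>(1) that disappears into
  p. On any other minimal submanifold |grad u|^2 is smaller, and because g increases with u this can
  only lower the divergence; that is why a lower bound for the area results. The singularity at p is
  smoothed by \<epsilon> instead of excising balls around the preimages of p, and w is cut off below
  cosh \<rho>_0 instead of integrating up to the boundary. Thus no level set has to be regular and
  no boundary term occurs: the only integration by parts is that of compactly supported C^1
  functions on a Euclidean space. As \<kappa> is nonnegative, a single preimage of p suffices even
  if several sheets of M pass through p. Area being a supremum over families of Borel pieces, one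
  good family bounds the area of M from below, whereas for the disc every family must be bounded
  from above.\<close>

section \<open>The Minkowski form on tangent spaces\<close>

text \<open>Makes the product rule, limits, continuity and sum rules of bounded bilinear maps
  available for the indefinite form \<open>mink\<close>.\<close>

lemma bounded_bilinear_mink: "bounded_bilinear (mink :: (real^'n) \<times> real \<Rightarrow> _)"
proof -
  have a: "bounded_bilinear (\<lambda>(x :: (real^'n) \<times> real) (y :: (real^'n) \<times> real). fst x \<bullet> fst y)"
    by (rule bounded_bilinear.comp[OF bounded_bilinear_inner bounded_linear_fst bounded_linear_fst])
  have b: "bounded_bilinear (\<lambda>(x :: (real^'n) \<times> real) (y :: (real^'n) \<times> real). snd x * snd y)"
    by (rule bounded_bilinear.comp[OF bounded_bilinear_mult bounded_linear_snd bounded_linear_snd])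
  show ?thesis
  proof
    fix x x' y y' :: "(real^'n) \<times> real" and r :: real
    show "mink (x + x') y = mink x y + mink x' y" "mink x (y + y') = mink x y + mink x y'"
      "mink (r *\<^sub>R x) y = r *\<^sub>R mink x y" "mink x (r *\<^sub>R y) = r *\<^sub>R mink x y"
      by (simp_all add: mink_def algebra_simps)
    obtain K L where KL: "\<And>(x :: (real^'n) \<times> real) (y :: (real^'n) \<times> real). norm (fst x \<bullet> fst y) \<le> norm x * norm y * K"
      "\<And>(x :: (real^'n) \<times> real) (y :: (real^'n) \<times> real). norm (snd x * snd y) \<le> norm x * norm y * L"
      using bounded_bilinear.bounded[OF a] bounded_bilinear.bounded[OF b] by metis
    have "norm (mink x y) \<le> norm x * norm y * K + norm x * norm y * L" for x y :: "(real^'n) \<times> real"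
    proof -
      have "norm (mink x y) \<le> norm (fst x \<bullet> fst y) + norm (snd x * snd y)"
        unfolding mink_def by (rule norm_triangle_ineq4)
      also have "\<dots> \<le> norm x * norm y * K + norm x * norm y * L"
        by (rule add_mono[OF KL(1)[of x y] KL(2)[of x y]])
      finally show ?thesis .
    qed
    then have "norm (mink x y) \<le> norm x * norm y * (K + L)" for x y :: "(real^'n) \<times> real"
      by (simp add: distrib_left)
    then show "\<exists>K. \<forall>(x :: (real^'n) \<times> real) (y :: (real^'n) \<times> real). norm (mink x y) \<le> norm x * norm y * K" by blast
  qed
qed

interpretation mink: bounded_bilinear mink
  by (rule bounded_bilinear_mink)

lemma mink_commute: "mink x y = mink y x"
  by (simp add: mink_def inner_commute)

lemma subspace_tangent_space: "subspace (tangent_space q)"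
  by (auto simp: subspace_def tangent_space_def mink.add_right mink.scaleR_right mink.zero_right)

text \<open>\<open>Q\<close> is the spatial part of the Lorentz reflection exchanging \<open>q\<close> and \<open>- (0, 1)\<close>.\<close>

lemma tangent_space_isometry:
  fixes q :: "(real^'n) \<times> real"
  assumes q: "q \<in> hyperbolic_space"
  obtains Q :: "(real^'n) \<times> real \<Rightarrow> real^'n" where "linear Q"
    "\<And>v w. v \<in> tangent_space q \<Longrightarrow> w \<in> tangent_space q \<Longrightarrow> mink v w = Q v \<bullet> Q w"
    "\<And>v. v \<in> tangent_space q \<Longrightarrow> Q v = 0 \<Longrightarrow> v = 0"
proof -
  define a b where "a = fst q" and "b = snd q"
  have b: "0 < b" "a \<bullet> a = b * b - 1"
    using q by (auto simp: hyperbolic_space_def mink_def a_def b_def)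
  define Q where "Q v = fst v - (snd v / (1 + b)) *\<^sub>R a" for v :: "(real^'n) \<times> real"
  have t: "a \<bullet> fst v = b * snd v" if "v \<in> tangent_space q" for v
    using that by (simp add: tangent_space_def mink_def a_def b_def)
  have iso: "mink v w = Q v \<bullet> Q w" if v: "v \<in> tangent_space q" and w: "w \<in> tangent_space q" for v w
  proof -
    define c where "c = 1 / (1 + b)"
    have c: "c * (1 + b) = 1" using b by (simp add: c_def)
    have "Q v \<bullet> Q w = fst v \<bullet> fst w - c * snd w * (fst v \<bullet> a) - c * snd v * (a \<bullet> fst w) + c * c * snd v * snd w * (a \<bullet> a)"
      unfolding Q_def c_def by (simp add: inner_diff_left inner_diff_right algebra_simps)
    also have "\<dots> = fst v \<bullet> fst w + snd v * snd w * (- 2 * c * b + c * c * (b * b - 1))"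
      using t[OF v] t[OF w] by (simp add: inner_commute b(2) algebra_simps)
    also have "- 2 * c * b + c * c * (b * b - 1) = - 1"
    proof -
      have "c * c * (b * b - 1) = (c * (1 + b)) * (c * (b - 1))" by (simp add: algebra_simps)
      then have "- 2 * c * b + c * c * (b * b - 1) = - 2 * c * b + c * (b - 1)" using c by simp
      also have "\<dots> = - (c * (1 + b))" by (simp add: algebra_simps)
      finally show ?thesis using c by simp
    qed
    finally show ?thesis by (simp add: mink_def)
  qed
  moreover have "linear Q"
    by (rule linearI) (auto simp: Q_def algebra_simps add_divide_distrib)
  moreover have "v = 0" if v: "v \<in> tangent_space q" and 0: "Q v = 0" for v
  proof -
    have f: "fst v = (snd v / (1 + b)) *\<^sub>R a" using 0 by (simp add: Q_def)
    \<comment> \<open>Tangency says a . fst v = b s with s = snd v, while \<open>Q v = 0\<close>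
      makes fst v a multiple of a. With |a|^2 = b^2 - 1 this leaves b s = (b - 1) s.\<close>
    have "b * snd v = (snd v / (1 + b)) * (b * b - 1)"
      using t[OF v] b(2) unfolding f by simp
    also have "b * b - 1 = (1 + b) * (b - 1)" by (simp add: algebra_simps)
    also have "snd v / (1 + b) * ((1 + b) * (b - 1)) = snd v * (b - 1)" using b(1) by simp
    finally have "snd v = 0" by (simp add: algebra_simps)
    with f show ?thesis by (simp add: prod_eq_iff)
  qed
  ultimately show ?thesis using that[of Q] by blast
qed

lemma mink_tangent_nonneg:
  "q \<in> hyperbolic_space \<Longrightarrow> v \<in> tangent_space q \<Longrightarrow> 0 \<le> mink v v"
  by (metis inner_ge_zero tangent_space_isometry)

lemma mink_tangent_eq_0_iff:
  assumes "q \<in> hyperbolic_space" "v \<in> tangent_space q"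
  shows "mink v v = 0 \<longleftrightarrow> v = 0"
  using assms by (metis inner_eq_zero_iff tangent_space_isometry mink.zero_left)

text \<open>Orthonormal coordinates on S for the form \<open>mink\<close>. The map Q carries S onto
  a Euclidean subspace of dimension CARD('k), which is isometric to the coordinate space; g is the
  resulting parametrisation and f its inverse on S.\<close>

lemma tangent_subspace_isometry:
  fixes q :: "(real^'n) \<times> real" and S :: "((real^'n) \<times> real) set"
  assumes q: "q \<in> hyperbolic_space" and S: "subspace S" "S \<subseteq> tangent_space q" "dim S = CARD('k::finite)"
  obtains f :: "(real^'n) \<times> real \<Rightarrow> real^'k" and g where "linear f" "linear g" "range g = S"
    "\<And>v w. v \<in> S \<Longrightarrow> w \<in> S \<Longrightarrow> mink v w = f v \<bullet> f w" 
    "\<And>x y. mink (g x) (g y) = x \<bullet> y"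
    "\<And>v. v \<in> S \<Longrightarrow> g (f v) = v" "\<And>x. f (g x) = x"
proof -
  obtain Q :: "(real^'n) \<times> real \<Rightarrow> real^'n" where Q: "linear Q"
    "\<And>v w. v \<in> tangent_space q \<Longrightarrow> w \<in> tangent_space q \<Longrightarrow> mink v w = Q v \<bullet> Q w"
    "\<And>v. v \<in> tangent_space q \<Longrightarrow> Q v = 0 \<Longrightarrow> v = 0"
    using tangent_space_isometry[OF q] by blast
  have injQ: "inj_on Q S"
    unfolding linear_injective_on_subspace_0[OF Q(1) S(1)] using Q(3) S(2) by auto
  have sub: "subspace (Q ` S)" using Q(1) S(1) by (rule linear_subspace_image)
  have dim: "dim (Q ` S) = dim (UNIV :: (real^'k) set)"
    using dim_image_eq[OF Q(1), of S] injQ S span_eq_iff[THEN iffD2, OF S(1)] by simp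
  obtain h k where h: "linear h" "linear k" "h ` Q ` S = (UNIV :: (real^'k) set)" "k ` (UNIV :: (real^'k) set) = Q ` S"
     "\<And>x. x \<in> Q ` S \<Longrightarrow> norm (h x) = norm x" "\<And>x. x \<in> UNIV \<Longrightarrow> norm (k x) = norm x"
     "\<And>x. x \<in> Q ` S \<Longrightarrow> k (h x) = x" "\<And>x. x \<in> UNIV \<Longrightarrow> h (k x) = x"
    by (rule isometries_subspaces[OF sub subspace_UNIV dim]) (rule that)
  note h = h(1-5) h(6)[OF UNIV_I] h(7) h(8)[OF UNIV_I]
  obtain r where r: "linear r" "\<And>v. v \<in> S \<Longrightarrow> r (Q v) = v" "range r \<subseteq> S"
    using linear_exists_left_inverse_on[OF Q(1) S(1) injQ] by (metis (full_types) rangeE subsetI UNIV_I image_subset_iff)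
  define f where "f = h \<circ> Q"
  define g where "g = r \<circ> k"
  have kS: "\<exists>v\<in>S. k x = Q v" for x using h(4) by (metis imageE UNIV_I image_eqI)
  have Qr: "Q (g x) = k x" for x
    using kS[of x] r(2) by (auto simp: g_def)
  have gS: "g x \<in> S" for x using r(3) by (auto simp: g_def)
  \<comment> \<open>Polarisation: k preserves norms and is linear, hence preserves inner
    products.\<close>
  have kk: "k x \<bullet> k y = x \<bullet> y" for x y
    by (metis (no_types) h(2,6) linear_add[OF h(2)] dot_norm)
  have gf: "g (f v) = v" if "v \<in> S" for v
    using that r(2) h(7) by (simp add: f_def g_def)
  have gg: "mink (g x) (g y) = x \<bullet> y" for x y
    using Q(2)[of "g x" "g y"] gS S(2) Qr kk by auto
  show ?thesis
  proof (rule that[of f g])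
    show "linear f" "linear g" unfolding f_def g_def using linear_compose Q h r by blast+
    show "range g = S" using gf gS by (metis image_subset_iff rangeI subsetI subset_antisym)
    show "mink v w = f v \<bullet> f w" if "v \<in> S" "w \<in> S" for v w
      using gg[of "f v" "f w"] gf that by simp
    show "f (g x) = x" for x using Qr h(8) by (simp add: f_def)
  qed (use gg gf in auto)
qed

text \<open>A is L expressed in orthonormal coordinates of its range. Hence the Gram determinant is
  (det A)^2 > 0; in the blow-up A also serves as the linear change of variables.\<close>

lemma gram_factorization:
  fixes L :: "real^'k \<Rightarrow> (real^'n) \<times> real"
  assumes q: "q \<in> hyperbolic_space" and L: "linear L" "inj L" "range L \<subseteq> tangent_space q"
  obtains A :: "real^'k^'k" where "det A \<noteq> 0" "\<And>x y. mink (L x) (L y) = (A *v x) \<bullet> (A *v y)"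
    "(\<chi> i j. mink (L (axis i 1)) (L (axis j 1))) = transpose A ** A"
proof -
  have "dim (range L) = CARD('k)"
    using dim_image_eq[OF L(1), of UNIV] L(2) by simp
  then obtain f :: "(real^'n) \<times> real \<Rightarrow> real^'k" where f: "linear f"
    "\<And>v w. v \<in> range L \<Longrightarrow> w \<in> range L \<Longrightarrow> mink v w = f v \<bullet> f w"
    "\<And>v. v \<in> range L \<Longrightarrow> f v = 0 \<Longrightarrow> v = 0"
    using tangent_subspace_isometry[OF q linear_subspace_image[OF L(1) subspace_UNIV] L(3)]
    by (metis linear_0)
  have lin: "linear (f \<circ> L)" using L(1) f(1) by (rule linear_compose)
  define A where "A = matrix (f \<circ> L)"
  have A: "A *v x = f (L x)" for x
    using matrix_vector_mul(2)[OF lin] by (simp add: A_def o_def fun_eq_iff)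
  have "x = 0" if "A *v x = 0" for x
    using that f(3)[of "L x"] L(2) linear_0[OF L(1)] A injD by (metis rangeI)
  then have "\<exists>B. B ** A = mat 1" by (subst matrix_left_invertible_ker) auto
  then have "det A \<noteq> 0" using invertible_det_nz invertible_left_inverse by blast
  moreover have eq: "mink (L x) (L y) = (A *v x) \<bullet> (A *v y)" for x y
    using f(2) A by auto
  moreover have "(\<chi> i j. mink (L (axis i 1)) (L (axis j 1))) = transpose A ** A"
    unfolding eq by (simp add: vec_eq_iff matrix_vector_mul_component inner_vec_def matrix_matrix_mult_def
        transpose_def matrix_vector_mult_basis column_def)
  ultimately show ?thesis using that[of A] by blast
qed

section \<open>Change of variables over an arbitrary finite index type\<close>

text \<open>The change of variables theorem of the library needs a well-ordered index type, which a type
  variable of class \<open>finite\<close> does not provide; \<open>'a ordered\<close> is a copy of \<open>'a\<close> with some well-order.\<close>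

typedef 'a ordered = "UNIV :: 'a set" morphisms unordered ordered ..

instantiation ordered :: (finite) "{finite, wellorder}"
begin

definition rank_ordered :: "'a ordered \<Rightarrow> nat" where
  "rank_ordered x = (SOME f. inj f) (unordered x)"

definition less_eq_ordered :: "'a ordered \<Rightarrow> 'a ordered \<Rightarrow> bool" where
  "x \<le> y \<longleftrightarrow> rank_ordered x \<le> rank_ordered y"

definition less_ordered :: "'a ordered \<Rightarrow> 'a ordered \<Rightarrow> bool" where
  "x < y \<longleftrightarrow> rank_ordered x < rank_ordered y"

instance
proof
  have "UNIV = range (ordered :: 'a \<Rightarrow> 'a ordered)"
    by (metis UNIV_eq_I ordered_cases rangeI)
  then show "finite (UNIV :: 'a ordered set)" by (metis finite finite_imageI)
  have "inj (SOME f :: 'a \<Rightarrow> nat. inj f)"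
    proof (rule someI_ex[where P = "\<lambda>f. inj f"])
    show "\<exists>f :: 'a \<Rightarrow> nat. inj f"
      using finite_imp_inj_to_nat_seg[OF finite[of "UNIV :: 'a set"]] by auto
  qed
  then have inj: "rank_ordered x = rank_ordered y \<longleftrightarrow> x = y" for x y :: "'a ordered"
    unfolding rank_ordered_def by (metis injD unordered_inject)
  fix x y z :: "'a ordered" and P :: "'a ordered \<Rightarrow> bool"
  show "x < y \<longleftrightarrow> x \<le> y \<and> \<not> y \<le> x" "x \<le> x" "x \<le> y \<Longrightarrow> y \<le> z \<Longrightarrow> x \<le> z"
    "x \<le> y \<Longrightarrow> y \<le> x \<Longrightarrow> x = y" "x \<le> y \<or> y \<le> x"
    using inj by (auto simp: less_eq_ordered_def less_ordered_def)
  show "P x" if "\<And>x. (\<And>y. y < x \<Longrightarrow> P y) \<Longrightarrow> P x"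
    by (induction "rank_ordered x" arbitrary: x rule: less_induct)
       (use that in \<open>auto simp: less_ordered_def\<close>)
qed

end

definition order_index :: "real^'k \<Rightarrow> real^('k ordered)" where
  "order_index x = (\<chi> i. x $ unordered i)"

definition unorder_index :: "real^('k ordered) \<Rightarrow> real^'k" where
  "unorder_index x = (\<chi> i. x $ ordered i)"

lemma unorder_index_inverse [simp]: "unorder_index (order_index x) = x"
  by (simp add: order_index_def unorder_index_def ordered_inverse vec_eq_iff)

lemma order_index_inverse [simp]: "order_index (unorder_index x) = x"
  by (simp add: order_index_def unorder_index_def unordered_inverse vec_eq_iff)

lemma order_index_eq_iff: "order_index x = order_index y \<longleftrightarrow> x = y"
  by (metis unorder_index_inverse)

lemma bij_unordered: "bij (unordered :: 'a ordered \<Rightarrow> 'a)"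
  by (metis bij_betw_def inj_def surj_def unordered_inject ordered_inverse UNIV_I)

lemma linear_order_index: "linear order_index"
  by (rule linearI) (auto simp: order_index_def vec_eq_iff)

lemma linear_unorder_index: "linear unorder_index"
  by (rule linearI) (auto simp: unorder_index_def vec_eq_iff)

lemma continuous_order_index [continuous_intros]: "continuous_on S order_index"
  by (simp add: linear_order_index linear_continuous_on linear_conv_bounded_linear[symmetric])

lemma continuous_unorder_index [continuous_intros]: "continuous_on S unorder_index"
  by (simp add: linear_unorder_index linear_continuous_on linear_conv_bounded_linear[symmetric])

lemma measurable_order_index [measurable]: "order_index \<in> borel_measurable borel"
  by (intro borel_measurable_continuous_onI continuous_order_index)

lemma measurable_unorder_index [measurable]: "unorder_index \<in> borel_measurable borel"
  by (intro borel_measurable_continuous_onI continuous_unorder_index)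

lemma prod_Basis_vec: "(\<Prod>b\<in>Basis. g (x \<bullet> b)) = (\<Prod>i\<in>UNIV. g ((x :: real^'k) $ i))"
proof -
  have "inj (\<lambda>i :: 'k. axis i (1::real))" by (auto intro!: injI simp: axis_eq_axis)
  then show ?thesis
    using prod.reindex[of "\<lambda>i :: 'k. axis i (1::real)" UNIV "\<lambda>b. g (x \<bullet> b)"]
    by (simp add: Basis_vec_def inner_axis UNION_singleton_eq_range)
qed

text \<open>Lebesgue measure is determined by its values on boxes, and relabelling coordinates only
  permutes the side lengths of a box.\<close>

lemma lborel_order_index: "lborel = distr lborel borel (order_index :: real^'k \<Rightarrow> _)"
proof (rule lborel_eqI)
  fix l u :: "real^('k ordered)"
  assume le: "\<And>b. b \<in> Basis \<Longrightarrow> l \<bullet> b \<le> u \<bullet> b"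
  have le': "l $ i \<le> u $ i" for i
    using le[of "axis i 1"] by (simp add: inner_axis axis_in_Basis_iff)
  have "order_index -` box l u = box (unorder_index l) (unorder_index u :: real^'k)"
    by (force simp: mem_box_cart order_index_def unorder_index_def ordered_inverse unordered_inverse
      dest: spec[of _ "unordered _"] spec[of _ "ordered _"])
  then have "emeasure (distr lborel borel order_index) (box l u) = emeasure lborel (box (unorder_index l) (unorder_index u :: real^'k))"
    by (simp add: emeasure_distr)
  also have "\<dots> = (\<Prod>b\<in>Basis. (unorder_index u - unorder_index l :: real^'k) \<bullet> b)"
    by (rule emeasure_lborel_box) (use le' in \<open>auto simp: Basis_vec_def inner_axis unorder_index_def\<close>)
  also have "(\<Prod>b\<in>Basis. (unorder_index u - unorder_index l :: real^'k) \<bullet> b) = (\<Prod>b\<in>Basis. (u - l) \<bullet> b)"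
    unfolding prod_Basis_vec[where g = "\<lambda>x. x"]
    by (rule prod.reindex_bij_betw[of unordered, symmetric, THEN trans])
       (auto simp: bij_unordered unorder_index_def unordered_inverse)
  finally show "emeasure (distr lborel borel order_index) (box l u) = (\<Prod>b\<in>Basis. (u - l) \<bullet> b)" .
qed simp

text \<open>Conjugation by f is a sign-preserving bijection between the permutations of the two
  index types, so the two Leibniz sums agree term by term.\<close>

lemma det_reindex:
  fixes A :: "real^'k^'k" and f :: "'l::finite \<Rightarrow> 'k"
  assumes f: "bij f"
  shows "det (\<chi> i j. A $ f i $ f j) = det A"
proof -
  let ?m = "map_permutation UNIV f" and ?n = "map_permutation UNIV (inv f)"
  have ap: "?m p (f i) = f (p i)" for p i
    using f by (simp add: map_permutation_def restrict_id_def bij_is_inj bij_is_surj)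
  have inj: "inj f" using f by (rule bij_is_inj)
  have "det (\<chi> i j. A $ f i $ f j) = (\<Sum>p | p permutes UNIV. of_int (sign p) * (\<Prod>i\<in>UNIV. A $ f i $ f (p i)))"
    by (simp add: det_def)
  also have "\<dots> = (\<Sum>p | p permutes UNIV. of_int (sign p) * (\<Prod>i\<in>UNIV. A $ i $ p i))"
  proof (rule sum.reindex_bij_witness[of _ ?n ?m])
    fix p :: "'l \<Rightarrow> 'l" assume p: "p \<in> {p. p permutes UNIV}"
    show "?n (?m p) = p" "?m p \<in> {p. p permutes UNIV}"
      using map_permutation_compose_inv[of f UNIV UNIV p "inv f"] f p inj map_permutation_permutes[of f UNIV UNIV p] by auto
    have "(\<Prod>i\<in>UNIV. A $ i $ ?m p i) = (\<Prod>i\<in>UNIV. A $ f i $ f (p i))"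
      using prod.reindex_bij_betw[OF f, of "\<lambda>i. A $ i $ ?m p i"] by (simp add: ap)
    then show "of_int (sign (?m p)) * (\<Prod>i\<in>UNIV. A $ i $ ?m p i) = of_int (sign p) * (\<Prod>i\<in>UNIV. A $ f i $ f (p i))"
      using sign_map_permutation[of f UNIV p] inj p by simp
  next
    fix p :: "'k \<Rightarrow> 'k" assume p: "p \<in> {p. p permutes UNIV}"
    show "?m (?n p) = p" "?n p \<in> {p. p permutes UNIV}"
      using map_permutation_compose_inv[of "inv f" UNIV UNIV p f] map_permutation_permutes[of "inv f" UNIV UNIV p]
        f p bij_imp_bij_inv[OF f] surj_f_inv_f[OF bij_is_surj[OF f]] by auto
  qed
  finally show ?thesis by (simp add: det_def)
qed

text \<open>\<open>has_measure_differentiable_image\<close> relates finite measure of the image to a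
  gauge integral of the Jacobian. Splitting on whether the nonnegative integral is finite turns this
  into an equation in \<open>ennreal\<close>.\<close>

lemma emeasure_image_ordered:
  fixes g :: "real^'n::{finite,wellorder} \<Rightarrow> real^'n::_"
  assumes S: "S \<in> sets borel" "g ` S \<in> sets borel"
    and der: "\<And>x. x \<in> S \<Longrightarrow> (g has_derivative g' x) (at x within S)"
    and inj: "inj_on g S"
    and meas: "(\<lambda>x. indicator S x * \<bar>det (matrix (g' x))\<bar>) \<in> borel_measurable borel"
  shows "emeasure lborel (g ` S) = (\<integral>\<^sup>+x. ennreal (indicator S x * \<bar>det (matrix (g' x))\<bar>) \<partial>lborel)"
proof -
  let ?d = "\<lambda>x. \<bar>det (matrix (g' x))\<bar>"
  have S': "S \<in> sets lebesgue" and gS: "g ` S \<in> sets lebesgue" using S by simp_all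
  note iff = has_measure_differentiable_image[OF S' der inj]
  have res: "((\<lambda>x. indicator S x * ?d x) has_integral r) UNIV \<longleftrightarrow> (?d has_integral r) S" for r
    unfolding has_integral_restrict_UNIV[of S ?d, symmetric]
    by (rule arg_cong[where f = "\<lambda>f. (f has_integral r) UNIV"]) (auto simp: indicator_def)
  consider r where "(\<integral>\<^sup>+x. ennreal (indicator S x * ?d x) \<partial>lborel) = ennreal r" "0 \<le> r"
    | "(\<integral>\<^sup>+x. ennreal (indicator S x * ?d x) \<partial>lborel) = \<infinity>"
    by (cases "\<integral>\<^sup>+x. ennreal (indicator S x * ?d x) \<partial>lborel" rule: ennreal_cases) auto
  then show ?thesis
  proof cases
    case 1
    then have "((\<lambda>x. indicator S x * ?d x) has_integral r) UNIV"
      using meas by (intro nn_integral_has_integral) auto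
    then have "g ` S \<in> lmeasurable" "measure lebesgue (g ` S) = r" using iff[of r] res by auto
    then have "emeasure lebesgue (g ` S) = ennreal r" using emeasure_eq_ennreal_measure fmeasurableD2 by metis
    then show ?thesis using 1 S(2) by simp
  next
    case 2
    \<comment> \<open>Were the image of finite measure, the equivalence read backwards would make
      the Jacobian integral finite.\<close>
    have "emeasure lborel (g ` S) = \<infinity>"
    proof (rule ccontr)
      assume "emeasure lborel (g ` S) \<noteq> \<infinity>"
      then have "g ` S \<in> lmeasurable" using S(2) gS by (auto simp: fmeasurable_def top.not_eq_extremum)
      then have "((\<lambda>x. indicator S x * ?d x) has_integral measure lebesgue (g ` S)) UNIV"
        using iff res by auto
      then have "(\<integral>\<^sup>+x. ennreal (indicator S x * ?d x) \<partial>lborel) = ennreal (measure lebesgue (g ` S))"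
        using meas by (intro nn_integral_has_integral_lborel) auto
      then show False using 2 by simp
    qed
    then show ?thesis using 2 by simp
  qed
qed

text \<open>Conjugation with the measure-preserving \<open>order_index\<close> reduces to the
  well-ordered index type; by \<open>det_reindex\<close> the Jacobian determinant does not
  change.\<close>

lemma emeasure_differentiable_image:
  fixes g :: "real^'k \<Rightarrow> real^'k"
  assumes S: "S \<in> sets borel" "g ` S \<in> sets borel"
    and der: "\<And>x. x \<in> S \<Longrightarrow> (g has_derivative g' x) (at x within S)"
    and inj: "inj_on g S"
    and meas: "(\<lambda>x. indicator S x * \<bar>det (matrix (g' x))\<bar>) \<in> borel_measurable borel"
  shows "emeasure lborel (g ` S) = (\<integral>\<^sup>+x. ennreal (indicator S x * \<bar>det (matrix (g' x))\<bar>) \<partial>lborel)"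
proof -
  let ?o = "order_index :: real^'k \<Rightarrow> _" and ?u = "unorder_index :: _ \<Rightarrow> real^'k"
  define h where "h = ?o \<circ> g \<circ> ?u"
  define h' where "h' x = ?o \<circ> g' (?u x) \<circ> ?u" for x
  define T where "T = ?o ` S"
  have T: "T = ?u -` S" by (force simp: T_def image_iff)
  have hT: "h ` T = ?u -` (g ` S)"
  proof (intro set_eqI iffI)
    fix y assume "y \<in> ?u -` (g ` S)"
    then obtain x where x: "x \<in> S" "?u y = g x" by auto
    have "y = ?o (?u y)" by simp
    also have "\<dots> = h (?o x)" using x(2) by (simp add: h_def)
    finally show "y \<in> h ` T" using x(1) by (auto simp: T_def)
  qed (auto simp: h_def T_def)
  have uT: "?u ` T = S" by (auto simp: T_def image_image)
  have det: "det (matrix (h' (?o x))) = det (matrix (g' x))" for x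
  proof -
    have "matrix (h' (?o x)) = (\<chi> i j. matrix (g' x) $ unordered i $ unordered j)"
    proof -
      have "?u (axis j 1) = axis (unordered j) 1" for j
        by (auto simp: unorder_index_def axis_def vec_eq_iff ordered_inverse unordered_inverse)
      then show ?thesis
        by (simp add: matrix_def h'_def) (simp add: order_index_def)
    qed
    then show ?thesis by (simp add: det_reindex[OF bij_unordered])
  qed
  have "emeasure lborel (h ` T) = (\<integral>\<^sup>+x. ennreal (indicator T x * \<bar>det (matrix (h' x))\<bar>) \<partial>lborel)"
  proof (rule emeasure_image_ordered)
    show "T \<in> sets borel"
      unfolding T using measurable_sets[OF measurable_unorder_index] S by auto
    show "h ` T \<in> sets borel"
      unfolding hT using measurable_sets[OF measurable_unorder_index] S by auto
    show "(h has_derivative h' x) (at x within T)" if "x \<in> T" for x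
      unfolding h_def h'_def
    proof (intro diff_chain_within)
      show "(?u has_derivative ?u) (at x within T)"
        using linear_unorder_index bounded_linear_imp_has_derivative linear_conv_bounded_linear by blast
      show "(g has_derivative g' (?u x)) (at (?u x) within ?u ` T)"
        unfolding uT using that der T by simp
      show "(?o has_derivative ?o) (at (g (?u x)) within g ` ?u ` T)"
        using linear_order_index bounded_linear_imp_has_derivative linear_conv_bounded_linear by blast
    qed
    show "inj_on h T"
      using inj order_index_eq_iff unfolding h_def T_def inj_on_def by auto
    have "(\<lambda>x. indicator T x * \<bar>det (matrix (h' x))\<bar>) = (\<lambda>x. indicator S x * \<bar>det (matrix (g' x))\<bar>) \<circ> ?u"
      using det[of "?u _"] by (auto simp: fun_eq_iff T indicator_def)
    then show "(\<lambda>x. indicator T x * \<bar>det (matrix (h' x))\<bar>) \<in> borel_measurable borel"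
      using measurable_comp[OF measurable_unorder_index meas] by simp
  qed
  also have "\<dots> = (\<integral>\<^sup>+x. ennreal (indicator T x * \<bar>det (matrix (h' x))\<bar>) \<partial>distr lborel borel ?o)"
    by (simp flip: lborel_order_index)
  also have "\<dots> = (\<integral>\<^sup>+x. ennreal (indicator T (?o x) * \<bar>det (matrix (h' (?o x)))\<bar>) \<partial>lborel)"
  proof -
    have "(\<lambda>x. indicator T x * \<bar>det (matrix (h' x))\<bar>) = (\<lambda>x. indicator S x * \<bar>det (matrix (g' x))\<bar>) \<circ> ?u"
      using det[of "?u _"] by (auto simp: fun_eq_iff T indicator_def)
    then have [measurable]: "(\<lambda>x. indicator T x * \<bar>det (matrix (h' x))\<bar>) \<in> borel_measurable borel"
      using measurable_comp[OF measurable_unorder_index meas] by simp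
    show ?thesis by (rule nn_integral_distr) simp_all
  qed
  also have "\<dots> = (\<integral>\<^sup>+x. ennreal (indicator S x * \<bar>det (matrix (g' x))\<bar>) \<partial>lborel)"
    by (intro nn_integral_cong) (simp add: det T indicator_def)
  also have "emeasure lborel (h ` T) = emeasure (distr lborel borel ?o) (h ` T)"
    by (simp flip: lborel_order_index)
  also have "\<dots> = emeasure lborel (g ` S)"
    using measurable_sets[OF measurable_unorder_index, of "g ` S"] S(2)
    by (subst emeasure_distr) (auto simp: hT vimage_def)
  finally show ?thesis .
qed

section \<open>Continuously differentiable functions and integration by parts\<close>

text \<open>Derivatives are two-sided, so the notion is meant for open V. Continuity is required
  direction by direction, which in finite dimension is the usual C^1 condition and is easy to check
  from explicit formulas.\<close>

definition C1_on :: "'a::real_normed_vector set \<Rightarrow> ('a \<Rightarrow> real) \<Rightarrow> bool" where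
  "C1_on V h \<longleftrightarrow>
     (\<exists>h'. (\<forall>x\<in>V. (h has_derivative h' x) (at x)) \<and> (\<forall>v. continuous_on V (\<lambda>x. h' x v)))"

lemma C1_onI:
  assumes "\<And>x. x \<in> V \<Longrightarrow> (h has_derivative h' x) (at x)" "\<And>v. continuous_on V (\<lambda>x. h' x v)"
  shows "C1_on V h"
  using assms unfolding C1_on_def by blast

lemma C1_on_frechet_derivative:
  assumes "C1_on V h"
  shows "x \<in> V \<Longrightarrow> (h has_derivative frechet_derivative h (at x)) (at x)"
    and "continuous_on V (\<lambda>x. frechet_derivative h (at x) v)"
proof -
  obtain h' where h': "\<And>x. x \<in> V \<Longrightarrow> (h has_derivative h' x) (at x)" "\<And>v. continuous_on V (\<lambda>x. h' x v)"
    using assms unfolding C1_on_def by blast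
  have eq: "frechet_derivative h (at x) = h' x" if "x \<in> V" for x
    using frechet_derivative_at[OF h'(1)[OF that]] by simp
  show "x \<in> V \<Longrightarrow> (h has_derivative frechet_derivative h (at x)) (at x)"
    using eq h'(1) by simp
  show "continuous_on V (\<lambda>x. frechet_derivative h (at x) v)"
    using h'(2)[of v] eq by (simp cong: continuous_on_cong)
qed

lemma C1_on_imp_continuous_on: "C1_on V h \<Longrightarrow> continuous_on V h"
  unfolding C1_on_def
  by (meson continuous_at_imp_continuous_on has_derivative_continuous)

lemma C1_on_const: "C1_on V (\<lambda>x. c)"
  by (rule C1_onI[where h' = "\<lambda>x v. 0"]) auto

lemma C1_on_add:
  assumes "C1_on V f" "C1_on V g"
  shows "C1_on V (\<lambda>x. f x + g x)"
proof -
  note f = C1_on_frechet_derivative[OF assms(1)] and g = C1_on_frechet_derivative[OF assms(2)]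
  show ?thesis
    by (rule C1_onI, rule has_derivative_add[OF f(1) g(1)]) (auto intro: continuous_on_add f(2) g(2))
qed

lemma C1_on_mult:
  assumes "C1_on V f" "C1_on V g"
  shows "C1_on V (\<lambda>x. f x * g x)"
proof -
  note f = C1_on_frechet_derivative[OF assms(1)] and g = C1_on_frechet_derivative[OF assms(2)]
  show ?thesis
    by (rule C1_onI, rule has_derivative_mult[OF f(1) g(1)])
       (auto intro!: continuous_on_add continuous_on_mult f(2) g(2) assms[THEN C1_on_imp_continuous_on])
qed

lemma C1_on_minus: "C1_on V f \<Longrightarrow> C1_on V (\<lambda>x. - f x)"
  using C1_on_mult[OF C1_on_const[of V "-1"], of f] by simp

lemma C1_on_diff: "C1_on V f \<Longrightarrow> C1_on V g \<Longrightarrow> C1_on V (\<lambda>x. f x - g x)"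
  using C1_on_add[OF _ C1_on_minus, of V f g] by simp

lemma C1_on_sum: "(\<And>i. i \<in> I \<Longrightarrow> C1_on V (f i)) \<Longrightarrow> C1_on V (\<lambda>x. \<Sum>i\<in>I. f i x)"
  by (induction I rule: infinite_finite_induct) (auto intro: C1_on_const C1_on_add)

lemma C1_on_prod: "(\<And>i. i \<in> I \<Longrightarrow> C1_on V (f i)) \<Longrightarrow> C1_on V (\<lambda>x. \<Prod>i\<in>I. f i x)"
  by (induction I rule: infinite_finite_induct) (auto intro: C1_on_const C1_on_mult)

lemma C1_on_compose_real:
  fixes \<phi> \<phi>' :: "real \<Rightarrow> real"
  assumes f: "C1_on V f" and \<phi>: "\<And>x. x \<in> V \<Longrightarrow> (\<phi> has_real_derivative \<phi>' (f x)) (at (f x))"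
    and cont: "continuous_on (f ` V) \<phi>'"
  shows "C1_on V (\<lambda>x. \<phi> (f x))"
proof (rule C1_onI)
  note f' = C1_on_frechet_derivative[OF f]
  show "((\<lambda>x. \<phi> (f x)) has_derivative (\<lambda>v. frechet_derivative f (at x) v * \<phi>' (f x))) (at x)" if "x \<in> V" for x
    using has_derivative_compose[OF f'(1)[OF that] \<phi>[OF that, unfolded has_field_derivative_def]]
    by (simp add: mult.commute)
  show "continuous_on V (\<lambda>x. frechet_derivative f (at x) v * \<phi>' (f x))" for v
    using continuous_on_compose[OF C1_on_imp_continuous_on[OF f] cont]
    by (intro continuous_on_mult f'(2)) (simp add: o_def)
qed

lemma C1_on_cong:
  assumes "open V" "\<And>x. x \<in> V \<Longrightarrow> f x = g x"
  shows "C1_on V f \<longleftrightarrow> C1_on V g"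
proof -
  have "C1_on V g" if "C1_on V f" "\<And>x. x \<in> V \<Longrightarrow> f x = g x" for f g
  proof (rule C1_onI)
    show "(g has_derivative frechet_derivative f (at x)) (at x)" if "x \<in> V" for x
      by (rule has_derivative_transform_within_open[OF C1_on_frechet_derivative(1)[OF \<open>C1_on V f\<close>] assms(1)])
        (use that \<open>\<And>x. x \<in> V \<Longrightarrow> f x = g x\<close> in auto)
  qed (rule C1_on_frechet_derivative(2)[OF \<open>C1_on V f\<close>])
  then show ?thesis using assms(2) by metis
qed

lemma C1_on_open_Un:
  assumes "open U" "open W" "C1_on U f" "C1_on W f"
  shows "C1_on (U \<union> W) f"
  by (rule C1_onI) (use assms C1_on_frechet_derivative in \<open>auto intro!: continuous_on_open_Un\<close>)

lemma frechet_derivative_eq_0_if_locally_0: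
  assumes "open U" "x \<in> U" "\<And>y. y \<in> U \<Longrightarrow> f y = (0::real)"
  shows "frechet_derivative f (at x) v = 0"
proof -
  have "(f has_derivative (\<lambda>v. 0)) (at x)"
    by (rule has_derivative_transform_within_open[OF _ assms(1,2)]) (use assms(3) in auto)
  then show ?thesis using frechet_derivative_at by metis
qed

text \<open>By translation invariance every difference quotient of H along v has integral zero. The
  mean value theorem bounds the quotients by a constant on a fixed compact set, so dominated
  convergence passes to the derivative, without iterated integrals or a choice of
  coordinates.\<close>

lemma integral_directional_derivative_eq_0:
  fixes H :: "'a::euclidean_space \<Rightarrow> real"
  assumes H: "C1_on UNIV H" and K: "compact K" and 0: "\<And>x. x \<notin> K \<Longrightarrow> H x = 0"
  shows "integrable lborel (\<lambda>x. frechet_derivative H (at x) v)" (is ?integrable)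
    and "(\<integral>x. frechet_derivative H (at x) v \<partial>lborel) = 0"
proof -
  define D where "D x = frechet_derivative H (at x) v" for x
  note H' = C1_on_frechet_derivative[OF H]
  have contD: "continuous_on UNIV D" unfolding D_def by (rule H'(2))
  have contH: "continuous_on UNIV H" using H by (rule C1_on_imp_continuous_on)
  have D0: "D x = 0" if "x \<notin> K" for x
    unfolding D_def using that 0 K
    by (intro frechet_derivative_eq_0_if_locally_0[of "- K"]) (auto intro: compact_imp_closed)
  have "compact (D ` K)" by (rule compact_continuous_image[OF continuous_on_subset[OF contD] K]) simp
  then obtain B where "\<forall>y\<in>D ` K. norm y \<le> B" using compact_imp_bounded bounded_iff by metis
  then have B: "\<bar>D x\<bar> \<le> \<bar>B\<bar>" for x using D0[of x] by (cases "x \<in> K") force+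
  have intg: "integrable lborel f" if "continuous_on UNIV f" "\<And>x. x \<notin> K \<Longrightarrow> f x = 0" for f :: "'a \<Rightarrow> real"
  proof -
    have "set_integrable lborel K f"
      unfolding set_integrable_def
      by (rule borel_integrable_compact[OF K continuous_on_subset[OF that(1)]]) simp
    also have "(\<lambda>x. indicator K x *\<^sub>R f x) = f" using that(2) by (auto simp: indicator_def fun_eq_iff)
    ultimately show ?thesis by (simp add: set_integrable_def)
  qed
  have iD: "integrable lborel D" and iH: "integrable lborel H"
    using contD D0 contH 0 by (auto intro: intg)
  show ?integrable using iD by (simp add: D_def[abs_def])
  define q where "q n x = real (Suc n) * (H (x + (1 / real (Suc n)) *\<^sub>R v) - H x)" for n x
  \<comment> \<open>The step lengths 1 / (n + 1) are at most 1, so every difference quotient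
    vanishes outside the |v|-neighbourhood of K.\<close>
  define K' where "K' = {x + y |x y. x \<in> K \<and> y \<in> cball 0 (norm v)}"
  have K': "compact K'" unfolding K'_def by (rule compact_sums[OF K]) simp
  have line: "((\<lambda>t. H (x + t *\<^sub>R v)) has_real_derivative D (x + t *\<^sub>R v)) (at t)" for x t
  proof -
    have "((\<lambda>t. x + t *\<^sub>R v) has_derivative (\<lambda>h. h *\<^sub>R v)) (at t)"
      by (auto intro!: derivative_eq_intros)
    from has_derivative_compose[OF this H'(1)[OF UNIV_I]]
    have "((\<lambda>t. H (x + t *\<^sub>R v)) has_derivative (\<lambda>h. frechet_derivative H (at (x + t *\<^sub>R v)) (h *\<^sub>R v))) (at t)" .
    moreover have "frechet_derivative H (at (x + t *\<^sub>R v)) (h *\<^sub>R v) = D (x + t *\<^sub>R v) * h" for h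
      using linear_scale[OF has_derivative_linear[OF H'(1)[OF UNIV_I]]] by (simp add: D_def mult.commute)
    ultimately show ?thesis by (simp add: has_field_derivative_def)
  qed
  have mvt: "\<exists>s. 0 < s \<and> s < 1 / real (Suc n) \<and> q n x = D (x + s *\<^sub>R v)" for n x
  proof -
    have "\<exists>s. 0 < s \<and> s < 1 / real (Suc n) \<and>
        H (x + (1 / real (Suc n)) *\<^sub>R v) - H (x + 0 *\<^sub>R v) = (1 / real (Suc n) - 0) * D (x + s *\<^sub>R v)"
      by (rule MVT2) (use line in auto)
    then show ?thesis by (auto simp: q_def field_simps)
  qed
  have bound: "norm (q n x) \<le> \<bar>B\<bar> * indicator K' x" for n x
  proof (cases "x \<in> K'")
    case True
    then show ?thesis using mvt[of n x] B by (auto simp: indicator_def)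
  next
    case False
    obtain s where s: "0 < s" "s < 1 / real (Suc n)" "q n x = D (x + s *\<^sub>R v)" using mvt by blast
    have "1 / real (Suc n) \<le> 1" by simp
    then have "s \<le> 1" using s(2) by linarith
    have "x + s *\<^sub>R v \<notin> K"
    proof
      assume *: "x + s *\<^sub>R v \<in> K"
      have "s * norm v \<le> norm v" using \<open>s \<le> 1\<close> by (simp add: mult_left_le_one_le s(1) less_imp_le)
      then have "- (s *\<^sub>R v) \<in> cball 0 (norm v)" using s(1) by simp
      then have "(x + s *\<^sub>R v) + - (s *\<^sub>R v) \<in> K'" unfolding K'_def using * by blast
      then show False using False by simp
    qed
    then show ?thesis using s(3) D0 False by simp
  qed
  have lim: "(\<lambda>n. q n x) \<longlonglongrightarrow> D x" for x
  proof -
    have "(\<lambda>h. (H (x + (0 + h) *\<^sub>R v) - H (x + 0 *\<^sub>R v)) / h) \<midarrow>0\<rightarrow> D (x + 0 *\<^sub>R v)"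
      using line[of x 0] unfolding DERIV_def .
    moreover have "filterlim (\<lambda>n. 1 / real (Suc n)) (at 0) sequentially"
      using LIMSEQ_inverse_real_of_nat by (auto simp: filterlim_at inverse_eq_divide)
    ultimately have "(\<lambda>n. (H (x + (0 + 1 / real (Suc n)) *\<^sub>R v) - H (x + 0 *\<^sub>R v)) / (1 / real (Suc n))) \<longlonglongrightarrow> D (x + 0 *\<^sub>R v)"
      by (rule filterlim_compose)
    then show ?thesis by (simp add: q_def mult.commute)
  qed
  have iq0: "integral\<^sup>L lborel (q n) = 0" for n
  proof -
    let ?c = "(1 / real (Suc n)) *\<^sub>R v"
    have *: "integrable lborel (\<lambda>x. H (x + ?c)) \<and> (\<integral>x. H (x + ?c) \<partial>lborel) = (\<integral>x. H x \<partial>lborel)"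
    proof -
      have m: "H \<in> borel_measurable borel" using contH by (rule borel_measurable_continuous_onI)
      have d: "distr lborel borel (\<lambda>x. x + ?c) = lborel"
      proof -
        have "(\<lambda>x. x + ?c) = (+) ?c" by (simp add: fun_eq_iff add.commute)
        then show ?thesis using lborel_distr_plus[of ?c] by simp
      qed
      have "integrable (distr lborel borel (\<lambda>x. x + ?c)) H" using iH d by simp
      then have 1: "integrable lborel (\<lambda>x. H (x + ?c))" using m by (subst (asm) integrable_distr_eq) auto
      have "(\<integral>x. H x \<partial>distr lborel borel (\<lambda>x. x + ?c)) = (\<integral>x. H (x + ?c) \<partial>lborel)"
        using m by (subst integral_distr) auto
      then show ?thesis using 1 d by simp
    qed
    then show ?thesis unfolding q_def using iH by simp
  qed
  have "(\<lambda>n. integral\<^sup>L lborel (q n)) \<longlonglongrightarrow> integral\<^sup>L lborel D"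
  proof (rule integral_dominated_convergence)
    show "D \<in> borel_measurable lborel" using iD by auto
    show "q n \<in> borel_measurable lborel" for n
      unfolding q_def using contH
      by (intro borel_measurable_continuous_onI continuous_intros continuous_on_compose2[OF contH]
        | simp)+
    show "integrable lborel (\<lambda>x. \<bar>B\<bar> * indicator K' x)"
      using K' emeasure_bounded_finite[OF compact_imp_bounded[OF K']]
      by (intro integrable_mult_right integrable_real_indicator) (auto simp: borel_compact)
    show "AE x in lborel. (\<lambda>n. q n x) \<longlonglongrightarrow> D x" using lim by simp
    show "AE x in lborel. norm (q n x) \<le> \<bar>B\<bar> * indicator K' x" for n using bound by simp
  qed
  then have "(\<lambda>n. 0) \<longlonglongrightarrow> integral\<^sup>L lborel D" unfolding iq0 .
  then show "(\<integral>x. frechet_derivative H (at x) v \<partial>lborel) = 0"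
    by (simp add: LIMSEQ_const_iff D_def[abs_def])
qed

section \<open>Radial integrals\<close>

text \<open>Polar coordinates without a measure on the sphere: the half-lines form an
  intersection-stable generator, the ball of radius a has volume omega_k a^k, and the density is the
  derivative of that volume.\<close>

lemma distr_norm_lborel:
  "distr lborel borel (norm :: real^'k \<Rightarrow> real) =
   density lborel (\<lambda>s. ennreal (unit_ball_vol (real CARD('k)) * (real CARD('k) * s ^ (CARD('k) - 1))) * indicator {0..} s)"
  (is "?M = density lborel ?f")
proof (rule measure_eqI_generator_eq[where E = "range (\<lambda>a. {..a})" and A = "\<lambda>n. {..real n}" and \<Omega> = UNIV])
  let ?\<omega> = "unit_ball_vol (real CARD('k))"
  have M: "emeasure ?M {..a} = (if a < 0 then 0 else ennreal (?\<omega> * a ^ CARD('k)))" for a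
  proof -
    have "emeasure ?M {..a} = emeasure lborel {y :: real^'k. norm y \<le> a}"
      by (subst emeasure_distr) (auto simp: vimage_def)
    also have "\<dots> = (if a < 0 then 0 else ennreal (?\<omega> * a ^ CARD('k)))"
    proof (cases "a < 0")
      case True
      then have e: "{y :: real^'k. norm y \<le> a} = {}" by (auto simp: not_le intro: less_le_trans[OF _ norm_ge_zero])
      show ?thesis unfolding e using True by simp
    next
      case False
      then have "{y :: real^'k. norm y \<le> a} = cball 0 a" by auto
      then show ?thesis using emeasure_cball[of a "0 :: real^'k"] False by simp
    qed
    finally show ?thesis .
  qed
  show "Int_stable (range (\<lambda>a :: real. {..a}))"
  proof (rule Int_stableI)
    fix a b :: "real set" assume "a \<in> range atMost" "b \<in> range atMost"
    then obtain r s where "a = {..r}" "b = {..s}" by auto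
    then have "a \<inter> b = {..min r s}" by auto
    then show "a \<inter> b \<in> range atMost" by simp
  qed
  show "range (\<lambda>a :: real. {..a}) \<subseteq> Pow UNIV" by auto
  show "sets ?M = sigma_sets UNIV (range (\<lambda>a. {..a}))"
    "sets (density lborel ?f) = sigma_sets UNIV (range (\<lambda>a. {..a}))"
    using arg_cong[OF borel_eq_atMost[where 'a = real], of sets] by simp_all
  show "range (\<lambda>n. {..real n}) \<subseteq> range (\<lambda>a :: real. {..a})" by auto
  show "(\<Union>n. {..real n}) = UNIV" using real_arch_simple by auto
  show "emeasure ?M {..real n} \<noteq> \<infinity>" for n unfolding M by simp
  fix X :: "real set" assume "X \<in> range (\<lambda>a. {..a})"
  then obtain a where X: "X = {..a}" by auto
  have "emeasure (density lborel ?f) X = (\<integral>\<^sup>+s. ?f s * indicator {..a} s \<partial>lborel)"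
    unfolding X by (subst emeasure_density) auto
  also have "\<dots> = (if a < 0 then 0 else ennreal (?\<omega> * a ^ CARD('k)))"
  proof (cases "a < 0")
    case True
    then have "(\<integral>\<^sup>+s. ?f s * indicator {..a} s \<partial>lborel) = (\<integral>\<^sup>+(s::real). 0 \<partial>lborel)"
      by (intro nn_integral_cong) (auto simp: indicator_def)
    then show ?thesis using True by simp
  next
    case False
    have "(\<integral>\<^sup>+s. ?f s * indicator {..a} s \<partial>lborel) =
        (\<integral>\<^sup>+s. ennreal (?\<omega> * (real CARD('k) * s ^ (CARD('k) - 1))) * indicator {0..a} s \<partial>lborel)"
      by (intro nn_integral_cong) (auto simp: indicator_def)
    also have "\<dots> = ennreal (?\<omega> * a ^ CARD('k) - ?\<omega> * 0 ^ CARD('k))"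
      by (rule nn_integral_FTC_Icc) (use False in \<open>auto intro!: derivative_eq_intros\<close>)
    finally show ?thesis using False by simp
  qed
  finally show "emeasure ?M X = emeasure (density lborel ?f) X" by (simp add: M X)
qed

lemma nn_integral_radial:
  fixes f :: "real \<Rightarrow> ennreal"
  assumes [measurable]: "f \<in> borel_measurable borel"
  shows "(\<integral>\<^sup>+y. f (norm (y :: real^'k)) \<partial>lborel) =
    ennreal (unit_ball_vol (real CARD('k)) * real CARD('k)) * (\<integral>\<^sup>+s. ennreal (s ^ (CARD('k) - 1)) * f s * indicator {0..} s \<partial>lborel)"
proof -
  have "(\<integral>\<^sup>+y. f (norm (y :: real^'k)) \<partial>lborel) = (\<integral>\<^sup>+s. f s \<partial>distr lborel borel (norm :: real^'k \<Rightarrow> real))"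
    by (rule nn_integral_distr[symmetric]) auto
  also have "\<dots> = (\<integral>\<^sup>+s. ennreal (unit_ball_vol (real CARD('k)) * (real CARD('k) * s ^ (CARD('k) - 1))) * indicator {0..} s * f s \<partial>lborel)"
    unfolding distr_norm_lborel by (subst nn_integral_density) auto
  also have "\<dots> = (\<integral>\<^sup>+s. ennreal (unit_ball_vol (real CARD('k)) * real CARD('k)) * (ennreal (s ^ (CARD('k) - 1)) * f s * indicator {0..} s) \<partial>lborel)"
    by (intro nn_integral_cong) (auto simp: indicator_def ennreal_mult' ennreal_mult'' mult.assoc)
  also have "\<dots> = ennreal (unit_ball_vol (real CARD('k)) * real CARD('k)) * (\<integral>\<^sup>+s. ennreal (s ^ (CARD('k) - 1)) * f s * indicator {0..} s \<partial>lborel)"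
    by (rule nn_integral_cmult) auto
  finally show ?thesis .
qed

section \<open>Second derivatives\<close>

text \<open>The mean value theorem is applied first in direction v to the increment of f along w,
  then in direction w to the derivative of f along v.\<close>

lemma second_difference_mean_value:
  fixes f :: "'a::real_normed_vector \<Rightarrow> real"
  assumes f': "\<And>y. y \<in> V \<Longrightarrow> (f has_derivative f' y) (at y)"
    and fv: "\<And>y. y \<in> V \<Longrightarrow> ((\<lambda>y. f' y v) has_derivative fv y) (at y)"
    and t: "0 < t" and seg: "\<And>r s. 0 \<le> r \<Longrightarrow> r \<le> t \<Longrightarrow> 0 \<le> s \<Longrightarrow> s \<le> t \<Longrightarrow> x + r *\<^sub>R v + s *\<^sub>R w \<in> V"
  obtains r s where "0 < r" "r < t" "0 < s" "s < t"
    "f (x + t *\<^sub>R v + t *\<^sub>R w) - f (x + t *\<^sub>R v) - f (x + t *\<^sub>R w) + f x = t * t * fv (x + r *\<^sub>R v + s *\<^sub>R w) w"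
proof -
  have lin: "((\<lambda>r. g (y + r *\<^sub>R u)) has_real_derivative g' u) (at r)"
    if "(g has_derivative g') (at (y + r *\<^sub>R u))" for g :: "'a \<Rightarrow> real" and g' y u r
  proof -
    have "((\<lambda>r. y + r *\<^sub>R u) has_derivative (\<lambda>h. h *\<^sub>R u)) (at r)"
      by (auto intro!: derivative_eq_intros)
    from has_derivative_compose[OF this that]
    have "((\<lambda>r. g (y + r *\<^sub>R u)) has_derivative (\<lambda>h. g' (h *\<^sub>R u))) (at r)" .
    moreover have "g' (h *\<^sub>R u) = g' u * h" for h
      using linear_scale[OF has_derivative_linear[OF that]] by (simp add: mult.commute)
    ultimately show ?thesis by (simp add: has_field_derivative_def)
  qed
  define \<phi> where "\<phi> r = f ((x + t *\<^sub>R w) + r *\<^sub>R v) - f (x + r *\<^sub>R v)" for r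
  have "\<exists>r. 0 < r \<and> r < t \<and> \<phi> t - \<phi> 0 = (t - 0) * (f' ((x + t *\<^sub>R w) + r *\<^sub>R v) v - f' (x + r *\<^sub>R v) v)"
  proof (rule MVT2[OF t])
    fix r assume r: "0 \<le> r" "r \<le> t"
    have "(x + t *\<^sub>R w) + r *\<^sub>R v \<in> V" "x + r *\<^sub>R v \<in> V"
      using seg[of r t] seg[of r 0] r t by (auto simp: algebra_simps)
    then show "(\<phi> has_real_derivative (f' ((x + t *\<^sub>R w) + r *\<^sub>R v) v - f' (x + r *\<^sub>R v) v)) (at r)"
      unfolding \<phi>_def by (intro DERIV_diff lin f')
  qed
  then obtain r where r: "0 < r" "r < t" "\<phi> t - \<phi> 0 = t * (f' ((x + t *\<^sub>R w) + r *\<^sub>R v) v - f' (x + r *\<^sub>R v) v)" by auto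
  have "\<exists>s. 0 < s \<and> s < t \<and> f' ((x + r *\<^sub>R v) + t *\<^sub>R w) v - f' ((x + r *\<^sub>R v) + 0 *\<^sub>R w) v = (t - 0) * fv ((x + r *\<^sub>R v) + s *\<^sub>R w) w"
  proof (rule MVT2[OF t])
    fix s assume s: "0 \<le> s" "s \<le> t"
    show "((\<lambda>s. f' ((x + r *\<^sub>R v) + s *\<^sub>R w) v) has_real_derivative fv ((x + r *\<^sub>R v) + s *\<^sub>R w) w) (at s)"
      by (rule lin) (use fv seg[of r s] r s in auto)
  qed
  then obtain s where s: "0 < s" "s < t" "f' ((x + r *\<^sub>R v) + t *\<^sub>R w) v - f' (x + r *\<^sub>R v) v = t * fv ((x + r *\<^sub>R v) + s *\<^sub>R w) w" by auto
  have "f (x + t *\<^sub>R v + t *\<^sub>R w) - f (x + t *\<^sub>R v) - f (x + t *\<^sub>R w) + f x = \<phi> t - \<phi> 0"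
    by (simp add: \<phi>_def algebra_simps)
  also have "\<dots> = t * (t * fv (x + r *\<^sub>R v + s *\<^sub>R w) w)"
    unfolding r(3) s(3)[symmetric] by (simp add: algebra_simps)
  finally show ?thesis using that[OF r(1,2) s(1,2)] by simp
qed

text \<open>The second difference is symmetric in v and w. Evaluated in both orders on a small
  parallelogram, it forces the two continuous mixed derivatives to agree at x.\<close>

lemma symmetric_second_derivative:
  fixes f :: "'a::real_normed_vector \<Rightarrow> real"
  assumes V: "open V" "x \<in> V"
    and f': "\<And>y. y \<in> V \<Longrightarrow> (f has_derivative f' y) (at y)"
    and fv: "\<And>y. y \<in> V \<Longrightarrow> ((\<lambda>y. f' y v) has_derivative fv y) (at y)"
    and fw: "\<And>y. y \<in> V \<Longrightarrow> ((\<lambda>y. f' y w) has_derivative fw y) (at y)"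
    and cv: "continuous_on V (\<lambda>y. fv y w)" and cw: "continuous_on V (\<lambda>y. fw y v)"
  shows "fv x w = fw x v"
proof (rule ccontr)
  assume ne: "fv x w \<noteq> fw x v"
  define e where "e = \<bar>fv x w - fw x v\<bar> / 2"
  have e: "0 < e" using ne by (simp add: e_def)
  have "isCont (\<lambda>y. fv y w) x" "isCont (\<lambda>y. fw y v) x"
    using cv cw V by (auto simp: continuous_on_eq_continuous_at)
  then obtain d1 d2 where d: "0 < d1" "\<And>y. dist y x < d1 \<Longrightarrow> dist (fv y w) (fv x w) < e"
    "0 < d2" "\<And>y. dist y x < d2 \<Longrightarrow> dist (fw y v) (fw x v) < e"
    using e unfolding continuous_at_eps_delta by metis
  obtain d3 where d3: "0 < d3" "\<And>y. dist y x < d3 \<Longrightarrow> y \<in> V"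
    using V by (metis open_dist)
  define d where "d = min d1 (min d2 d3)"
  have d0: "0 < d" using d d3 by (simp add: d_def)
  \<comment> \<open>Makes the whole parallelogram spanned by t v and t w lie within distance d of x;
    the summand 1 keeps the denominator positive when v = w = 0.\<close>
  define t where "t = d / (norm v + norm w + 1)"
  have nv: "0 < norm v + norm w + 1" by (smt (verit) norm_ge_zero)
  have t: "0 < t" using d0 nv by (simp add: t_def)
  have near: "dist (x + r *\<^sub>R v + s *\<^sub>R w) x < d" if "0 \<le> r" "r \<le> t" "0 \<le> s" "s \<le> t" for r s
  proof -
    have "dist (x + r *\<^sub>R v + s *\<^sub>R w) x = norm (r *\<^sub>R v + s *\<^sub>R w)" by (simp add: dist_norm)
    also have "\<dots> \<le> r * norm v + s * norm w" using that norm_triangle_ineq[of "r *\<^sub>R v" "s *\<^sub>R w"] by simp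
    also have "\<dots> \<le> t * norm v + t * norm w" using that by (intro add_mono mult_right_mono) auto
    also have "\<dots> < t * (norm v + norm w + 1)" using t by (simp add: algebra_simps)
    also have "\<dots> = d" using nv by (simp add: t_def)
    finally show ?thesis .
  qed
  have near': "dist (x + s *\<^sub>R w + r *\<^sub>R v) x < d" if "0 \<le> r" "r \<le> t" "0 \<le> s" "s \<le> t" for r s
    using near[OF that] by (simp add: algebra_simps)
  obtain r s where rs: "0 < r" "r < t" "0 < s" "s < t"
    "f (x + t *\<^sub>R v + t *\<^sub>R w) - f (x + t *\<^sub>R v) - f (x + t *\<^sub>R w) + f x = t * t * fv (x + r *\<^sub>R v + s *\<^sub>R w) w"
    by (rule second_difference_mean_value[OF f' fv t, where x = x and w = w]) (use near d3(2) d_def in auto)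
  obtain r' s' where rs': "0 < r'" "r' < t" "0 < s'" "s' < t"
    "f (x + t *\<^sub>R w + t *\<^sub>R v) - f (x + t *\<^sub>R w) - f (x + t *\<^sub>R v) + f x = t * t * fw (x + r' *\<^sub>R w + s' *\<^sub>R v) v"
    by (rule second_difference_mean_value[OF f' fw t, where x = x and w = v]) (use near' d3(2) d_def in auto)
  have "t * t * fv (x + r *\<^sub>R v + s *\<^sub>R w) w = t * t * fw (x + r' *\<^sub>R w + s' *\<^sub>R v) v"
    unfolding rs(5)[symmetric] rs'(5)[symmetric] by (simp add: algebra_simps)
  then have eq: "fv (x + r *\<^sub>R v + s *\<^sub>R w) w = fw (x + r' *\<^sub>R w + s' *\<^sub>R v) v" using t by simp
  have "\<bar>fv (x + r *\<^sub>R v + s *\<^sub>R w) w - fv x w\<bar> < e"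
    using d(2)[of "x + r *\<^sub>R v + s *\<^sub>R w"] near[of r s] rs by (simp add: dist_real_def d_def)
  moreover have "\<bar>fw (x + r' *\<^sub>R w + s' *\<^sub>R v) v - fw x v\<bar> < e"
    using d(4)[of "x + r' *\<^sub>R w + s' *\<^sub>R v"] near'[of s' r'] rs' by (simp add: dist_real_def d_def)
  ultimately have "\<bar>fv x w - fw x v\<bar> < 2 * e" unfolding eq by linarith
  then show False by (simp add: e_def)
qed

lemma linear_eq_sum_axis:
  fixes L :: "real^'k \<Rightarrow> 'b::real_vector"
  assumes "linear L"
  shows "L h = (\<Sum>j\<in>UNIV. h $ j *\<^sub>R L (axis j 1))"
proof -
  have "L h = L (\<Sum>j\<in>UNIV. h $ j *\<^sub>R axis j 1)"
    using arg_cong[OF basis_expansion[of h], of L] by (simp add: scalar_mult_eq_scaleR)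
  then show ?thesis by (simp add: linear_sum[OF assms] linear_scale[OF assms])
qed

section \<open>The Laplacian of the height function on a minimal submanifold\<close>

text \<open>A permutation other than the identity moves at least two indices, so its Leibniz term
  contains two factors that vanish at the identity matrix and has zero derivative. Only the trace
  survives.\<close>

lemma has_derivative_det_at_identity:
  fixes C :: "'a::real_normed_vector \<Rightarrow> real^'k^'k"
  assumes C': "\<And>i j. ((\<lambda>x. C x $ i $ j) has_derivative C' i j) (at x)" and C: "C x = mat 1"
  shows "((\<lambda>x. det (C x)) has_derivative (\<lambda>h. \<Sum>i\<in>UNIV. C' i i h)) (at x)"
proof -
  let ?P = "{p. p permutes (UNIV :: 'k set)}"
  have *: "((\<lambda>x. det (C x)) has_derivative (\<lambda>h. \<Sum>p\<in>?P. of_int (sign p) *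
      (\<Sum>i\<in>UNIV. C' i (p i) h * (\<Prod>j\<in>UNIV - {i}. C x $ j $ p j)))) (at x)"
    unfolding det_def by (intro has_derivative_sum has_derivative_mult_right has_derivative_prod C')
  have zero: "(\<Prod>j\<in>UNIV - {i}. C x $ j $ p j) = 0" if p: "p permutes UNIV" "p \<noteq> id" for p i
  proof -
    obtain a where a: "p a \<noteq> a" using p(2) by (auto simp: fun_eq_iff)
    \<comment> \<open>If i itself is moved, then so is p i; hence a vanishing factor remains after
      the factor with index i has been differentiated.\<close>
    have "\<exists>j. j \<noteq> i \<and> p j \<noteq> j"
    proof (cases "a = i")
      case True
      have "p (p a) \<noteq> p a" using a permutes_inj[OF p(1)] by (auto dest: injD)
      then show ?thesis using a True by metis
    qed (use a in auto)
    then obtain j where "j \<noteq> i" "p j \<noteq> j" by blast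
    then show ?thesis by (intro prod_zero bexI[of _ j]) (auto simp: C mat_def)
  qed
  have "(\<Sum>p\<in>?P. of_int (sign p) * (\<Sum>i\<in>UNIV. C' i (p i) h * (\<Prod>j\<in>UNIV - {i}. C x $ j $ p j))) =
      (\<Sum>p\<in>{id}. of_int (sign p) * (\<Sum>i\<in>UNIV. C' i (p i) h * (\<Prod>j\<in>UNIV - {i}. C x $ j $ p j)))" for h
    by (rule sum.mono_neutral_right) (auto simp: finite_permutations permutes_id zero)
  also have "\<dots> h = (\<Sum>i\<in>UNIV. C' i i h)" for h
    by (simp add: C mat_def)
  finally show ?thesis using * by simp
qed

text \<open>Jacobi's formula. Multiplication by the constant inverse B of A x reduces it to the
  derivative at the identity.\<close>

lemma has_derivative_det:
  fixes A :: "'a::real_normed_vector \<Rightarrow> real^'k^'k"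
  assumes A': "\<And>i j. ((\<lambda>x. A x $ i $ j) has_derivative A' i j) (at x)" and B: "B ** A x = mat 1"
  shows "((\<lambda>x. det (A x)) has_derivative (\<lambda>h. det (A x) * (\<Sum>i\<in>UNIV. \<Sum>j\<in>UNIV. B $ i $ j * A' j i h))) (at x)"
proof -
  have "((\<lambda>y. det (B ** A y)) has_derivative (\<lambda>h. \<Sum>i\<in>UNIV. \<Sum>j\<in>UNIV. B $ i $ j * A' j i h)) (at x)"
  proof (rule has_derivative_det_at_identity[where C' = "\<lambda>i k h. \<Sum>j\<in>UNIV. B $ i $ j * A' j k h"])
    show "((\<lambda>y. (B ** A y) $ i $ j) has_derivative (\<lambda>h. \<Sum>ja\<in>UNIV. B $ i $ ja * A' ja j h)) (at x)" for i j
      unfolding matrix_matrix_mult_def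
      by (simp, intro has_derivative_sum has_derivative_mult_right A')
  qed (rule B)
  then have "((\<lambda>y. det (A x) * det (B ** A y)) has_derivative (\<lambda>h. det (A x) * (\<Sum>i\<in>UNIV. \<Sum>j\<in>UNIV. B $ i $ j * A' j i h))) (at x)"
    by (rule has_derivative_mult_right)
  moreover have "det (A x) * det (B ** A y) = det (A y)" for y
  proof -
    have "det (A x) * det B = 1" using arg_cong[OF B, of det] by (simp add: det_mul mult.commute)
    then show ?thesis by (simp add: det_mul mult.assoc[symmetric])
  qed
  ultimately show ?thesis by simp
qed

text \<open>A local parametrisation f of an immersed submanifold, with e j standing for its j-th
  partial derivative and s i j for the second partial derivatives. Naming them as parameters keeps
  derivative operators out of the tensor computations.\<close>

locale hyperbolic_param =
  fixes V :: "(real^'k) set" and f :: "real^'k \<Rightarrow> (real^'n) \<times> real"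
    and e :: "'k \<Rightarrow> real^'k \<Rightarrow> (real^'n) \<times> real" and s :: "'k \<Rightarrow> 'k \<Rightarrow> real^'k \<Rightarrow> (real^'n) \<times> real"
  assumes open_V: "open V"
    and hyp: "x \<in> V \<Longrightarrow> f x \<in> hyperbolic_space"
    and f': "x \<in> V \<Longrightarrow> (f has_derivative (\<lambda>h. \<Sum>j\<in>UNIV. h $ j *\<^sub>R e j x)) (at x)"
    and e': "x \<in> V \<Longrightarrow> (e j has_derivative (\<lambda>h. \<Sum>i\<in>UNIV. h $ i *\<^sub>R s i j x)) (at x)"
    and s_cont: "continuous_on V (s i j)"
    and inj: "x \<in> V \<Longrightarrow> inj (\<lambda>h. \<Sum>j\<in>UNIV. h $ j *\<^sub>R e j x)"
begin

text \<open>The first fundamental form; \<open>weight\<close> below is the density of the Riemannian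
  volume, and \<open>L x\<close> further on is the differential of f at x.\<close>

definition G :: "real^'k \<Rightarrow> real^'k^'k" where
  "G x = (\<chi> i j. mink (e i x) (e j x))"

definition weight :: "real^'k \<Rightarrow> real" where
  "weight x = sqrt (det (G x))"

lemma G_commute: "G x $ i $ j = G x $ j $ i"
  by (simp add: G_def mink_commute)

lemma sum_axis [simp]: "(\<Sum>j\<in>UNIV. axis i 1 $ j *\<^sub>R (v j :: 'v::real_vector)) = v i"
  by (simp add: axis_def if_distrib[of "\<lambda>c. c *\<^sub>R _"] cong: if_cong)

lemma s_commute:
  assumes x: "x \<in> V"
  shows "s i j x = s j i x"
proof (rule euclidean_eqI)
  fix b :: "(real^'n) \<times> real"
  let ?f' = "\<lambda>y h. (\<Sum>j\<in>UNIV. h $ j *\<^sub>R e j y) \<bullet> b"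
  have 1: "((\<lambda>y. f y \<bullet> b) has_derivative ?f' y) (at y)" if "y \<in> V" for y
    using has_derivative_inner_left[OF f'[OF that]] by simp
  have 2: "((\<lambda>y. ?f' y (axis i 1)) has_derivative (\<lambda>h. (\<Sum>j\<in>UNIV. h $ j *\<^sub>R s j i y) \<bullet> b)) (at y)" if "y \<in> V" for y i
    using has_derivative_inner_left[OF e'[OF that]] by simp
  have "(\<Sum>l\<in>UNIV. axis i 1 $ l *\<^sub>R s l j x) \<bullet> b = (\<Sum>l\<in>UNIV. axis j 1 $ l *\<^sub>R s l i x) \<bullet> b"
    by (rule symmetric_second_derivative[OF open_V x 1 2 2])
       (auto intro!: continuous_intros s_cont)
  then show "s i j x \<bullet> b = s j i x \<bullet> b" by simp
qed

text \<open>Differentiate \<open>mink (f y) (f y) = -1\<close>.\<close>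

lemma mink_f_e:
  assumes x: "x \<in> V"
  shows "mink (f x) (e j x) = 0"
proof -
  have "((\<lambda>y. mink (f y) (f y)) has_derivative
      (\<lambda>h. mink (f x) (\<Sum>j\<in>UNIV. h $ j *\<^sub>R e j x) + mink (\<Sum>j\<in>UNIV. h $ j *\<^sub>R e j x) (f x))) (at x)"
    by (rule mink.FDERIV[OF f'[OF x] f'[OF x]])
  then have "(\<lambda>h. mink (f x) (\<Sum>j\<in>UNIV. h $ j *\<^sub>R e j x) + mink (\<Sum>j\<in>UNIV. h $ j *\<^sub>R e j x) (f x)) = (\<lambda>h. 0)"
  proof (rule has_derivative_unique)
    show "((\<lambda>y. mink (f y) (f y)) has_derivative (\<lambda>h. 0)) (at x)"
    by (rule has_derivative_transform_within_open[OF has_derivative_const[of "-1"] open_V x])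
       (use hyp in \<open>auto simp: hyperbolic_space_def\<close>)
  qed
  from fun_cong[OF this, of "axis j 1"] have "mink (f x) (\<Sum>l\<in>UNIV. axis j 1 $ l *\<^sub>R e l x) + mink (\<Sum>l\<in>UNIV. axis j 1 $ l *\<^sub>R e l x) (f x) = 0"
    .
  then show ?thesis by (simp add: mink_commute)
qed

text \<open>Differentiate \<open>mink (f y) (e j y) = 0\<close>. This is the curvature of the
  hyperboloid in the flat ambient space, and the source of the term k u in the Laplacian of
  u.\<close>

lemma mink_f_s:
  assumes x: "x \<in> V"
  shows "mink (f x) (s i j x) = - G x $ i $ j"
proof -
  have "((\<lambda>y. mink (f y) (e j y)) has_derivative
      (\<lambda>h. mink (f x) (\<Sum>i\<in>UNIV. h $ i *\<^sub>R s i j x) + mink (\<Sum>j\<in>UNIV. h $ j *\<^sub>R e j x) (e j x))) (at x)"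
    by (rule mink.FDERIV[OF f'[OF x] e'[OF x]])
  then have "(\<lambda>h. mink (f x) (\<Sum>i\<in>UNIV. h $ i *\<^sub>R s i j x) + mink (\<Sum>j\<in>UNIV. h $ j *\<^sub>R e j x) (e j x)) = (\<lambda>h. 0)"
  proof (rule has_derivative_unique)
    show "((\<lambda>y. mink (f y) (e j y)) has_derivative (\<lambda>h. 0)) (at x)"
    by (rule has_derivative_transform_within_open[OF has_derivative_const[of 0] open_V x])
       (use mink_f_e in auto)
  qed
  from fun_cong[OF this, of "axis i 1"] have "mink (f x) (\<Sum>l\<in>UNIV. axis i 1 $ l *\<^sub>R s l j x) + mink (\<Sum>l\<in>UNIV. axis i 1 $ l *\<^sub>R e l x) (e j x) = 0"
    .
  then show ?thesis by (simp add: G_def)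
qed

definition L :: "real^'k \<Rightarrow> real^'k \<Rightarrow> (real^'n) \<times> real" where
  "L x h = (\<Sum>j\<in>UNIV. h $ j *\<^sub>R e j x)"

lemma linear_L: "linear (L x)"
  by (rule linearI) (auto simp: L_def algebra_simps sum.distrib scaleR_sum_right)

lemma L_tangent: "x \<in> V \<Longrightarrow> L x h \<in> tangent_space (f x)"
  by (simp add: L_def tangent_space_def mink.sum_right mink.scaleR_right mink_f_e)

lemma G_factorization:
  assumes x: "x \<in> V"
  obtains A :: "real^'k^'k" where "det A \<noteq> 0" "\<And>a b. mink (L x a) (L x b) = (A *v a) \<bullet> (A *v b)"
    "G x = transpose A ** A"
proof -
  have inj': "inj (L x)" using inj[OF x] by (simp add: L_def[abs_def])
  have gram: "(\<chi> i j. mink (L x (axis i 1)) (L x (axis j 1))) = G x"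
    by (simp add: G_def L_def)
  have "range (L x) \<subseteq> tangent_space (f x)" using L_tangent[OF x] by auto
  from gram_factorization[OF hyp[OF x] linear_L inj' this, unfolded gram] show ?thesis
    using that by metis
qed

lemma det_G_pos:
  assumes "x \<in> V"
  shows "0 < det (G x)"
proof -
  obtain A :: "real^'k^'k" where "det A \<noteq> 0" "G x = transpose A ** A"
    by (rule G_factorization[OF assms]) (rule that)
  then show ?thesis by (simp add: det_mul det_transpose zero_less_mult_iff) linarith
qed

lemma weight_pos: "x \<in> V \<Longrightarrow> 0 < weight x"
  by (simp add: weight_def det_G_pos)

lemma inverse_G:
  assumes "x \<in> V"
  shows "matrix_inv (G x) ** G x = mat 1" "G x ** matrix_inv (G x) = mat 1"
proof -
  have "invertible (G x)" using det_G_pos[OF assms] by (simp add: invertible_det_nz)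
  then have "G x ** matrix_inv (G x) = mat 1 \<and> matrix_inv (G x) ** G x = mat 1"
    unfolding invertible_def matrix_inv_def by (rule someI_ex)
  then show "matrix_inv (G x) ** G x = mat 1" "G x ** matrix_inv (G x) = mat 1"
    by simp_all
qed

lemma matrix_inv_G_commute:
  assumes "x \<in> V"
  shows "matrix_inv (G x) $ i $ j = matrix_inv (G x) $ j $ i"
proof -
  let ?B = "matrix_inv (G x)"
  have t: "transpose (G x) = G x" by (simp add: transpose_def vec_eq_iff G_commute)
  have "transpose ?B ** G x = mat 1"
    using arg_cong[OF inverse_G(2)[OF assms], of transpose] by (simp add: matrix_transpose_mul t transpose_mat)
  then have "transpose ?B = ?B"
    using matrix_mul_assoc[of "transpose ?B" "G x" ?B] inverse_G(2)[OF assms] by simp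
  then have "transpose ?B $ j $ i = ?B $ j $ i" by simp
  then show ?thesis by (simp add: transpose_def)
qed

section \<open>The height function, its gradient and its Laplacian\<close>

context
  fixes p :: "(real^'n) \<times> real"
begin

definition u :: "real^'k \<Rightarrow> real" where "u x = - mink p (f x)"

definition du :: "real^'k \<Rightarrow> real^'k" where "du x = (\<chi> j. - mink p (e j x))"

text \<open>The Riemannian gradient in chart coordinates, that is the vector dual to du under G;
  \<open>gradsq\<close> is its squared Riemannian length.\<close>

definition grad :: "real^'k \<Rightarrow> real^'k" where "grad x = matrix_inv (G x) *v du x"

definition gradsq :: "real^'k \<Rightarrow> real" where "gradsq x = du x \<bullet> grad x"

lemma G_grad: "x \<in> V \<Longrightarrow> G x *v grad x = du x"
  by (simp add: grad_def matrix_vector_mul_assoc inverse_G)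

lemma mink_L_grad:
  assumes x: "x \<in> V"
  shows "mink (L x a) (L x (grad x)) = du x \<bullet> a"
proof -
  have "mink (L x a) (L x b) = a \<bullet> (G x *v b)" for b
  proof -
    have "mink (L x a) (L x b) = (\<Sum>i\<in>UNIV. \<Sum>j\<in>UNIV. a $ i * (b $ j * mink (e i x) (e j x)))"
      by (simp add: L_def mink.sum_left mink.sum_right mink.scaleR_left mink.scaleR_right sum_distrib_left)
        (subst sum.swap, simp add: mult.left_commute)
    also have "\<dots> = a \<bullet> (G x *v b)"
      by (simp add: inner_vec_def matrix_vector_mult_def G_def sum_distrib_left mult.commute)
    finally show ?thesis .
  qed
  then show ?thesis by (simp add: G_grad[OF x] inner_commute)
qed

text \<open>p - u f is the projection of p to the tangent space of the hyperboloid at f, of squared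
  length u^2 - 1. Its part tangent to the submanifold is - Z, where Z is the image of the gradient,
  so adding Z leaves the normal part. Tangent vectors of the hyperboloid have nonnegative squared
  length, which gives both bounds.\<close>

lemma gradsq_bounds:
  assumes x: "x \<in> V" and p: "p \<in> hyperbolic_space"
  shows "0 \<le> gradsq x" "gradsq x \<le> (u x)\<^sup>2 - 1"
proof -
  let ?Z = "L x (grad x)" and ?q = "p - u x *\<^sub>R f x"
  have ZZ: "mink ?Z ?Z = gradsq x" using mink_L_grad[OF x] by (simp add: gradsq_def)
  show "0 \<le> gradsq x" using mink_tangent_nonneg[OF hyp[OF x] L_tangent[OF x]] ZZ by metis
  have ff: "mink (f x) (f x) = - 1" using hyp[OF x] by (simp add: hyperbolic_space_def)
  have pp: "mink p p = - 1" using p by (simp add: hyperbolic_space_def)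
  have fp: "mink (f x) p = - u x" by (simp add: u_def mink_commute)
  have pf: "mink p (f x) = - u x" by (simp add: u_def)
  have q: "?q \<in> tangent_space (f x)"
    by (simp add: tangent_space_def mink.diff_right mink.scaleR_right ff fp)
  have qq: "mink ?q ?q = (u x)\<^sup>2 - 1"
    by (simp add: mink.diff_right mink.diff_left mink.scaleR_right mink.scaleR_left ff fp pf pp power2_eq_square algebra_simps)
  have fZ: "mink (f x) ?Z = 0" using L_tangent[OF x] by (simp add: tangent_space_def)
  have "mink p (L x a) = - (du x \<bullet> a)" for a
    by (simp add: L_def du_def mink.sum_right mink.scaleR_right inner_vec_def sum_negf mult.commute)
  then have qZ: "mink ?q ?Z = - gradsq x"
    by (simp add: mink.diff_left mink.scaleR_left fZ gradsq_def)
  have "0 \<le> mink (?Z + ?q) (?Z + ?q)"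
    using mink_tangent_nonneg[OF hyp[OF x]] subspace_add[OF subspace_tangent_space L_tangent[OF x] q] by blast
  also have "\<dots> = (u x)\<^sup>2 - 1 - gradsq x"
    using qZ mink_commute[of ?Z ?q] by (simp add: mink.add_left mink.add_right ZZ qq)
  finally show "gradsq x \<le> (u x)\<^sup>2 - 1" by simp
qed

lemma has_derivative_mink_e:
  assumes x: "x \<in> V"
  shows "((\<lambda>y. mink (e i y) (e j y)) has_derivative
     (\<lambda>h. mink (e i x) (\<Sum>l\<in>UNIV. h $ l *\<^sub>R s l j x) + mink (\<Sum>l\<in>UNIV. h $ l *\<^sub>R s l i x) (e j x))) (at x)"
  by (rule mink.FDERIV[OF e'[OF x] e'[OF x]])

lemma continuous_e: "continuous_on V (e j)"
  by (meson continuous_at_imp_continuous_on has_derivative_continuous e')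

lemma C1_G: "C1_on V (\<lambda>x. G x $ i $ j)"
  unfolding G_def
  by (simp, rule C1_onI[OF has_derivative_mink_e])
     (auto intro!: continuous_intros mink.continuous_on continuous_e s_cont)

lemma has_derivative_du:
  assumes x: "x \<in> V"
  shows "((\<lambda>y. du y $ j) has_derivative (\<lambda>h. - mink p (\<Sum>l\<in>UNIV. h $ l *\<^sub>R s l j x))) (at x)"
proof -
  have "((\<lambda>y. - mink p (e j y)) has_derivative (\<lambda>h. - (mink p (\<Sum>l\<in>UNIV. h $ l *\<^sub>R s l j x) + mink 0 (e j x)))) (at x)"
    by (rule has_derivative_minus[OF mink.FDERIV[OF has_derivative_const e'[OF x]]])
  then show ?thesis by (simp add: du_def mink.zero_left)
qed

lemma C1_du: "C1_on V (\<lambda>x. du x $ j)"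
  by (rule C1_onI[OF has_derivative_du])
     (auto intro!: continuous_intros mink.continuous_on s_cont)

lemma has_derivative_u:
  assumes x: "x \<in> V"
  shows "(u has_derivative (\<lambda>h. du x \<bullet> h)) (at x)"
proof -
  have "((\<lambda>y. - mink p (f y)) has_derivative (\<lambda>h. - (mink p (\<Sum>l\<in>UNIV. h $ l *\<^sub>R e l x) + mink 0 (f x)))) (at x)"
    by (rule has_derivative_minus[OF mink.FDERIV[OF has_derivative_const f'[OF x]]])
  moreover have "- (mink p (\<Sum>l\<in>UNIV. h $ l *\<^sub>R e l x) + mink 0 (f x)) = du x \<bullet> h" for h
    by (simp add: du_def mink.zero_left mink.sum_right mink.scaleR_right inner_vec_def sum_negf mult.commute)
  ultimately show ?thesis by (simp add: u_def[abs_def])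
qed

lemma C1_u: "C1_on V u"
proof (rule C1_onI[OF has_derivative_u])
  show "continuous_on V (\<lambda>x. du x \<bullet> h)" for h
    unfolding inner_vec_def
    by (intro continuous_intros C1_on_imp_continuous_on[OF C1_du]) 
qed

lemma C1_det:
  fixes A :: "real^'k \<Rightarrow> real^'k^'k"
  assumes "\<And>i j. C1_on V (\<lambda>x. A x $ i $ j)"
  shows "C1_on V (\<lambda>x. det (A x))"
  unfolding det_def by (intro C1_on_sum C1_on_mult C1_on_const C1_on_prod assms)

lemma C1_weight: "C1_on V weight"
  unfolding weight_def[abs_def]
proof (rule C1_on_compose_real[OF C1_det[OF C1_G], where \<phi>' = "\<lambda>y. inverse (sqrt y) / 2"])
  show "(sqrt has_real_derivative inverse (sqrt (det (G x))) / 2) (at (det (G x)))" if "x \<in> V" for x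
    using det_G_pos[OF that] by (auto intro!: derivative_eq_intros)
  show "continuous_on ((\<lambda>x. det (G x)) ` V) (\<lambda>y. inverse (sqrt y) / 2)"
    using det_G_pos by (intro continuous_intros) (fastforce simp: less_le)+
qed

text \<open>Cramer's rule writes the components of the gradient as quotients of determinants with
  C^1 entries, so the matrix inverse itself need not be differentiated.\<close>

lemma C1_grad: "C1_on V (\<lambda>x. grad x $ i)"
proof -
  let ?N = "\<lambda>x. det (\<chi> a b. if b = i then du x $ a else G x $ a $ b)"
  have N: "C1_on V ?N"
  proof (rule C1_det)
    fix a b
    show "C1_on V (\<lambda>x. (\<chi> a b. if b = i then du x $ a else G x $ a $ b) $ a $ b)"
      using C1_du C1_G by (cases "b = i") simp_all
  qed
  have D: "C1_on V (\<lambda>x. inverse (det (G x)))"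
  proof (rule C1_on_compose_real[OF C1_det[OF C1_G], where \<phi>' = "\<lambda>y. - (inverse y ^ Suc (Suc 0))"])
    show "(inverse has_real_derivative - (inverse (det (G x)) ^ Suc (Suc 0))) (at (det (G x)))" if "x \<in> V" for x
      using DERIV_inverse[of "det (G x)"] det_G_pos[OF that] by auto
    show "continuous_on ((\<lambda>x. det (G x)) ` V) (\<lambda>y. - (inverse y ^ Suc (Suc 0)))"
      using det_G_pos by (intro continuous_intros) (fastforce simp: less_le)+
  qed
  have "grad x $ i = ?N x * inverse (det (G x))" if "x \<in> V" for x
    using cramer[of "G x" "grad x" "du x"] G_grad[OF that] det_G_pos[OF that]
    by (simp add: divide_inverse vec_eq_iff)
  then show ?thesis
    using C1_on_cong[OF open_V, of "\<lambda>x. grad x $ i" "\<lambda>x. ?N x * inverse (det (G x))"] C1_on_mult[OF N D] by simp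
qed

lemma has_derivative_weight:
  assumes x: "x \<in> V"
  shows "(weight has_derivative (\<lambda>h. weight x * (\<Sum>i\<in>UNIV. \<Sum>j\<in>UNIV. matrix_inv (G x) $ i $ j *
     (mink (e j x) (\<Sum>l\<in>UNIV. h $ l *\<^sub>R s l i x) + mink (\<Sum>l\<in>UNIV. h $ l *\<^sub>R s l j x) (e i x))) / 2)) (at x)"
proof -
  let ?t = "\<lambda>h. \<Sum>i\<in>UNIV. \<Sum>j\<in>UNIV. matrix_inv (G x) $ i $ j *
     (mink (e j x) (\<Sum>l\<in>UNIV. h $ l *\<^sub>R s l i x) + mink (\<Sum>l\<in>UNIV. h $ l *\<^sub>R s l j x) (e i x))"
  have "((\<lambda>y. det (G y)) has_derivative (\<lambda>h. det (G x) * ?t h)) (at x)"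
    by (rule has_derivative_det[where A = G, OF _ inverse_G(1)[OF x]]) (simp add: G_def has_derivative_mink_e[OF x])
  then have "((\<lambda>y. sqrt (det (G y))) has_derivative (\<lambda>h. inverse (sqrt (det (G x))) / 2 * (det (G x) * ?t h))) (at x)"
    by (rule has_derivative_compose[where g = sqrt])
       (use det_G_pos[OF x] in \<open>auto intro!: derivative_eq_intros simp: has_field_derivative_def[symmetric]\<close>)
  moreover have "inverse (sqrt (det (G x))) / 2 * (det (G x) * ?t h) = weight x * ?t h / 2" for h
  proof -
    have "inverse (sqrt (det (G x))) * det (G x) = sqrt (det (G x))"
      using det_G_pos[OF x] by (simp add: field_simps)
    then show ?thesis by (simp add: weight_def)
  qed
  ultimately have "((\<lambda>y. sqrt (det (G y))) has_derivative (\<lambda>h. weight x * ?t h / 2)) (at x)"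
    by (rule has_derivative_eq_rhs[OF _ ext])
  then show ?thesis unfolding weight_def[abs_def] .
qed

text \<open>In coordinates this is the statement that the Laplacian of u is k u. The gradient X is
  differentiated implicitly through G X = du. This produces the trace S0 of the flat second
  derivatives and two Christoffel-type sums S1 and S2; S2 cancels against the derivative of the
  volume density, and minimality evaluates S0 - S1.\<close>

lemma div_grad:
  assumes x: "x \<in> V"
    and minimal: "(\<Sum>i\<in>UNIV. \<Sum>j\<in>UNIV. matrix_inv (G x) $ i $ j *\<^sub>R
      (tangent_proj (f x) (s i j x) - (\<Sum>a\<in>UNIV. \<Sum>b\<in>UNIV.
        (matrix_inv (G x) $ a $ b * mink (tangent_proj (f x) (s i j x)) (e a x)) *\<^sub>R e b x))) = 0"
  shows "(\<Sum>l\<in>UNIV. frechet_derivative (\<lambda>y. weight y * grad y $ l) (at x) (axis l 1)) =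
    real CARD('k) * u x * weight x"
proof -
  define B where "B i j = matrix_inv (G x) $ i $ j" for i j
  define X where "X i = grad x $ i" for i
  define a where "a i j c = mink (s i j x) (e c x)" for i j c
  define v where "v i j = - mink p (s i j x)" for i j
  define dX where "dX i l = frechet_derivative (\<lambda>y. grad y $ i) (at x) (axis l 1)" for i l
  have B_commute: "B i j = B j i" for i j unfolding B_def by (rule matrix_inv_G_commute[OF x])
  have a_commute: "a i j c = a j i c" for i j c using s_commute[OF x, of i j] by (simp add: a_def)
  have v_commute: "v i j = v j i" for i j using s_commute[OF x, of i j] by (simp add: v_def)
  have BG: "(\<Sum>i\<in>UNIV. B m i * G x $ i $ j) = (if m = j then 1 else 0)" for m j
    using inverse_G(1)[OF x] by (simp add: vec_eq_iff matrix_matrix_mult_def mat_def B_def)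
  have dX: "((\<lambda>y. grad y $ i) has_derivative frechet_derivative (\<lambda>y. grad y $ i) (at x)) (at x)" for i
    by (rule C1_on_frechet_derivative(1)[OF C1_grad x])
  \<comment> \<open>The equation G X = du differentiated along the coordinate direction l;
    multiplying by the inverse B then solves for dX.\<close>
  have eq: "(\<Sum>j\<in>UNIV. G x $ i $ j * dX j l) = v l i - (\<Sum>j\<in>UNIV. (a l i j + a l j i) * X j)" for i l
  proof -
    let ?d = "\<lambda>h. \<Sum>j\<in>UNIV. G x $ i $ j * frechet_derivative (\<lambda>y. grad y $ j) (at x) h +
       (mink (e i x) (\<Sum>l\<in>UNIV. h $ l *\<^sub>R s l j x) + mink (\<Sum>l\<in>UNIV. h $ l *\<^sub>R s l i x) (e j x)) * grad x $ j"
    have "((\<lambda>y. \<Sum>j\<in>UNIV. G y $ i $ j * grad y $ j) has_derivative ?d) (at x)"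
      by (intro has_derivative_sum has_derivative_mult dX) (simp add: G_def has_derivative_mink_e[OF x])
    then have "((\<lambda>y. du y $ i) has_derivative ?d) (at x)"
      by (rule has_derivative_transform_within_open[OF _ open_V x])
         (simp add: G_grad[symmetric] matrix_vector_mult_def)
    then have "?d = (\<lambda>h. - mink p (\<Sum>l\<in>UNIV. h $ l *\<^sub>R s l i x))"
      by (rule has_derivative_unique[OF _ has_derivative_du[OF x]])
    from fun_cong[OF this, of "axis l 1"]
    show ?thesis
      by (simp add: dX_def v_def a_def X_def sum.distrib mink_commute algebra_simps)
  qed
  have dX_eq: "dX m l = (\<Sum>i\<in>UNIV. B m i * (v l i - (\<Sum>j\<in>UNIV. (a l i j + a l j i) * X j)))" for m l
  proof -
    have "(\<Sum>i\<in>UNIV. B m i * (\<Sum>j\<in>UNIV. G x $ i $ j * dX j l)) = (\<Sum>j\<in>UNIV. (\<Sum>i\<in>UNIV. B m i * G x $ i $ j) * dX j l)"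
      by (simp add: sum_distrib_left sum_distrib_right mult.assoc) (rule sum.swap)
    also have "\<dots> = dX m l" unfolding BG by (simp add: if_distrib[of "\<lambda>c. c * _"] cong: if_cong)
    finally show ?thesis by (simp add: eq)
  qed
  define S1 where "S1 = (\<Sum>l\<in>UNIV. \<Sum>i\<in>UNIV. \<Sum>j\<in>UNIV. B l i * a l i j * X j)"
  define S2 where "S2 = (\<Sum>l\<in>UNIV. \<Sum>i\<in>UNIV. \<Sum>j\<in>UNIV. B l i * a l j i * X j)"
  define S0 where "S0 = (\<Sum>l\<in>UNIV. \<Sum>i\<in>UNIV. B l i * v l i)"
  have div_X: "(\<Sum>l\<in>UNIV. dX l l) = S0 - S1 - S2"
    unfolding dX_eq S0_def S1_def S2_def
    by (simp add: sum_subtractf[symmetric] sum_distrib_left right_diff_distrib algebra_simps sum.distrib)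
  \<comment> \<open>By Jacobi's formula the left-hand side is twice the derivative of log
    \<open>weight\<close> along X. It becomes 2 S2 after renaming indices and using the symmetries
    of a and B.\<close>
  have tr: "(\<Sum>l\<in>UNIV. (\<Sum>i\<in>UNIV. \<Sum>j\<in>UNIV. B i j * (a l i j + a l j i)) * X l) = 2 * S2"
  proof -
    have "S2 = (\<Sum>l\<in>UNIV. \<Sum>j\<in>UNIV. \<Sum>i\<in>UNIV. B l i * a l j i * X j)"
      unfolding S2_def by (rule sum.cong[OF refl], rule sum.swap)
    also have "\<dots> = (\<Sum>l\<in>UNIV. \<Sum>j\<in>UNIV. \<Sum>i\<in>UNIV. B j i * a j l i * X l)"
      by (rule sum.swap)
    also have "\<dots> = (\<Sum>l\<in>UNIV. \<Sum>i\<in>UNIV. \<Sum>j\<in>UNIV. B i j * a l i j * X l)"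
      by (simp add: a_commute)
    finally have 1: "S2 = (\<Sum>l\<in>UNIV. \<Sum>i\<in>UNIV. \<Sum>j\<in>UNIV. B i j * a l i j * X l)" .
    also have "\<dots> = (\<Sum>l\<in>UNIV. \<Sum>j\<in>UNIV. \<Sum>i\<in>UNIV. B i j * a l i j * X l)"
      by (rule sum.cong[OF refl], rule sum.swap)
    finally have 2: "S2 = (\<Sum>l\<in>UNIV. \<Sum>i\<in>UNIV. \<Sum>j\<in>UNIV. B i j * a l j i * X l)"
      by (simp add: B_commute)
    have "(\<Sum>l\<in>UNIV. (\<Sum>i\<in>UNIV. \<Sum>j\<in>UNIV. B i j * (a l i j + a l j i)) * X l) = S2 + S2"
      by (subst 1, subst 2) (simp add: sum_distrib_right sum.distrib[symmetric] distrib_left distrib_right)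
    then show ?thesis by simp
  qed
  \<comment> \<open>The vanishing mean curvature vector is paired with p. Projection to the
    hyperboloid contributes G u by \<open>mink_f_s\<close>, whose trace with the inverse of G is k
    u; removing the tangential part contributes S1.\<close>
  have min: "S0 - real CARD('k) * u x - S1 = 0"
  proof -
    have BG1: "(\<Sum>i\<in>UNIV. \<Sum>j\<in>UNIV. B i j * G x $ i $ j) = real CARD('k)"
    proof -
      have "(\<Sum>j\<in>UNIV. B i j * G x $ i $ j) = 1" for i
        using BG[of i i] by (simp add: G_commute)
      then show ?thesis by simp
    qed
    have t: "mink p (tangent_proj (f x) (s i j x)) = - v i j + G x $ i $ j * u x" for i j
      by (simp add: tangent_proj_def mink.add_right mink.diff_right mink.scaleR_right mink_f_s[OF x] v_def u_def)
    have ta: "mink (tangent_proj (f x) (s i j x)) (e c x) = a i j c" for i j c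
      by (simp add: tangent_proj_def mink.add_left mink.scaleR_left mink_f_e[OF x] a_def)
    have Xa: "(\<Sum>b\<in>UNIV. B c b * mink p (e b x)) = - X c" for c
      by (simp add: X_def grad_def du_def B_def matrix_vector_mult_def sum_negf)
    have "(\<Sum>c\<in>UNIV. \<Sum>b\<in>UNIV. B c b * a i j c * mink p (e b x)) = (\<Sum>c\<in>UNIV. a i j c * (\<Sum>b\<in>UNIV. B c b * mink p (e b x)))" for i j
      by (simp add: sum_distrib_left mult.assoc mult.left_commute)
    then have ts: "(\<Sum>c\<in>UNIV. \<Sum>b\<in>UNIV. B c b * a i j c * mink p (e b x)) = - (\<Sum>c\<in>UNIV. a i j c * X c)" for i j
      by (simp add: Xa sum_negf)
    have "mink p 0 = (\<Sum>i\<in>UNIV. \<Sum>j\<in>UNIV. B i j * (- v i j + G x $ i $ j * u x + (\<Sum>c\<in>UNIV. a i j c * X c)))"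
      unfolding minimal[symmetric] B_def[symmetric]
      by (simp add: mink.sum_right mink.scaleR_right mink.diff_right t ta ts)
    also have "\<dots> = - S0 + (\<Sum>i\<in>UNIV. \<Sum>j\<in>UNIV. B i j * G x $ i $ j) * u x + S1"
      by (simp add: S0_def S1_def algebra_simps sum.distrib sum_subtractf sum_distrib_left sum_distrib_right sum_negf)
    finally show ?thesis unfolding BG1 by (simp add: mink.zero_right)
  qed
  have "frechet_derivative (\<lambda>y. weight y * grad y $ l) (at x) (axis l 1) =
     weight x * dX l l + weight x * ((\<Sum>i\<in>UNIV. \<Sum>j\<in>UNIV. B i j * (a l i j + a l j i)) * X l) / 2" for l
    using fun_cong[OF frechet_derivative_at[OF has_derivative_mult[OF has_derivative_weight[OF x] dX[of l]]], of "axis l 1"]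
    by (simp add: dX_def B_def X_def a_def mink_commute add.commute)
  then have "(\<Sum>l\<in>UNIV. frechet_derivative (\<lambda>y. weight y * grad y $ l) (at x) (axis l 1)) =
     weight x * (\<Sum>l\<in>UNIV. dX l l) + weight x * (\<Sum>l\<in>UNIV. (\<Sum>i\<in>UNIV. \<Sum>j\<in>UNIV. B i j * (a l i j + a l j i)) * X l) / 2"
    by (simp add: sum.distrib sum_distrib_left sum_divide_distrib)
  also have "\<dots> = weight x * (S0 - S1)" unfolding tr div_X by (simp add: algebra_simps)
  also have "S0 - S1 = real CARD('k) * u x" using min by simp
  finally show ?thesis by simp
qed

text \<open>The divergence theorem for \<psi> g(u) grad u with \<psi> compactly supported in the
  chart. The product rule and \<open>div_grad\<close> turn the coordinate divergence of the
  density-weighted field into the integrand.\<close>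

lemma integral_div_cutoff:
  fixes g g' :: "real \<Rightarrow> real"
  assumes minimal: "\<And>x. x \<in> V \<Longrightarrow> (\<Sum>i\<in>UNIV. \<Sum>j\<in>UNIV. matrix_inv (G x) $ i $ j *\<^sub>R
      (tangent_proj (f x) (s i j x) - (\<Sum>a\<in>UNIV. \<Sum>b\<in>UNIV.
        (matrix_inv (G x) $ a $ b * mink (tangent_proj (f x) (s i j x)) (e a x)) *\<^sub>R e b x))) = 0"
    and g: "\<And>x. x \<in> V \<Longrightarrow> (g has_real_derivative g' (u x)) (at (u x))" "continuous_on (u ` V) g'"
    and \<psi>: "C1_on V \<psi>" and K: "compact K" "K \<subseteq> V" and 0: "\<And>x. x \<in> V \<Longrightarrow> x \<notin> K \<Longrightarrow> \<psi> x = 0"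
  shows "(\<integral>x. indicator V x * ((\<psi> x * (g' (u x) * gradsq x + g (u x) * (real CARD('k) * u x)) +
    frechet_derivative \<psi> (at x) (g (u x) *\<^sub>R grad x)) * weight x) \<partial>lborel) = 0"
proof -
  define h where "h x = \<psi> x * g (u x)" for x
  have gu: "C1_on V (\<lambda>x. g (u x))" by (rule C1_on_compose_real[OF C1_u g])
  have h: "C1_on V h" unfolding h_def[abs_def] by (rule C1_on_mult[OF \<psi> gu])
  have wX: "C1_on V (\<lambda>x. weight x * grad x $ i)" for i by (rule C1_on_mult[OF C1_weight C1_grad])
  \<comment> \<open>Extension by zero is C^1 on the whole space: H is C^1 on V, vanishes on the
    complement of K, and these two open sets cover everything.\<close>
  define H where "H i x = (if x \<in> V then h x * (weight x * grad x $ i) else 0)" for i x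
  have H0: "H i x = 0" if "x \<notin> K" for i x using that 0 by (simp add: H_def h_def)
  have HV: "C1_on V (H i)" for i
    using C1_on_cong[OF open_V, of "H i" "\<lambda>x. h x * (weight x * grad x $ i)"] C1_on_mult[OF h wX[of i]]
    by (simp add: H_def)
  have opK: "open (- K)" using K(1) by (simp add: compact_imp_closed open_Compl)
  have HK: "C1_on (- K) (H i)" for i
    using C1_on_cong[OF opK, of "H i" "\<lambda>x. 0"] H0 C1_on_const by auto
  have "V \<union> - K = UNIV" using K(2) by auto
  then have C1: "C1_on UNIV (H i)" for i
    using C1_on_open_Un[OF open_V opK HV HK, of i] by simp
  have dH: "(\<Sum>i\<in>UNIV. frechet_derivative (H i) (at x) (axis i 1)) =
    indicator V x * ((\<psi> x * (g' (u x) * gradsq x + g (u x) * (real CARD('k) * u x)) +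
      frechet_derivative \<psi> (at x) (g (u x) *\<^sub>R grad x)) * weight x)" for x
  proof (cases "x \<in> V")
    case True
    let ?D = "frechet_derivative \<psi> (at x)"
    note \<psi>' = C1_on_frechet_derivative(1)[OF \<psi> True]
    have "((\<lambda>x. g (u x)) has_derivative (\<lambda>v. g' (u x) * (du x \<bullet> v))) (at x)"
      using has_derivative_compose[OF has_derivative_u[OF True] g(1)[OF True, unfolded has_field_derivative_def]] by simp
    from has_derivative_mult[OF \<psi>' this]
    have h': "(h has_derivative (\<lambda>v. \<psi> x * (g' (u x) * (du x \<bullet> v)) + ?D v * g (u x))) (at x)"
      by (simp add: h_def[abs_def])
    let ?w = "\<lambda>i. frechet_derivative (\<lambda>y. weight y * grad y $ i) (at x)"
    have "((\<lambda>x. h x * (weight x * grad x $ i)) has_derivative (\<lambda>v. h x * ?w i v +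
        (\<psi> x * (g' (u x) * (du x \<bullet> v)) + ?D v * g (u x)) * (weight x * grad x $ i))) (at x)" for i
      by (rule has_derivative_mult[OF h' C1_on_frechet_derivative(1)[OF wX True]])
    then have HD: "(H i has_derivative (\<lambda>v. h x * ?w i v +
        (\<psi> x * (g' (u x) * (du x \<bullet> v)) + ?D v * g (u x)) * (weight x * grad x $ i))) (at x)" for i
      by (rule has_derivative_transform_within_open[OF _ open_V True]) (simp add: H_def)
    have "frechet_derivative (H i) (at x) = (\<lambda>v. h x * ?w i v +
        (\<psi> x * (g' (u x) * (du x \<bullet> v)) + ?D v * g (u x)) * (weight x * grad x $ i))" for i
      by (rule sym[OF frechet_derivative_at[OF HD]])
    then have "(\<Sum>i\<in>UNIV. frechet_derivative (H i) (at x) (axis i 1)) =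
        h x * (\<Sum>i\<in>UNIV. ?w i (axis i 1)) + (\<psi> x * g' (u x) * (\<Sum>i\<in>UNIV. du x $ i * grad x $ i) +
        (\<Sum>i\<in>UNIV. grad x $ i * ?D (axis i 1)) * g (u x)) * weight x"
      by (simp add: inner_axis sum.distrib sum_distrib_left sum_distrib_right algebra_simps)
    also have "(\<Sum>i\<in>UNIV. ?w i (axis i 1)) = real CARD('k) * u x * weight x"
      by (rule div_grad[OF True minimal[OF True]])
    also have "(\<Sum>i\<in>UNIV. du x $ i * grad x $ i) = gradsq x" by (simp add: gradsq_def inner_vec_def)
    also have "(\<Sum>i\<in>UNIV. grad x $ i * ?D (axis i 1)) = ?D (grad x)"
      using linear_eq_sum_axis[OF has_derivative_linear[OF \<psi>'], of "grad x"] by simp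
    finally show ?thesis
      using True linear_scale[OF has_derivative_linear[OF \<psi>']] by (simp add: h_def algebra_simps)
  next
    case False
    then have "x \<in> - K" using K(2) by auto
    then have "frechet_derivative (H i) (at x) v = 0" for i v
      using H0 by (intro frechet_derivative_eq_0_if_locally_0[OF opK]) auto
    then show ?thesis using False by simp
  qed
  have "(\<integral>x. (\<Sum>i\<in>UNIV. frechet_derivative (H i) (at x) (axis i 1)) \<partial>lborel) = 0"
    using integral_directional_derivative_eq_0[OF C1 K(1) H0] by (subst Bochner_Integration.integral_sum) auto
  then show ?thesis unfolding dH .
qed

end

end

section \<open>Smooth maps\<close>

lemma frechet_derivative_cong_open:
  assumes "open S" "x \<in> S" "\<And>y. y \<in> S \<Longrightarrow> f y = g y"
  shows "frechet_derivative f (at x) = frechet_derivative g (at x)"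
    and "f differentiable (at x) \<longleftrightarrow> g differentiable (at x)"
proof -
  have "(f has_derivative f') (at x) \<longleftrightarrow> (g has_derivative f') (at x)" for f'
    using has_derivative_transform_within_open[OF _ assms(1,2), of f f' UNIV g]
      has_derivative_transform_within_open[OF _ assms(1,2), of g f' UNIV f] assms(3) by auto
  then show "frechet_derivative f (at x) = frechet_derivative g (at x)"
    "f differentiable (at x) \<longleftrightarrow> g differentiable (at x)"
    by (simp_all add: frechet_derivative_def differentiable_def)
qed

lemma Ck_on_subset: "Ck_on m S f \<Longrightarrow> T \<subseteq> S \<Longrightarrow> Ck_on m T f"
proof (induction m arbitrary: f)
  case 0
  then show ?case by (auto intro: continuous_on_subset)
qed auto

lemma Ck_on_cong:
  assumes "open S" "\<And>y. y \<in> S \<Longrightarrow> f y = g y"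
  shows "Ck_on m S f \<longleftrightarrow> Ck_on m S g"
  using assms(2)
proof (induction m arbitrary: f g)
  case 0
  then show ?case by (simp cong: continuous_on_cong)
next
  case (Suc m)
  have "Ck_on m S (\<lambda>x. frechet_derivative f (at x) v) \<longleftrightarrow> Ck_on m S (\<lambda>x. frechet_derivative g (at x) v)" for v
    by (rule Suc.IH) (use frechet_derivative_cong_open[OF assms(1) _ Suc.prems] in auto)
  then show ?case using frechet_derivative_cong_open(2)[OF assms(1) _ Suc.prems] by auto
qed

lemma Ck_on_local:
  assumes "\<And>x. x \<in> S \<Longrightarrow> \<exists>W. open W \<and> x \<in> W \<and> Ck_on m W f"
  shows "Ck_on m S f"
  using assms
proof (induction m arbitrary: f)
  case 0
  show ?case unfolding Ck_on.simps
  proof (rule continuous_at_imp_continuous_on, rule ballI)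
    fix x assume "x \<in> S"
    then obtain W where "open W" "x \<in> W" "continuous_on W f" using 0 by auto
    then show "isCont f x" by (simp add: continuous_on_eq_continuous_at)
  qed
next
  case (Suc m)
  have "Ck_on m S (\<lambda>x. frechet_derivative f (at x) v)" for v
    by (rule Suc.IH) (use Suc.prems in fastforce)
  moreover have "f differentiable (at x)" if "x \<in> S" for x using Suc.prems[OF that] by auto
  ultimately show ?case by simp
qed

text \<open>On an open subset the local extensions in the definition of \<open>smooth_on\<close>
  coincide with f nearby, so their derivatives are those of f.\<close>

lemma smooth_on_imp_Ck_on:
  assumes "smooth_on S f" "open T" "T \<subseteq> S"
  shows "Ck_on m T f"
proof (rule Ck_on_local)
  fix x assume x: "x \<in> T"
  then have "x \<in> S" using assms(3) by auto
  then obtain W g where "open W" "x \<in> W" "\<forall>m. Ck_on m W g" and eq: "\<forall>y\<in>W \<inter> S. g y = f y"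
    using assms(1) unfolding smooth_on_def by meson
  then have W: "open W" "x \<in> W" "Ck_on m W g" by auto
  have "Ck_on m (W \<inter> T) g" by (rule Ck_on_subset[OF W(3)]) auto
  then have "Ck_on m (W \<inter> T) f"
    using Ck_on_cong[of "W \<inter> T" g f m] W eq assms(2,3) by (auto simp: open_Int subset_iff)
  then show "\<exists>W. open W \<and> x \<in> W \<and> Ck_on m W f" using W x assms(2) by blast
qed

lemma smooth_on_derivative:
  fixes f :: "'a::real_normed_vector \<Rightarrow> 'b::real_normed_vector"
  assumes "smooth_on S f" "open T" "T \<subseteq> S"
  shows "x \<in> T \<Longrightarrow> (f has_derivative frechet_derivative f (at x)) (at x)"
    and "continuous_on T (\<lambda>x. frechet_derivative f (at x) v)"
    and "x \<in> T \<Longrightarrow> ((\<lambda>x. frechet_derivative f (at x) v) has_derivative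
      frechet_derivative (\<lambda>x. frechet_derivative f (at x) v) (at x)) (at x)"
    and "continuous_on T (\<lambda>x. frechet_derivative (\<lambda>x. frechet_derivative f (at x) v) (at x) v')"
proof -
  have 2: "Ck_on (Suc (Suc 0)) T f" by (rule smooth_on_imp_Ck_on[OF assms])
  then show "continuous_on T (\<lambda>x. frechet_derivative (\<lambda>x. frechet_derivative f (at x) v) (at x) v')"
    by simp
  have 1: "Ck_on (Suc 0) T f" by (rule smooth_on_imp_Ck_on[OF assms])
  then show "continuous_on T (\<lambda>x. frechet_derivative f (at x) v)" by simp
  show "x \<in> T \<Longrightarrow> (f has_derivative frechet_derivative f (at x)) (at x)"
    using 1 by (simp add: frechet_derivative_works)
  show "x \<in> T \<Longrightarrow> ((\<lambda>x. frechet_derivative f (at x) v) has_derivative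
      frechet_derivative (\<lambda>x. frechet_derivative f (at x) v) (at x)) (at x)"
    using 2 by (simp add: frechet_derivative_works)
qed

lemma has_derivative_sum_axis:
  assumes "(f has_derivative frechet_derivative f (at x)) (at x)"
  shows "(f has_derivative (\<lambda>h. \<Sum>j\<in>UNIV. h $ j *\<^sub>R frechet_derivative f (at x) (axis j 1))) (at x)"
  using linear_eq_sum_axis[OF has_derivative_linear[OF assms]] assms by (metis (no_types, lifting) has_derivative_eq_rhs ext)

text \<open>Near interior points the derivative within V is the ordinary one. For second derivatives
  this has to hold on a whole neighbourhood, hence the open set T.\<close>

lemma partial_interior:
  assumes "open T" "T \<subseteq> V" "x \<in> T"
  shows "partial V i f x = frechet_derivative f (at x) (axis i 1)"
    and "partial V i (partial V j f) x = frechet_derivative (\<lambda>x. frechet_derivative f (at x) (axis j 1)) (at x) (axis i 1)"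
proof -
  have at: "at y within V = at y" if "y \<in> T" for y
    by (rule at_within_interior) (use assms that in \<open>auto simp: interior_def\<close>)
  then show "partial V i f x = frechet_derivative f (at x) (axis i 1)" using assms by (simp add: partial_def)
  have "partial V j f y = frechet_derivative f (at y) (axis j 1)" if "y \<in> T" for y
    using at that by (simp add: partial_def)
  then show "partial V i (partial V j f) x = frechet_derivative (\<lambda>x. frechet_derivative f (at x) (axis j 1)) (at x) (axis i 1)"
    using frechet_derivative_cong_open(1)[OF assms(1,3), of "partial V j f" "\<lambda>x. frechet_derivative f (at x) (axis j 1)"] at assms(3)
    by (simp add: partial_def[of V i "partial V j f"])
qed

section \<open>Geodesics of the hyperboloid\<close>

text \<open>The operator D^2 - a^2 factors as (D - a)(D + a). So exp(-a t) (y' + a y) is constant,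
  hence zero, and then exp(a t) y is constant; this includes a = 0.\<close>

lemma harmonic_ode_unique:
  fixes y :: "real \<Rightarrow> 'a::euclidean_space"
  assumes y: "\<And>t. (y has_vector_derivative y' t) (at t)" "\<And>t. (y' has_vector_derivative a\<^sup>2 *\<^sub>R y t) (at t)"
    and 0: "y 0 = 0" "y' 0 = 0"
  shows "y t = 0"
proof -
  define z where "z t = exp (- a * t) *\<^sub>R (y' t + a *\<^sub>R y t)" for t
  have "(z has_vector_derivative 0) (at t)" for t
    unfolding z_def
    by (rule has_vector_derivative_eq_rhs, (rule derivative_eq_intros y refl)+)
       (auto simp: algebra_simps power2_eq_square)
  then have "z t = z 0" for t
    using has_vector_derivative_zero_constant[of UNIV z] by (metis convex_UNIV UNIV_I)
  then have y'_eq: "y' t = - a *\<^sub>R y t" for t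
    using 0 by (simp add: z_def eq_neg_iff_add_eq_0)
  define x where "x t = exp (a * t) *\<^sub>R y t" for t
  have "(x has_vector_derivative 0) (at t)" for t
    unfolding x_def
    by (rule has_vector_derivative_eq_rhs, (rule derivative_eq_intros y refl)+)
       (auto simp: algebra_simps y'_eq)
  then have "x t = x 0" for t
    using has_vector_derivative_zero_constant[of UNIV x] by (metis convex_UNIV UNIV_I)
  then show ?thesis using 0 by (simp add: x_def)
qed

lemma has_vector_derivative_vector_derivative:
  fixes y :: "real \<Rightarrow> 'a::real_normed_vector"
  assumes "(y has_derivative frechet_derivative y (at t)) (at t)"
  shows "(y has_vector_derivative vector_derivative y (at t)) (at t)"
  using assms by (metis differentiableI vector_derivative_works)

text \<open>Differentiating \<open>mink (\<gamma> t) (\<gamma> t) = -1\<close> twice determines the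
  normal component of the acceleration, and the geodesic equation kills the tangential one. The
  acceleration is then orthogonal to the velocity, so the squared speed is constant and the equation
  is linear with constant coefficients.\<close>

lemma geodesic_second_derivative:
  fixes \<gamma> :: "real \<Rightarrow> (real^'n) \<times> real"
  assumes \<gamma>: "geodesic \<gamma>"
  defines "y' \<equiv> \<lambda>t. vector_derivative \<gamma> (at t)"
  shows "(\<gamma> has_vector_derivative y' t) (at t)"
    and "(y' has_vector_derivative mink (y' 0) (y' 0) *\<^sub>R \<gamma> t) (at t)"
    and "y' t \<in> tangent_space (\<gamma> t)"
proof -
  have sm: "smooth_on UNIV \<gamma>" and H: "\<gamma> t \<in> hyperbolic_space"
    and geo: "tangent_proj (\<gamma> t) (vector_derivative y' (at t)) = 0" for t
    using \<gamma> by (auto simp: geodesic_def y'_def)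
  note d = smooth_on_derivative[OF sm open_UNIV subset_UNIV]
  show y': "(\<gamma> has_vector_derivative y' t) (at t)" for t
    unfolding y'_def by (rule has_vector_derivative_vector_derivative[OF d(1)[OF UNIV_I]])
  have y'_eq: "y' = (\<lambda>t. frechet_derivative \<gamma> (at t) 1)"
  proof
    show "y' t = frechet_derivative \<gamma> (at t) 1" for t
      using fun_cong[OF frechet_derivative_at[OF y'[of t, unfolded has_vector_derivative_def]], of 1] by simp
  qed
  define y'' where "y'' t = vector_derivative y' (at t)" for t
  have y'': "(y' has_vector_derivative y'' t) (at t)" for t
    unfolding y''_def
    by (rule has_vector_derivative_vector_derivative) (use d(3)[OF UNIV_I, of 1 t] in \<open>simp add: y'_eq\<close>)
  note mder = mink.has_vector_derivative
  have const: "f 0 = f t \<and> f' t = 0" if "\<And>t. (f has_vector_derivative f' t) (at t)" "\<And>t. f t = c" for f f' :: "real \<Rightarrow> real" and c t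
  proof -
    have "f = (\<lambda>t. c)" using that(2) by auto
    then show ?thesis using that(1)[of t] by (auto dest: vector_derivative_unique_at[OF has_vector_derivative_const])
  qed
  have gy: "mink (\<gamma> t) (y' t) = 0" for t
    using const[OF mder[OF y' y'], of "-1" t] H by (simp add: hyperbolic_space_def mink_commute)
  then show "y' t \<in> tangent_space (\<gamma> t)" by (simp add: tangent_space_def)
  have gy'': "mink (\<gamma> t) (y'' t) = - mink (y' t) (y' t)" for t
    using const[OF mder[OF y' y''], of 0 t] gy by simp
  have y''_eq: "y'' t = mink (y' t) (y' t) *\<^sub>R \<gamma> t" for t
    using geo[of t] gy''[of t] by (simp add: tangent_proj_def y''_def)
  have "((\<lambda>t. mink (y' t) (y' t)) has_vector_derivative 0) (at t)" for t
    using mder[OF y'' y'', of t] gy[of t]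
    by (simp add: y''_eq mink.scaleR_left mink.scaleR_right mink_commute)
  then have c: "mink (y' t) (y' t) = mink (y' 0) (y' 0)" for t
    using has_vector_derivative_zero_constant[of UNIV "\<lambda>t. mink (y' t) (y' t)"] by (metis convex_UNIV UNIV_I)
  show "(y' has_vector_derivative mink (y' 0) (y' 0) *\<^sub>R \<gamma> t) (at t)"
    using y''[of t] unfolding y''_eq[of t] c[of t] .
qed

text \<open>Differentiation exchanges and rescales the two coefficient vectors, so this class of
  curves is closed under it; hence the induction with b and d arbitrary.\<close>

lemma Ck_on_hyperbolic_line:
  fixes b d :: "'a::real_normed_vector"
  shows "Ck_on m UNIV (\<lambda>t. cosh (a * t) *\<^sub>R b + sinh (a * t) *\<^sub>R d)"
proof (induction m arbitrary: b d)
  case 0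
  show ?case by (auto intro!: continuous_intros)
next
  case (Suc m)
  have D: "((\<lambda>t. cosh (a * t) *\<^sub>R b + sinh (a * t) *\<^sub>R d) has_derivative
      (\<lambda>h. cosh (a * t) *\<^sub>R (h * a) *\<^sub>R d + sinh (a * t) *\<^sub>R (h * a) *\<^sub>R b)) (at t)" for t
    by (auto intro!: derivative_eq_intros simp: algebra_simps)
  then have "frechet_derivative (\<lambda>t. cosh (a * t) *\<^sub>R b + sinh (a * t) *\<^sub>R d) (at t) h =
      cosh (a * t) *\<^sub>R (h * a) *\<^sub>R d + sinh (a * t) *\<^sub>R (h * a) *\<^sub>R b" for t h
    using frechet_derivative_at[OF D] by (metis (no_types, lifting))
  then have eq: "(\<lambda>t. frechet_derivative (\<lambda>t. cosh (a * t) *\<^sub>R b + sinh (a * t) *\<^sub>R d) (at t) h) =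
      (\<lambda>t. cosh (a * t) *\<^sub>R (h * a) *\<^sub>R d + sinh (a * t) *\<^sub>R (h * a) *\<^sub>R b)" for h by blast
  show ?case unfolding Ck_on.simps eq using differentiableI[OF D] Suc by blast
qed

text \<open>The equation \<open>mink x x = - 1\<close> has two sheets. By the Cauchy-Schwarz
  inequality points of the lower one pair nonnegatively with p, so the sign of
  \<open>mink p x\<close> selects the sheet.\<close>

lemma hyperbolic_spaceI:
  fixes x p :: "(real^'n) \<times> real"
  assumes "mink x x = - 1" "mink p x < 0" "p \<in> hyperbolic_space"
  shows "x \<in> hyperbolic_space"
proof -
  have p: "norm (fst p) \<le> snd p" "0 < snd p"
  proof -
    show "0 < snd p" using assms(3) by (simp add: hyperbolic_space_def)
    have "(norm (fst p))\<^sup>2 \<le> (snd p)\<^sup>2"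
      unfolding power2_norm_eq_inner power2_eq_square[of "snd p"]
      using assms(3) by (simp add: hyperbolic_space_def mink_def)
    then show "norm (fst p) \<le> snd p" by (rule power2_le_imp_le) (use \<open>0 < snd p\<close> in simp)
  qed
  have "(norm (fst x))\<^sup>2 \<le> \<bar>snd x\<bar>\<^sup>2"
    unfolding power2_norm_eq_inner power2_abs power2_eq_square[of "snd x"]
    using assms(1) by (simp add: mink_def)
  then have x: "norm (fst x) \<le> \<bar>snd x\<bar>" by (rule power2_le_imp_le) simp
  have "0 < snd x"
  proof (rule ccontr)
    assume "\<not> 0 < snd x"
    then have "\<bar>snd x\<bar> = - snd x" by simp
    have "norm (fst p) * norm (fst x) \<le> snd p * \<bar>snd x\<bar>"
      by (rule mult_mono) (use p x in auto)
    moreover have "- (norm (fst p) * norm (fst x)) \<le> fst p \<bullet> fst x"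
      using Cauchy_Schwarz_ineq2[of "fst p" "fst x"] by linarith
    ultimately have "0 \<le> mink p x" using \<open>\<bar>snd x\<bar> = - snd x\<close> by (simp add: mink_def)
    then show False using assms(2) by simp
  qed
  then show ?thesis using assms(1) by (simp add: hyperbolic_space_def)
qed

text \<open>As \<open>hexp\<close> is a definite description, both existence and uniqueness are
  needed. The explicit curve is a geodesic, and any geodesic with the same initial data satisfies
  the same linear second-order equation with constant a^2.\<close>

lemma hexp_eq:
  fixes p v :: "(real^'n) \<times> real"
  assumes p: "p \<in> hyperbolic_space" and v: "v \<in> tangent_space p"
  shows "hexp p v = cosh (hnorm v) *\<^sub>R p + (sinh (hnorm v) / hnorm v) *\<^sub>R v"
proof -
  define a where "a = hnorm v"
  define \<gamma> where "\<gamma> t = cosh (a * t) *\<^sub>R p + sinh (a * t) *\<^sub>R (v /\<^sub>R a)" for t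
  define \<gamma>' where "\<gamma>' t = (a * sinh (a * t)) *\<^sub>R p + (a * cosh (a * t)) *\<^sub>R (v /\<^sub>R a)" for t
  have a2: "a\<^sup>2 = mink v v" using mink_tangent_nonneg[OF p v] by (simp add: a_def hnorm_def)
  have v0: "v = 0" if "a = 0" using that a2 mink_tangent_eq_0_iff[OF p v] by simp
  \<comment> \<open>If a = 0, definiteness on the tangent space gives v = 0, so the default value of
    division by zero is the correct one.\<close>
  have av: "a *\<^sub>R (v /\<^sub>R a) = v" using v0 by (cases "a = 0") auto
  have pp: "mink p p = - 1" and pv: "mink p v = 0" and vp: "mink v p = 0"
    using p v by (auto simp: hyperbolic_space_def tangent_space_def mink_commute)
  have d1: "(\<gamma> has_vector_derivative \<gamma>' t) (at t)" for t
    unfolding \<gamma>_def \<gamma>'_def has_vector_derivative_def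
    by (auto intro!: derivative_eq_intros simp: algebra_simps)
  have d2: "(\<gamma>' has_vector_derivative a\<^sup>2 *\<^sub>R \<gamma> t) (at t)" for t
    unfolding \<gamma>_def \<gamma>'_def has_vector_derivative_def
    by (auto intro!: derivative_eq_intros simp: algebra_simps power2_eq_square)
  have vv: "mink (v /\<^sub>R a) (v /\<^sub>R a) = (if a = 0 then 0 else 1)"
    using a2 v0 by (cases "a = 0") (auto simp: mink.scaleR_left mink.scaleR_right mink.zero_left power2_eq_square field_simps)
  have gg: "mink (\<gamma> t) (\<gamma> t) = - 1" for t
  proof -
    have "mink (\<gamma> t) (\<gamma> t) = - (cosh (a * t))\<^sup>2 + (sinh (a * t))\<^sup>2 * mink (v /\<^sub>R a) (v /\<^sub>R a)"
      by (simp add: \<gamma>_def mink.add_left mink.add_right mink.scaleR_left mink.scaleR_right pp pv vp power2_eq_square algebra_simps)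
    also have "\<dots> = - 1" unfolding vv using cosh_square_eq[of "a * t"] by (cases "a = 0") auto
    finally show ?thesis .
  qed
  have pg: "mink p (\<gamma> t) = - cosh (a * t)" for t
    by (simp add: \<gamma>_def mink.add_right mink.scaleR_right pp pv)
  have gH: "\<gamma> t \<in> hyperbolic_space" for t
    by (rule hyperbolic_spaceI[OF gg _ p]) (simp add: pg)
  have geo: "geodesic \<gamma>"
    unfolding geodesic_def
  proof (intro conjI allI)
    show "smooth_on UNIV \<gamma>"
      unfolding smooth_on_def \<gamma>_def using Ck_on_hyperbolic_line by blast
    show "range \<gamma> \<subseteq> hyperbolic_space" using gH by auto
    have "(\<lambda>s. vector_derivative \<gamma> (at s)) = \<gamma>'" using d1 by (auto intro: vector_derivative_at)
    then show "tangent_proj (\<gamma> t) (vector_derivative (\<lambda>s. vector_derivative \<gamma> (at s)) (at t)) = 0" for t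
      using vector_derivative_at[OF d2, of t] by (simp add: tangent_proj_def mink.scaleR_right gg)
  qed
  have \<gamma>0: "\<gamma> 0 = p" "\<gamma>' 0 = v" using av by (simp_all add: \<gamma>_def \<gamma>'_def)
  have uniq: "\<delta> 1 = \<gamma> 1" if \<delta>: "geodesic \<delta>" "\<delta> 0 = p" "vector_derivative \<delta> (at 0) = v" for \<delta>
  proof -
    define \<delta>' where "\<delta>' t = vector_derivative \<delta> (at t)" for t
    have e1: "(\<delta> has_vector_derivative \<delta>' t) (at t)" for t
      unfolding \<delta>'_def by (rule geodesic_second_derivative(1)[OF \<delta>(1)])
    have e2: "(\<delta>' has_vector_derivative a\<^sup>2 *\<^sub>R \<delta> t) (at t)" for t
      using geodesic_second_derivative(2)[OF \<delta>(1), of t] \<delta>(3) a2 by (simp add: \<delta>'_def[abs_def])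
    have "\<delta> 1 - \<gamma> 1 = 0"
    proof (rule harmonic_ode_unique[where y = "\<lambda>t. \<delta> t - \<gamma> t" and y' = "\<lambda>t. \<delta>' t - \<gamma>' t" and a = a])
      show "((\<lambda>t. \<delta> t - \<gamma> t) has_vector_derivative \<delta>' t - \<gamma>' t) (at t)" for t
        by (rule has_vector_derivative_diff[OF e1 d1])
      show "((\<lambda>t. \<delta>' t - \<gamma>' t) has_vector_derivative a\<^sup>2 *\<^sub>R (\<delta> t - \<gamma> t)) (at t)" for t
        using has_vector_derivative_diff[OF e2 d2] by (simp add: scaleR_diff_right)
    qed (use \<delta> \<gamma>0 in \<open>auto simp: \<delta>'_def\<close>)
    then show ?thesis by simp
  qed
  have "hexp p v = \<gamma> 1"
    unfolding hexp_def
  proof (rule the_equality)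
    show "\<exists>\<gamma>'. geodesic \<gamma>' \<and> \<gamma>' 0 = p \<and> vector_derivative \<gamma>' (at 0) = v \<and> \<gamma>' 1 = \<gamma> 1"
      using geo \<gamma>0 vector_derivative_at[OF d1, of 0] by auto
  qed (use uniq in auto)
  then show ?thesis by (simp add: \<gamma>_def a_def divide_inverse)
qed

text \<open>Turns membership in geodesic balls and spheres into a condition on the height - mink
  p.\<close>

lemma mink_hexp:
  assumes "p \<in> hyperbolic_space" "v \<in> tangent_space p"
  shows "- mink p (hexp p v) = cosh (hnorm v)"
  using assms by (simp add: hexp_eq mink.add_right mink.scaleR_right tangent_space_def hyperbolic_space_def)

section \<open>Integration over a manifold\<close>

context
  fixes g :: "real^'k \<Rightarrow> real^'k" and g' :: "real^'k \<Rightarrow> real^'k \<Rightarrow> real^'k" and S :: "(real^'k) set"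
  assumes S: "S \<in> sets borel" "g ` S \<in> sets borel"
    and der: "\<And>x. x \<in> S \<Longrightarrow> (g has_derivative g' x) (at x within S)"
    and inj: "inj_on g S" and cont: "\<And>v. continuous_on S (\<lambda>x. g' x v)"
begin

text \<open>Change of variables as an equality of measures: on a Borel set E both sides are the
  volume of the image of S intersected with the preimage of E. The integral formulas for nonnegative
  and for real functions both follow from it.\<close>

lemma distr_differentiable_image:
  shows "distr (density lborel (\<lambda>x. ennreal (indicator S x * \<bar>det (matrix (g' x))\<bar>))) borel (\<lambda>x. if x \<in> S then g x else 0) =
    density lborel (indicator (g ` S))"
    and "(\<lambda>x. indicator S x * \<bar>det (matrix (g' x))\<bar>) \<in> borel_measurable borel"
    and "(\<lambda>x. if x \<in> S then g x else 0) \<in> borel_measurable borel"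
proof -
  let ?h = "\<lambda>x. if x \<in> S then g x else 0" and ?d = "\<lambda>x. indicator S x * \<bar>det (matrix (g' x))\<bar>"
  have contg: "continuous_on S g"
    using der by (meson has_derivative_continuous continuous_on_eq_continuous_within)
  show h: "?h \<in> borel_measurable borel"
    using S(1) contg by (intro borel_measurable_continuous_on_if) auto
  have "continuous_on S (\<lambda>x. \<bar>det (matrix (g' x))\<bar>)"
    unfolding det_def matrix_def
    by (simp, intro continuous_intros continuous_on_component[OF cont])
  from borel_measurable_continuous_on_indicator[OF S(1) this]
  show d: "?d \<in> borel_measurable borel" by simp
  show "distr (density lborel (\<lambda>x. ennreal (?d x))) borel ?h = density lborel (indicator (g ` S))"
  proof (rule measure_eqI)
    fix E assume "E \<in> sets (distr (density lborel (\<lambda>x. ennreal (?d x))) borel ?h)"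
    then have E: "E \<in> sets borel" by simp
    define T where "T = S \<inter> ?h -` E"
    have T: "T \<in> sets borel" unfolding T_def using measurable_sets[OF h E] S(1) by auto
    have gT: "g ` T = g ` S \<inter> E" by (auto simp: T_def)
    have TS: "T \<subseteq> S" by (auto simp: T_def)
    have "emeasure (distr (density lborel (\<lambda>x. ennreal (?d x))) borel ?h) E =
        emeasure (density lborel (\<lambda>x. ennreal (?d x))) (?h -` E)"
      using h E by (subst emeasure_distr) auto
    also have "\<dots> = (\<integral>\<^sup>+x. ennreal (?d x) * indicator (?h -` E) x \<partial>lborel)"
      using h E d measurable_sets[OF h E] by (subst emeasure_density) auto
    also have "\<dots> = (\<integral>\<^sup>+x. ennreal (indicator T x * \<bar>det (matrix (g' x))\<bar>) \<partial>lborel)"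
      by (intro nn_integral_cong) (auto simp: T_def indicator_def)
    also have "\<dots> = emeasure lborel (g ` T)"
    proof (rule emeasure_differentiable_image[symmetric])
      show "T \<in> sets borel" "g ` T \<in> sets borel" using T S(2) E by (auto simp: gT)
      show "(g has_derivative g' x) (at x within T)" if "x \<in> T" for x
        using der TS that has_derivative_subset by blast
      show "inj_on g T" using inj TS by (rule inj_on_subset)
      have "(\<lambda>x. indicator T x * \<bar>det (matrix (g' x))\<bar>) = (\<lambda>x. indicator T x * ?d x)"
        using TS by (auto simp: indicator_def fun_eq_iff)
      then show "(\<lambda>x. indicator T x * \<bar>det (matrix (g' x))\<bar>) \<in> borel_measurable borel"
        using T d by simp
    qed
    also have "\<dots> = emeasure (density lborel (indicator (g ` S))) E"
      using S(2) E by (subst emeasure_density) (auto simp: gT simp flip: indicator_inter_arith nn_integral_indicator)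
    finally show "emeasure (distr (density lborel (\<lambda>x. ennreal (?d x))) borel ?h) E = emeasure (density lborel (indicator (g ` S))) E" .
  qed simp
qed

lemma nn_integral_differentiable_image:
  fixes F :: "real^'k \<Rightarrow> ennreal"
  assumes F: "F \<in> borel_measurable borel"
  shows "(\<integral>\<^sup>+x\<in>S. ennreal \<bar>det (matrix (g' x))\<bar> * F (g x) \<partial>lborel) = (\<integral>\<^sup>+x\<in>g ` S. F x \<partial>lborel)"
proof -
  let ?h = "\<lambda>x. if x \<in> S then g x else 0" and ?d = "\<lambda>x. indicator S x * \<bar>det (matrix (g' x))\<bar>"
  note D = distr_differentiable_image
  note [measurable] = D(2,3)
  have [measurable]: "g ` S \<in> sets borel" by (rule S)
  note [measurable] = F
  have "(\<integral>\<^sup>+x\<in>g ` S. F x \<partial>lborel) = (\<integral>\<^sup>+x. F x \<partial>density lborel (indicator (g ` S)))"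
    by (subst nn_integral_density) (auto simp: mult.commute)
  also have "\<dots> = (\<integral>\<^sup>+x. F (?h x) \<partial>density lborel (\<lambda>x. ennreal (?d x)))"
    unfolding D(1)[symmetric] by (rule nn_integral_distr) auto
  also have "\<dots> = (\<integral>\<^sup>+x. ennreal (?d x) * F (?h x) \<partial>lborel)"
    by (rule nn_integral_density) auto
  also have "\<dots> = (\<integral>\<^sup>+x\<in>S. ennreal \<bar>det (matrix (g' x))\<bar> * F (g x) \<partial>lborel)"
    by (intro nn_integral_cong) (auto simp: indicator_def)
  finally show ?thesis ..
qed

lemma integral_differentiable_image:
  fixes F :: "real^'k \<Rightarrow> real"
  assumes F: "(\<lambda>x. indicator (g ` S) x * F x) \<in> borel_measurable borel"
  shows "(\<integral>x. indicator S x * (\<bar>det (matrix (g' x))\<bar> * F (g x)) \<partial>lborel) = (\<integral>x. indicator (g ` S) x * F x \<partial>lborel)"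
proof -
  let ?h = "\<lambda>x. if x \<in> S then g x else 0" and ?d = "\<lambda>x. indicator S x * \<bar>det (matrix (g' x))\<bar>"
  let ?F = "\<lambda>x. indicator (g ` S) x * F x"
  note D = distr_differentiable_image
  note [measurable] = D(2,3)
  have [measurable]: "g ` S \<in> sets borel" by (rule S)
  have dens: "density lborel (indicator (g ` S)) = density lborel (\<lambda>x. ennreal (indicator (g ` S) x))"
    by (rule arg_cong[where f = "density lborel"]) (auto simp: fun_eq_iff indicator_def)
  note [measurable] = F
  have "(\<integral>x. ?F x \<partial>lborel) = (\<integral>x. indicator (g ` S) x * ?F x \<partial>lborel)"
    by (intro Bochner_Integration.integral_cong) (auto simp: indicator_def)
  also have "\<dots> = (\<integral>x. ?F x \<partial>density lborel (\<lambda>x. ennreal (indicator (g ` S) x)))"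
    by (subst integral_density) auto
  also have "\<dots> = (\<integral>x. ?F (?h x) \<partial>density lborel (\<lambda>x. ennreal (?d x)))"
    unfolding dens[symmetric] D(1)[symmetric] by (rule integral_distr) auto
  also have "\<dots> = (\<integral>x. ?d x * ?F (?h x) \<partial>lborel)"
    by (subst integral_density) auto
  also have "\<dots> = (\<integral>x. indicator S x * (\<bar>det (matrix (g' x))\<bar> * F (g x)) \<partial>lborel)"
    by (intro Bochner_Integration.integral_cong) (auto simp: indicator_def)
  finally show ?thesis ..
qed

end

text \<open>A cutoff equal to 1 for t up to 1 and to 0 from t = 2 on. Squares of positive parts are
  continuously differentiable, which is all the smoothness that integration by parts
  requires.\<close>

definition bump :: "real \<Rightarrow> real" where
  "bump t = (max 0 (1 - (max 0 (t - 1))\<^sup>2))\<^sup>2"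

lemma has_derivative_max_0_square:
  "((\<lambda>t::real. (max 0 t)\<^sup>2) has_real_derivative 2 * max 0 t) (at t)"
proof -
  consider "t < 0" | "t > 0" | "t = 0" by linarith
  then show ?thesis
  proof cases
    case 1
    have "((\<lambda>t::real. 0) has_real_derivative 2 * max 0 t) (at t)" using 1 by simp
    then show ?thesis
      by (rule has_field_derivative_transform_within_open[where S = "{..<0}"]) (use 1 in auto)
  next
    case 2
    have "((\<lambda>t::real. t\<^sup>2) has_real_derivative 2 * max 0 t) (at t)"
      using 2 by (auto intro!: derivative_eq_intros)
    then show ?thesis
      by (rule has_field_derivative_transform_within_open[where S = "{0<..}"]) (use 2 in auto)
  next
    case 3
    have "(\<lambda>h::real. (max 0 h)\<^sup>2 / h) \<midarrow>0\<rightarrow> 0"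
    proof (rule tendsto_rabs_zero_cancel, rule Lim_null_comparison)
      show "\<forall>\<^sub>F h::real in at 0. norm \<bar>(max 0 h)\<^sup>2 / h\<bar> \<le> \<bar>h\<bar>"
        by (rule always_eventually) (auto simp: max_def power2_eq_square)
      show "((\<lambda>h::real. \<bar>h\<bar>) \<longlongrightarrow> 0) (at 0)" by (rule tendsto_rabs_zero) simp
    qed
    then show ?thesis using 3 by (simp add: DERIV_def)
  qed
qed

lemma bump_derivative:
  "(bump has_real_derivative 2 * max 0 (1 - (max 0 (t - 1))\<^sup>2) * - (2 * max 0 (t - 1))) (at t)"
proof -
  have 1: "((\<lambda>t. (max 0 (t - 1))\<^sup>2) has_real_derivative 2 * max 0 (t - 1)) (at t)"
  proof -
    have "((\<lambda>t. t - 1) has_real_derivative 1) (at t)" by (auto intro!: derivative_eq_intros)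
    from DERIV_chain2[OF has_derivative_max_0_square this] show ?thesis by simp
  qed
  have "((\<lambda>t. 1 - (max 0 (t - 1))\<^sup>2) has_real_derivative - (2 * max 0 (t - 1))) (at t)"
    using DERIV_diff[OF DERIV_const[of 1] 1] by simp
  from DERIV_chain2[OF has_derivative_max_0_square this] show ?thesis
    by (simp add: bump_def[abs_def])
qed

lemma bump_eq_1: "t \<le> 1 \<Longrightarrow> bump t = 1"
  by (simp add: bump_def max_def)

lemma bump_eq_0:
  assumes "2 \<le> t"
  shows "bump t = 0"
proof -
  have m: "max 0 (t - 1) = t - 1" using assms by simp
  have "1 \<le> (t - 1)\<^sup>2" using power_mono[of 1 "t - 1" 2] assms by simp
  then have "max 0 (1 - (t - 1)\<^sup>2) = 0" by (intro max_absorb1) linarith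
  then show ?thesis by (simp add: bump_def m)
qed

lemma C1_on_bump:
  fixes c :: "'a::euclidean_space"
  shows "C1_on UNIV (\<lambda>y. bump ((norm (y - c))\<^sup>2 / r\<^sup>2))"
proof (rule C1_on_compose_real[where \<phi> = bump and \<phi>' = "\<lambda>t. 2 * max 0 (1 - (max 0 (t - 1))\<^sup>2) * - (2 * max 0 (t - 1))"])
  show "C1_on UNIV (\<lambda>y. (norm (y - c))\<^sup>2 / r\<^sup>2)"
  proof (rule C1_onI)
    show "((\<lambda>y. (norm (y - c))\<^sup>2 / r\<^sup>2) has_derivative (\<lambda>h. 2 * ((x - c) \<bullet> h) / r\<^sup>2)) (at x)" for x
    proof -
      have "((\<lambda>y. (y - c) \<bullet> (y - c) * inverse (r\<^sup>2)) has_derivative (\<lambda>h. 2 * ((x - c) \<bullet> h) * inverse (r\<^sup>2))) (at x)"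
        by (auto intro!: derivative_eq_intros simp: inner_commute)
      then show ?thesis by (simp add: divide_inverse power2_norm_eq_inner)
    qed
  qed (auto simp: divide_inverse intro!: continuous_intros)
qed (rule bump_derivative, intro continuous_intros)

text \<open>\<open>C1_on\<close> gives continuity for each fixed direction; expanding in coordinate
  directions allows the direction to vary with the point.\<close>

lemma continuous_on_frechet_derivative_apply:
  fixes h :: "real^'k \<Rightarrow> real"
  assumes h: "C1_on U h" and g: "continuous_on A g" "g ` A \<subseteq> U" and v: "continuous_on A v"
  shows "continuous_on A (\<lambda>x. frechet_derivative h (at (g x)) (v x))"
proof -
  let ?d = "\<lambda>y. frechet_derivative h (at y)"
  have "?d y b = (\<Sum>l\<in>UNIV. b $ l * ?d y (axis l 1))" if "y \<in> U" for y b
    using linear_eq_sum_axis[OF has_derivative_linear[OF C1_on_frechet_derivative(1)[OF h that]], of b] by simp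
  then have eq: "?d (g x) (v x) = (\<Sum>l\<in>UNIV. v x $ l * ?d (g x) (axis l 1))" if "x \<in> A" for x
    using g(2) that by blast
  have "continuous_on A (\<lambda>x. \<Sum>l\<in>UNIV. v x $ l * ?d (g x) (axis l 1))"
    by (intro continuous_intros continuous_on_component v
        continuous_on_compose2[OF C1_on_frechet_derivative(2)[OF h] g])
  then show ?thesis by (rule continuous_on_eq) (simp add: eq)
qed

section \<open>The divergence theorem on a manifold with finitely many charts\<close>

text \<open>A vector field, with components \<open>X i\<close> and divergence \<open>D i\<close> in the chart \<open>par i\<close>, on a manifold with
  volume densities \<open>w i\<close>. Assumption \<open>div\<close> is the divergence theorem for the field multiplied by a cutoff
  supported in a single chart.\<close>

locale chart_field =
  fixes n :: nat and V :: "nat \<Rightarrow> (real^'k) set" and par :: "nat \<Rightarrow> real^'k \<Rightarrow> 'm"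
    and c :: "nat \<Rightarrow> real^'k" and r :: "nat \<Rightarrow> real"
    and \<tau> :: "nat \<Rightarrow> nat \<Rightarrow> real^'k \<Rightarrow> real^'k" and \<tau>' :: "nat \<Rightarrow> nat \<Rightarrow> real^'k \<Rightarrow> real^'k \<Rightarrow> real^'k"
    and w :: "nat \<Rightarrow> real^'k \<Rightarrow> real" and X :: "nat \<Rightarrow> real^'k \<Rightarrow> real^'k" and D :: "nat \<Rightarrow> real^'k \<Rightarrow> real"
    and K :: "'m set"
  assumes open_V: "i < n \<Longrightarrow> open (V i)"
    and inj_par: "i < n \<Longrightarrow> inj_on (par i) (V i)"
    and r_pos: "i < n \<Longrightarrow> 0 < r i"
    and cball_V: "i < n \<Longrightarrow> cball (c i) (2 * r i) \<subseteq> V i"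
    and \<tau>: "i < n \<Longrightarrow> j < n \<Longrightarrow> x \<in> V i \<Longrightarrow> par i x \<in> par j ` V j \<Longrightarrow> \<tau> i j x \<in> V j \<and> par j (\<tau> i j x) = par i x"
    and \<tau>': "i < n \<Longrightarrow> j < n \<Longrightarrow> x \<in> V i \<Longrightarrow> par i x \<in> par j ` V j \<Longrightarrow> (\<tau> i j has_derivative \<tau>' i j x) (at x)"
    and \<tau>'_cont: "i < n \<Longrightarrow> j < n \<Longrightarrow> continuous_on {x \<in> V i. par i x \<in> par j ` V j} (\<lambda>x. \<tau>' i j x v)"
    and open_overlap: "i < n \<Longrightarrow> j < n \<Longrightarrow> open {x \<in> V i. par i x \<in> par j ` V j}"
    and open_outside: "i < n \<Longrightarrow> j < n \<Longrightarrow> open {x \<in> V i. par i x \<notin> par j ` cball (c j) (2 * r j)}"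
    and w_change: "i < n \<Longrightarrow> j < n \<Longrightarrow> x \<in> V i \<Longrightarrow> par i x \<in> par j ` V j \<Longrightarrow>
      w i x = \<bar>det (matrix (\<tau>' i j x))\<bar> * w j (\<tau> i j x)"
    and X_change: "i < n \<Longrightarrow> j < n \<Longrightarrow> x \<in> V i \<Longrightarrow> par i x \<in> par j ` V j \<Longrightarrow> X j (\<tau> i j x) = \<tau>' i j x (X i x)"
    and D_change: "i < n \<Longrightarrow> j < n \<Longrightarrow> x \<in> V i \<Longrightarrow> par i x \<in> par j ` V j \<Longrightarrow> D j (\<tau> i j x) = D i x"
    and w_cont: "i < n \<Longrightarrow> continuous_on (V i) (w i)"
    and X_cont: "i < n \<Longrightarrow> continuous_on (V i) (X i)"
    and D_cont: "i < n \<Longrightarrow> continuous_on (V i) (D i)"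
    and outside_K: "i < n \<Longrightarrow> x \<in> V i \<Longrightarrow> par i x \<notin> K \<Longrightarrow> D i x = 0 \<and> X i x = 0"
    and cover: "K \<subseteq> (\<Union>i<n. par i ` ball (c i) (r i))"
    and div: "i < n \<Longrightarrow> C1_on (V i) \<psi> \<Longrightarrow> compact C \<Longrightarrow> C \<subseteq> V i \<Longrightarrow> (\<And>x. x \<in> V i \<Longrightarrow> x \<notin> C \<Longrightarrow> \<psi> x = 0) \<Longrightarrow>
      (\<integral>x. indicator (V i) x * ((\<psi> x * D i x + frechet_derivative \<psi> (at x) (X i x)) * w i x) \<partial>lborel) = 0"
begin

abbreviation "T i j \<equiv> {x \<in> V i. par i x \<in> par j ` V j}"

text \<open>Each point covered by the balls is assigned to the first ball containing it, so the
  images of these sets partition the union of the balls.\<close>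

definition S :: "nat \<Rightarrow> (real^'k) set" where
  "S i = {x \<in> ball (c i) (r i). \<forall>j<i. par i x \<notin> par j ` ball (c j) (r j)}"

definition smooth :: "('m \<Rightarrow> real) \<Rightarrow> bool" where
  "smooth \<eta> \<longleftrightarrow> (\<forall>i<n. C1_on (V i) (\<lambda>x. \<eta> (par i x)))"

text \<open>The divergence of \<eta> times the field, multiplied by the volume density, in chart i.
  The functional \<Lambda> integrates it over the manifold, piece by piece.\<close>

definition I :: "('m \<Rightarrow> real) \<Rightarrow> nat \<Rightarrow> real^'k \<Rightarrow> real" where
  "I \<eta> i x = (\<eta> (par i x) * D i x + frechet_derivative (\<lambda>x. \<eta> (par i x)) (at x) (X i x)) * w i x"

definition \<Lambda> :: "('m \<Rightarrow> real) \<Rightarrow> real" where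
  "\<Lambda> \<eta> = (\<Sum>i<n. \<integral>x. indicator (S i) x * I \<eta> i x \<partial>lborel)"

lemma ball_V: "i < n \<Longrightarrow> ball (c i) (r i) \<subseteq> V i"
  using cball_V[of i] r_pos[of i] by (auto simp: subset_iff)

lemma S_cball: "i < n \<Longrightarrow> S i \<subseteq> cball (c i) (2 * r i)"
  using r_pos[of i] by (auto simp: S_def)

lemma S_V: "i < n \<Longrightarrow> S i \<subseteq> V i"
  using S_cball cball_V by blast

lemma open_overlap_ball:
  assumes "i < n" "j < n" "U \<subseteq> V j" "open U"
  shows "open {x \<in> V i. par i x \<in> par j ` U}"
proof -
  have cont: "continuous_on (T i j) (\<tau> i j)"
    using \<tau>' assms by (intro continuous_at_imp_continuous_on) (auto intro!: has_derivative_continuous)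
  have "{x \<in> V i. par i x \<in> par j ` U} = T i j \<inter> \<tau> i j -` U"
  proof (intro set_eqI iffI)
    fix x assume x: "x \<in> {x \<in> V i. par i x \<in> par j ` U}"
    then have xT: "x \<in> T i j" using assms(3) by auto
    obtain y where y: "y \<in> U" "par i x = par j y" using x by auto
    have "\<tau> i j x = y"
      using \<tau>[OF assms(1,2), of x] xT y assms(3) inj_onD[OF inj_par[OF assms(2)]] by auto
    then show "x \<in> T i j \<inter> \<tau> i j -` U" using xT y by auto
  next
    fix x assume x: "x \<in> T i j \<inter> \<tau> i j -` U"
    then have "par i x = par j (\<tau> i j x)" "\<tau> i j x \<in> U" "x \<in> V i" using \<tau>[OF assms(1,2)] by auto
    then show "x \<in> {x \<in> V i. par i x \<in> par j ` U}" by blast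
  qed
  then show ?thesis using continuous_open_preimage[OF cont open_overlap[OF assms(1,2)] assms(4)] by simp
qed

lemma borel_S:
  assumes i: "i < n"
  shows "S i \<in> sets borel"
proof -
  have "S i = ball (c i) (r i) - (\<Union>j<i. {x \<in> V i. par i x \<in> par j ` ball (c j) (r j)})"
    using ball_V[OF i] by (auto simp: S_def)
  moreover have "open (\<Union>j<i. {x \<in> V i. par i x \<in> par j ` ball (c j) (r j)})"
    using i by (intro open_UN ballI open_overlap_ball ball_V) auto
  ultimately show ?thesis by simp
qed

lemma continuous_I:
  assumes "i < n" "smooth \<eta>"
  shows "continuous_on (V i) (I \<eta> i)"
proof -
  have C1: "C1_on (V i) (\<lambda>x. \<eta> (par i x))" using assms by (simp add: smooth_def)
  let ?d = "\<lambda>x. frechet_derivative (\<lambda>x. \<eta> (par i x)) (at x)"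
  have "continuous_on (V i) (\<lambda>x. ?d x (X i x))"
    by (rule continuous_on_frechet_derivative_apply[OF C1 continuous_on_id]) (auto intro: X_cont assms)
  then show ?thesis unfolding I_def[abs_def]
    by (intro continuous_intros w_cont D_cont C1_on_imp_continuous_on[OF C1] assms)
qed

lemma integrable_I:
  assumes "i < n" "smooth \<eta>" "B \<in> sets borel" "B \<subseteq> cball (c i) (2 * r i)"
  shows "integrable lborel (\<lambda>x. indicator B x * I \<eta> i x)"
proof -
  have "set_integrable lborel (cball (c i) (2 * r i)) (I \<eta> i)"
    unfolding set_integrable_def
    by (rule borel_integrable_compact[OF _ continuous_on_subset[OF continuous_I[OF assms(1,2)] cball_V[OF assms(1)]]]) simp
  then have "set_integrable lborel B (I \<eta> i)"
    by (rule set_integrable_subset) (use assms in auto)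
  then show ?thesis by (simp add: set_integrable_def)
qed

lemma \<Lambda>_diff:
  assumes "smooth \<eta>" "smooth \<zeta>"
  shows "\<Lambda> (\<lambda>m. \<eta> m - \<zeta> m) = \<Lambda> \<eta> - \<Lambda> \<zeta>"
proof -
  have "(\<integral>x. indicator (S i) x * I (\<lambda>m. \<eta> m - \<zeta> m) i x \<partial>lborel) =
    (\<integral>x. indicator (S i) x * I \<eta> i x \<partial>lborel) - (\<integral>x. indicator (S i) x * I \<zeta> i x \<partial>lborel)" if i: "i < n" for i
  proof -
    have "indicator (S i) x * I (\<lambda>m. \<eta> m - \<zeta> m) i x = indicator (S i) x * I \<eta> i x - indicator (S i) x * I \<zeta> i x" for x
    proof (cases "x \<in> S i")
      case True
      then have x: "x \<in> V i" using S_V[OF i] by auto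
      have 1: "C1_on (V i) (\<lambda>x. \<eta> (par i x))" "C1_on (V i) (\<lambda>x. \<zeta> (par i x))"
        using assms i by (auto simp: smooth_def)
      have "frechet_derivative (\<lambda>x. \<eta> (par i x) - \<zeta> (par i x)) (at x) =
        (\<lambda>v. frechet_derivative (\<lambda>x. \<eta> (par i x)) (at x) v - frechet_derivative (\<lambda>x. \<zeta> (par i x)) (at x) v)"
        by (rule sym[OF frechet_derivative_at[OF has_derivative_diff[OF C1_on_frechet_derivative(1)[OF 1(1) x] C1_on_frechet_derivative(1)[OF 1(2) x]]]])
      then show ?thesis by (simp add: I_def algebra_simps)
    qed simp
    then show ?thesis
      using integrable_I[OF i assms(1) borel_S[OF i] S_cball[OF i]] integrable_I[OF i assms(2) borel_S[OF i] S_cball[OF i]]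
      by (simp only: Bochner_Integration.integral_diff)
  qed
  then show ?thesis by (simp add: \<Lambda>_def sum_subtractf)
qed

text \<open>Equal to 1 on the ball of radius r, and zero from distance sqrt 2 times r on, hence
  supported inside the closed ball of radius 2 r that the chart contains.\<close>

definition \<theta> :: "nat \<Rightarrow> 'm \<Rightarrow> real" where
  "\<theta> a m = (if m \<in> par a ` V a then bump ((norm (inv_into (V a) (par a) m - c a))\<^sup>2 / (r a)\<^sup>2) else 0)"

lemma \<theta>_par: "a < n \<Longrightarrow> y \<in> V a \<Longrightarrow> \<theta> a (par a y) = bump ((norm (y - c a))\<^sup>2 / (r a)\<^sup>2)"
  by (simp add: \<theta>_def inv_into_f_f inj_par)

lemma \<theta>_eq_1:
  assumes "a < n" "y \<in> ball (c a) (r a)"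
  shows "\<theta> a (par a y) = 1"
proof -
  have "(norm (y - c a))\<^sup>2 \<le> (r a)\<^sup>2" using assms(2) by (intro power_mono) (auto simp: dist_norm norm_minus_commute)
  then have "(norm (y - c a))\<^sup>2 / (r a)\<^sup>2 \<le> 1" using r_pos[OF assms(1)] by simp
  then show ?thesis using assms ball_V[OF assms(1)] by (simp add: \<theta>_par bump_eq_1 subset_iff)
qed

lemma \<theta>_eq_0:
  assumes "a < n" "m \<notin> par a ` cball (c a) (2 * r a)"
  shows "\<theta> a m = 0"
proof (cases "m \<in> par a ` V a")
  case True
  then obtain y where y: "y \<in> V a" "m = par a y" by auto
  then have "y \<notin> cball (c a) (2 * r a)" using assms(2) by auto
  then have "2 * r a \<le> norm (y - c a)" by (auto simp: dist_norm norm_minus_commute)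
  then have "(2 * r a)\<^sup>2 \<le> (norm (y - c a))\<^sup>2" using r_pos[OF assms(1)] by (intro power_mono) auto
  then have "4 \<le> (norm (y - c a))\<^sup>2 / (r a)\<^sup>2" using r_pos[OF assms(1)] by (simp add: pos_le_divide_eq power_mult_distrib)
  then show ?thesis using y by (simp add: \<theta>_par[OF assms(1)] bump_eq_0)
qed (simp add: \<theta>_def)

text \<open>Two open sets cover the domain of chart i: the overlap with chart a, where \<theta> is
  the cutoff composed with the transition map, and the part outside the closed ball of radius 2 r,
  where \<theta> vanishes.\<close>

lemma smooth_\<theta>:
  assumes a: "a < n"
  shows "smooth (\<theta> a)"
  unfolding smooth_def
proof (intro allI impI)
  fix i assume i: "i < n"
  let ?b = "\<lambda>y. bump ((norm (y - c a))\<^sup>2 / (r a)\<^sup>2)"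
  let ?O = "{x \<in> V i. par i x \<notin> par a ` cball (c a) (2 * r a)}"
  note b = C1_on_bump[of "c a" "r a"]
  have "C1_on (T i a) (\<lambda>x. ?b (\<tau> i a x))"
  proof (rule C1_onI)
    let ?d = "\<lambda>y. frechet_derivative ?b (at y)"
    show "((\<lambda>x. ?b (\<tau> i a x)) has_derivative (\<lambda>v. ?d (\<tau> i a x) (\<tau>' i a x v))) (at x)" if "x \<in> T i a" for x
      using has_derivative_compose[OF \<tau>'[OF i a] C1_on_frechet_derivative(1)[OF b UNIV_I]] that by auto
    have contau: "continuous_on (T i a) (\<tau> i a)"
      using \<tau>'[OF i a] by (intro continuous_at_imp_continuous_on) (auto intro!: has_derivative_continuous)
    show "continuous_on (T i a) (\<lambda>x. ?d (\<tau> i a x) (\<tau>' i a x v))" for v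
      by (rule continuous_on_frechet_derivative_apply[OF b contau]) (auto intro: \<tau>'_cont i a)
  qed
  moreover have "\<theta> a (par i x) = ?b (\<tau> i a x)" if "x \<in> T i a" for x
    using \<tau>[OF i a, of x] that \<theta>_par[OF a, of "\<tau> i a x"] by auto
  ultimately have "C1_on (T i a) (\<lambda>x. \<theta> a (par i x))"
    using C1_on_cong[OF open_overlap[OF i a]] by (metis (no_types, lifting))
  moreover have "C1_on ?O (\<lambda>x. \<theta> a (par i x))"
    using C1_on_cong[OF open_outside[OF i a], of "\<lambda>x. \<theta> a (par i x)" "\<lambda>x. 0"] \<theta>_eq_0[OF a] C1_on_const by auto
  ultimately have "C1_on (T i a \<union> ?O) (\<lambda>x. \<theta> a (par i x))"
    by (rule C1_on_open_Un[OF open_overlap[OF i a] open_outside[OF i a]])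
  moreover have "T i a \<union> ?O = V i" using cball_V[OF a] by auto
  ultimately show "C1_on (V i) (\<lambda>x. \<theta> a (par i x))" by simp
qed

lemma smooth_mult: "smooth \<eta> \<Longrightarrow> smooth \<zeta> \<Longrightarrow> smooth (\<lambda>m. \<eta> m * \<zeta> m)"
  by (simp add: smooth_def C1_on_mult)

lemma I_eq_0:
  assumes "open U" "x \<in> U" "\<And>y. y \<in> U \<Longrightarrow> \<eta> (par i y) = 0"
  shows "I \<eta> i x = 0"
  using frechet_derivative_eq_0_if_locally_0[OF assms(1,2), of "\<lambda>x. \<eta> (par i x)"] assms by (simp add: I_def)

text \<open>The product with \<theta> a lives in the single chart a. Transition maps move the
  integrals over all pieces to that chart, where they add up to the one integral that
  \<open>div\<close> declares to be zero.\<close>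

lemma \<Lambda>_cutoff:
  assumes a: "a < n" and \<eta>: "smooth \<eta>"
  shows "\<Lambda> (\<lambda>m. \<eta> m * \<theta> a m) = 0"
proof -
  define \<zeta> where "\<zeta> = (\<lambda>m. \<eta> m * \<theta> a m)"
  have \<zeta>: "smooth \<zeta>" unfolding \<zeta>_def by (rule smooth_mult[OF \<eta> smooth_\<theta>[OF a]])
  then have \<zeta>C1: "C1_on (V i) (\<lambda>x. \<zeta> (par i x))" if "i < n" for i using that by (simp add: smooth_def)
  have zero: "I \<zeta> i x = 0" if "i < n" "x \<in> V i" "par i x \<notin> par a ` cball (c a) (2 * r a)" for i x
    by (rule I_eq_0[OF open_outside[OF that(1) a]]) (use that \<theta>_eq_0[OF a] in \<open>auto simp: \<zeta>_def\<close>)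
  have zero_a: "I \<zeta> a x = 0" if "x \<in> V a" "x \<notin> cball (c a) (2 * r a)" for x
    using zero[OF a that(1)] that inj_onD[OF inj_par[OF a]] cball_V[OF a] by blast
  \<comment> \<open>The piece with index i as seen in chart a.\<close>
  define R where "R i = {x \<in> V a. par a x \<in> par i ` S i}" for i
  have R_eq: "R i = {x \<in> V a. par a x \<in> par i ` ball (c i) (r i)} - (\<Union>j<i. {x \<in> V a. par a x \<in> par j ` ball (c j) (r j)})" for i
  proof (intro set_eqI iffI)
    fix x assume "x \<in> R i"
    then obtain y where "x \<in> V a" "par a x = par i y" "y \<in> S i" by (auto simp: R_def)
    then show "x \<in> {x \<in> V a. par a x \<in> par i ` ball (c i) (r i)} - (\<Union>j<i. {x \<in> V a. par a x \<in> par j ` ball (c j) (r j)})"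
      by (simp add: S_def)
  next
    fix x assume x: "x \<in> {x \<in> V a. par a x \<in> par i ` ball (c i) (r i)} - (\<Union>j<i. {x \<in> V a. par a x \<in> par j ` ball (c j) (r j)})"
    then obtain y where "par a x = par i y" "y \<in> ball (c i) (r i)" by blast
    moreover from this have "y \<in> S i" using x by (simp add: S_def)
    ultimately show "x \<in> R i" using x by (simp add: R_def)
  qed
  have R_borel: "R i \<in> sets borel" if i: "i < n" for i
  proof -
    have "open {x \<in> V a. par a x \<in> par i ` ball (c i) (r i)}"
      using i a by (intro open_overlap_ball ball_V) auto
    moreover have "open (\<Union>j<i. {x \<in> V a. par a x \<in> par j ` ball (c j) (r j)})"
      using i a by (intro open_UN ballI open_overlap_ball ball_V) auto
    ultimately show ?thesis unfolding R_eq by simp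
  qed
  have RT: "R i \<subseteq> T a i" if "i < n" for i using S_V[OF that] by (auto simp: R_def)
  have image: "\<tau> a i ` R i = S i \<inter> T i a" if i: "i < n" for i
  proof (intro set_eqI iffI)
    fix y assume "y \<in> \<tau> a i ` R i"
    then obtain x where x: "x \<in> R i" "y = \<tau> a i x" by auto
    then obtain y' where y': "y' \<in> S i" "par a x = par i y'" by (auto simp: R_def)
    have xT: "x \<in> T a i" using RT[OF i] x(1) by auto
    then have "y \<in> V i" "par i y = par a x" using \<tau>[OF a i, of x] x(2) by auto
    then have "y = y'" using y' S_V[OF i] inj_onD[OF inj_par[OF i]] by auto
    then show "y \<in> S i \<inter> T i a" using y' xT \<open>y \<in> V i\<close> by (auto intro: image_eqI[OF sym])
  next
    fix y assume y: "y \<in> S i \<inter> T i a"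
    then obtain x where x: "x \<in> V a" "par i y = par a x" by auto
    have xT: "x \<in> T a i" using x y by (auto intro: image_eqI[OF sym])
    have "\<tau> a i x = y"
      using \<tau>[OF a i, of x] xT x y inj_onD[OF inj_par[OF i]] by auto
    moreover have "x \<in> R i" using x y by (auto simp: R_def intro: image_eqI[OF sym])
    ultimately show "y \<in> \<tau> a i ` R i" by blast
  qed
  \<comment> \<open>The integrand is a scalar times the volume density, so it transforms with the
    Jacobian: the derivative of the cutoff composes with \<tau>' by the chain rule, and \<tau>'
    carries the field of chart a to that of chart i.\<close>
  have trans: "\<bar>det (matrix (\<tau>' a i x))\<bar> * I \<zeta> i (\<tau> a i x) = I \<zeta> a x" if i: "i < n" and x: "x \<in> T a i" for i x
  proof -
    have x1: "x \<in> V a" "par a x \<in> par i ` V i" using x by auto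
    have t: "\<tau> a i x \<in> V i" "par i (\<tau> a i x) = par a x" using \<tau>[OF a i x1] by auto
    let ?d = "frechet_derivative (\<lambda>x. \<zeta> (par i x)) (at (\<tau> a i x))"
    have "((\<lambda>x. \<zeta> (par i (\<tau> a i x))) has_derivative (\<lambda>v. ?d (\<tau>' a i x v))) (at x)"
      by (rule has_derivative_compose[OF \<tau>'[OF a i x1] C1_on_frechet_derivative(1)[OF \<zeta>C1[OF i] t(1)]])
    then have "((\<lambda>x. \<zeta> (par a x)) has_derivative (\<lambda>v. ?d (\<tau>' a i x v))) (at x)"
      by (rule has_derivative_transform_within_open[OF _ open_overlap[OF a i] x]) (use \<tau>[OF a i] in auto)
    then have "frechet_derivative (\<lambda>x. \<zeta> (par a x)) (at x) = (\<lambda>v. ?d (\<tau>' a i x v))"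
      by (rule sym[OF frechet_derivative_at])
    then show ?thesis
      using w_change[OF a i x1] X_change[OF a i x1] D_change[OF a i x1] t(2)
      by (simp add: I_def)
  qed
  have piece: "(\<integral>x. indicator (S i) x * I \<zeta> i x \<partial>lborel) = (\<integral>x. indicator (R i) x * I \<zeta> a x \<partial>lborel)" if i: "i < n" for i
  proof -
    have "(\<integral>x. indicator (S i) x * I \<zeta> i x \<partial>lborel) = (\<integral>x. indicator (S i \<inter> T i a) x * I \<zeta> i x \<partial>lborel)"
      using zero[OF i] S_V[OF i] cball_V[OF a]
      by (intro Bochner_Integration.integral_cong refl) (auto simp: indicator_def)
    also have "\<dots> = (\<integral>x. indicator (\<tau> a i ` R i) x * I \<zeta> i x \<partial>lborel)" unfolding image[OF i] ..
    also have "\<dots> = (\<integral>x. indicator (R i) x * (\<bar>det (matrix (\<tau>' a i x))\<bar> * I \<zeta> i (\<tau> a i x)) \<partial>lborel)"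
    proof (rule integral_differentiable_image[symmetric])
      show "R i \<in> sets borel" by (rule R_borel[OF i])
      show *: "\<tau> a i ` R i \<in> sets borel" unfolding image[OF i] using borel_S[OF i] open_overlap[OF i a] by auto
      show "(\<tau> a i has_derivative \<tau>' a i x) (at x within R i)" if "x \<in> R i" for x
        by (rule has_derivative_at_withinI[OF \<tau>'[OF a i]]) (use that RT[OF i] in auto)
      show "inj_on (\<tau> a i) (R i)"
      proof (rule inj_onI)
        fix x y assume xy: "x \<in> R i" "y \<in> R i" "\<tau> a i x = \<tau> a i y"
        then have "x \<in> T a i" "y \<in> T a i" using RT[OF i] by blast+
        then have "par a x = par a y" using \<tau>[OF a i, of x] \<tau>[OF a i, of y] xy(3) by auto
        then show "x = y" using xy inj_onD[OF inj_par[OF a]] by (auto simp: R_def)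
      qed
      show "continuous_on (R i) (\<lambda>x. \<tau>' a i x v)" for v
        by (rule continuous_on_subset[OF \<tau>'_cont[OF a i] RT[OF i]])
      have "continuous_on (\<tau> a i ` R i) (I \<zeta> i)"
        by (rule continuous_on_subset[OF continuous_I[OF i \<zeta>]]) (use image[OF i] in auto)
      from borel_measurable_continuous_on_indicator[OF * this]
      show "(\<lambda>x. indicator (\<tau> a i ` R i) x * I \<zeta> i x) \<in> borel_measurable borel" by simp
    qed
    also have "\<dots> = (\<integral>x. indicator (R i) x * I \<zeta> a x \<partial>lborel)"
      using trans[OF i] RT[OF i] by (intro Bochner_Integration.integral_cong refl) (auto simp: indicator_def)
    finally show ?thesis .
  qed
  have int: "integrable lborel (\<lambda>x. indicator (R i) x * I \<zeta> a x)" if i: "i < n" for i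
  proof -
    have "integrable lborel (\<lambda>x. indicator (R i \<inter> cball (c a) (2 * r a)) x * I \<zeta> a x)"
      using R_borel[OF i] by (intro integrable_I a \<zeta>) auto
    also have "(\<lambda>x. indicator (R i \<inter> cball (c a) (2 * r a)) x * I \<zeta> a x) = (\<lambda>x. indicator (R i) x * I \<zeta> a x)"
      using zero_a by (auto simp: fun_eq_iff indicator_def R_def)
    finally show ?thesis .
  qed
  \<comment> \<open>Over K every point lies in exactly one R i, that of the least admissible index;
    off K the field and its divergence vanish.\<close>
  have sum: "(\<Sum>i<n. indicator (R i) x * I \<zeta> a x) = indicator (V a) x * I \<zeta> a x" for x
  proof -
    consider "x \<notin> V a" | "x \<in> V a" "par a x \<notin> K" | "x \<in> V a" "par a x \<in> K" by blast
    then show ?thesis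
    proof cases
      case 1
      then show ?thesis by (simp add: R_def)
    next
      case 2
      have "linear (frechet_derivative (\<lambda>x. \<zeta> (par a x)) (at x))"
        using C1_on_frechet_derivative(1)[OF \<zeta>C1[OF a] 2(1)] by (rule has_derivative_linear)
      then have "I \<zeta> a x = 0" using outside_K[OF a 2] by (simp add: I_def linear_0)
      then show ?thesis by simp
    next
      case 3
      let ?P = "\<lambda>i. par a x \<in> par i ` ball (c i) (r i)"
      obtain i0 where i0: "i0 < n" "?P i0" using 3 cover by auto
      define i where "i = (LEAST i. ?P i)"
      have i: "?P i" "\<And>j. j < i \<Longrightarrow> \<not> ?P j" unfolding i_def using LeastI[of ?P, OF i0(2)] not_less_Least by blast+
      have "i \<le> i0" unfolding i_def using i0(2) by (rule Least_le)
      then have "i < n" using i0(1) by simp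
      have "indicator (R j) x = (if j = i then 1 else 0 :: real)" for j
      proof -
        have "x \<in> R j \<longleftrightarrow> ?P j \<and> (\<forall>l<j. \<not> ?P l)" using 3(1) by (auto simp: R_eq)
        then have "x \<in> R j \<longleftrightarrow> j = i" using i by (metis linorder_neqE_nat)
        then show ?thesis by (cases "j = i") auto
      qed
      then show ?thesis using \<open>i < n\<close> 3(1)
        by (simp add: if_distrib[of "\<lambda>c. c * _"] cong: if_cong)
    qed
  qed
  have "\<Lambda> \<zeta> = (\<Sum>i<n. \<integral>x. indicator (R i) x * I \<zeta> a x \<partial>lborel)" by (simp add: \<Lambda>_def piece)
  also have "\<dots> = (\<integral>x. (\<Sum>i<n. indicator (R i) x * I \<zeta> a x) \<partial>lborel)"
    using int by (subst Bochner_Integration.integral_sum) auto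
  also have "\<dots> = (\<integral>x. indicator (V a) x * I \<zeta> a x \<partial>lborel)" unfolding sum ..
  also have "\<dots> = 0"
    unfolding I_def
  proof (rule div[OF a \<zeta>C1[OF a] compact_cball cball_V[OF a]])
    show "\<zeta> (par a x) = 0" if "x \<in> V a" "x \<notin> cball (c a) (2 * r a)" for x
    proof -
      have "par a x \<notin> par a ` cball (c a) (2 * r a)"
        using that inj_onD[OF inj_par[OF a]] cball_V[OF a] by blast
      then show ?thesis by (simp add: \<zeta>_def \<theta>_eq_0[OF a])
    qed
  qed
  finally show ?thesis by (simp add: \<zeta>_def)
qed

text \<open>Multiplying the constant 1 successively by the factors \<open>1 - \<theta> a\<close> does not change \<open>\<Lambda>\<close>, by
  \<open>\<Lambda>_cutoff\<close>; the product of all of them vanishes near every point of every \<open>S i\<close>. This replaces a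
  partition of unity.\<close>

theorem sum_integral_divergence_eq_0:
  "(\<Sum>i<n. \<integral>x. indicator (S i) x * (D i x * w i x) \<partial>lborel) = 0"
proof -
  define P where "P l m = (\<Prod>a<l. 1 - \<theta> a m)" for l m
  have smooth_P: "smooth (P l)" if "l \<le> n" for l
  proof -
    have "C1_on (V i) (\<lambda>x. 1 - \<theta> a (par i x))" if "i < n" "a < n" for i a
      using smooth_\<theta>[OF that(2)] that(1) by (intro C1_on_diff C1_on_const) (auto simp: smooth_def)
    then show ?thesis using that by (auto simp: smooth_def P_def intro!: C1_on_prod)
  qed
  have step: "\<Lambda> (P l) = \<Lambda> (P 0)" if "l \<le> n" for l
    using that
  proof (induction l)
    case (Suc l)
    then have l: "l < n" by simp
    have "P (Suc l) = (\<lambda>m. P l m - P l m * \<theta> l m)" by (auto simp: P_def fun_eq_iff algebra_simps)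
    then have "\<Lambda> (P (Suc l)) = \<Lambda> (P l) - \<Lambda> (\<lambda>m. P l m * \<theta> l m)"
      using \<Lambda>_diff[OF smooth_P smooth_mult[OF smooth_P smooth_\<theta>[OF l]], of l l] l by simp
    then show ?case using \<Lambda>_cutoff[OF l smooth_P[of l]] Suc l by simp
  qed simp
  have "I (P n) i x = 0" if i: "i < n" and x: "x \<in> S i" for i x
  proof (rule I_eq_0[of "ball (c i) (r i)"])
    show "x \<in> ball (c i) (r i)" using x by (simp add: S_def)
    show "P n (par i y) = 0" if "y \<in> ball (c i) (r i)" for y
      unfolding P_def using i \<theta>_eq_1[OF i that] by (intro prod_zero) auto
  qed simp
  then have "(\<lambda>x. indicator (S i) x * I (P n) i x) = (\<lambda>x. 0)" if "i < n" for i
    using that by (auto simp: indicator_def fun_eq_iff)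
  then have "\<Lambda> (P n) = 0" by (simp add: \<Lambda>_def)
  moreover have "I (P 0) i x = D i x * w i x" for i x
    using frechet_derivative_const by (simp add: I_def P_def)
  ultimately show ?thesis using step[of n] by (simp add: \<Lambda>_def)
qed

end

section \<open>The radial profile\<close>

text \<open>The total mass of the rescaled approximate delta function. In polar coordinates the
  radial integrand has the primitive (s^2 / (1 + s^2))^(k/2), written as a product so as to be
  differentiable at 0; it rises from 0 to 1.\<close>

lemma nn_integral_kernel:
  "(\<integral>\<^sup>+z. ennreal (real CARD('k) * (1 + (norm (z :: real^'k))\<^sup>2) powr (- (real CARD('k) / 2) - 1)) \<partial>lborel) =
    ennreal (unit_ball_vol (real CARD('k)) * real CARD('k))"
proof -
  let ?k = "CARD('k)"
  define K where "K = real ?k"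
  have k: "0 < ?k" by simp
  have K0: "0 < K" by (simp add: K_def)
  let ?f = "\<lambda>s::real. K * (1 + s\<^sup>2) powr (- (K / 2) - 1)"
  let ?F = "\<lambda>s::real. s ^ ?k * (1 + s\<^sup>2) powr (- (K / 2))"
  have pos: "0 < 1 + s\<^sup>2" for s :: real by (rule add_pos_nonneg) auto
  have meas: "(\<lambda>s. ennreal (?f s)) \<in> borel_measurable borel" by measurable
  have D: "(?F has_real_derivative s ^ (?k - 1) * ?f s) (at s)" for s
  proof -
    have "(?F has_real_derivative (real ?k * s ^ (?k - 1)) * (1 + s\<^sup>2) powr (- (K / 2)) +
        s ^ ?k * ((- (K / 2)) * (1 + s\<^sup>2) powr (- (K / 2) - 1) * (2 * s))) (at s)"
      using pos[of s] by (auto intro!: derivative_eq_intros simp: powr_diff)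
    moreover have "(real ?k * s ^ (?k - 1)) * (1 + s\<^sup>2) powr (- (K / 2)) +
        s ^ ?k * ((- (K / 2)) * (1 + s\<^sup>2) powr (- (K / 2) - 1) * (2 * s)) = s ^ (?k - 1) * ?f s"
    proof -
      have "(1 + s\<^sup>2) powr (- (K / 2)) = (1 + s\<^sup>2) powr (- (K / 2) - 1) * (1 + s\<^sup>2)"
        using pos[of s] by (simp add: powr_diff)
      moreover have "s ^ ?k = s ^ (?k - 1) * s" using k by (metis power_minus_mult)
      ultimately show ?thesis by (simp add: K_def power2_eq_square algebra_simps)
    qed
    ultimately show ?thesis by simp
  qed
  have lim: "(?F \<longlongrightarrow> 1) at_top"
  proof -
    have "((\<lambda>s::real. (s\<^sup>2 / (1 + s\<^sup>2)) powr (K / 2)) \<longlongrightarrow> 1 powr (K / 2)) at_top"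
    proof (rule tendsto_powr)
      show "((\<lambda>s::real. s\<^sup>2 / (1 + s\<^sup>2)) \<longlongrightarrow> 1) at_top" by real_asymp
    qed auto
    moreover have "\<forall>\<^sub>F s in at_top. (s\<^sup>2 / (1 + s\<^sup>2)) powr (K / 2) = ?F s"
    proof (rule eventually_at_top_linorderI[of 1])
      fix s :: real assume s: "1 \<le> s"
      have "s\<^sup>2 = s powr 2" using s by simp
      then have "(s\<^sup>2) powr (K / 2) = s powr (2 * (K / 2))" by (simp only: powr_powr)
      also have "2 * (K / 2) = K" by simp
      also have "s powr K = s ^ ?k" using s unfolding K_def by (intro powr_realpow) simp
      finally have "(s\<^sup>2) powr (K / 2) = s ^ ?k" .
      moreover have "(s\<^sup>2 / (1 + s\<^sup>2)) powr (K / 2) = (s\<^sup>2) powr (K / 2) / (1 + s\<^sup>2) powr (K / 2)"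
        by (rule powr_divide)
      ultimately show "(s\<^sup>2 / (1 + s\<^sup>2)) powr (K / 2) = ?F s"
        unfolding powr_minus_divide by simp
    qed
    ultimately show ?thesis by (simp add: tendsto_cong)
  qed
  have "(\<integral>\<^sup>+s. ennreal (s ^ (?k - 1)) * ennreal (?f s) * indicator {0..} s \<partial>lborel) =
      (\<integral>\<^sup>+s. ennreal (s ^ (?k - 1) * ?f s) * indicator {0..} s \<partial>lborel)"
    using K0 by (intro nn_integral_cong) (auto simp: indicator_def ennreal_mult)
  also have "\<dots> = ennreal (1 - ?F 0)"
    using K0 by (intro nn_integral_FTC_atLeast D lim) (auto, measurable)
  also have "\<dots> = 1" using k by simp
  finally show ?thesis
    using nn_integral_radial[where 'k = 'k, OF meas] by (simp add: K_def)
qed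

text \<open>Monotone convergence over closed annuli. The annuli avoid both the centre, where the
  profile may be singular, and the rim, where the field has to vanish.\<close>

lemma nn_integral_disc_le:
  fixes X :: ennreal
  assumes R: "0 < R" and le: "\<And>\<alpha> \<beta>. 0 < \<alpha> \<Longrightarrow> \<alpha> < \<beta> \<Longrightarrow> \<beta> < R \<Longrightarrow>
    ennreal (unit_ball_vol (real CARD('k)) * real CARD('k)) *
      (\<integral>\<^sup>+s\<in>{\<alpha>..\<beta>}. ennreal (s ^ (CARD('k) - 1) / sqrt (1 + s\<^sup>2)) \<partial>lborel) \<le> X"
  shows "(\<integral>\<^sup>+y\<in>ball (0 :: real^'k) R. ennreal (1 / sqrt (1 + (norm y)\<^sup>2)) \<partial>lborel) \<le> X"
proof -
  let ?k = "CARD('k)"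
  let ?c = "ennreal (unit_ball_vol (real ?k) * real ?k)"
  let ?h = "\<lambda>s::real. ennreal (s ^ (?k - 1) / sqrt (1 + s\<^sup>2))"
  \<comment> \<open>The shift by 3 gives \<alpha> < \<beta> already for n = 0, where the radii are
    R/3 and 2R/3.\<close>
  define \<alpha> \<beta> where "\<alpha> n = R / (real n + 3)" and "\<beta> n = R - R / (real n + 3)" for n :: nat
  have ab: "0 < \<alpha> n" "\<alpha> n < \<beta> n" "\<beta> n < R" for n
  proof -
    have "R / (real n + 3) \<le> R / 3" using R by (intro divide_left_mono) auto
    moreover have "0 < R / (real n + 3)" using R by (intro divide_pos_pos) auto
    ultimately show "0 < \<alpha> n" "\<alpha> n < \<beta> n" "\<beta> n < R" using R unfolding \<alpha>_def \<beta>_def by linarith+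
  qed
  have "(\<integral>\<^sup>+y\<in>ball (0 :: real^'k) R. ennreal (1 / sqrt (1 + (norm y)\<^sup>2)) \<partial>lborel) =
      (\<integral>\<^sup>+y. (\<lambda>s. ennreal (1 / sqrt (1 + s\<^sup>2)) * indicator {..<R} s) (norm (y :: real^'k)) \<partial>lborel)"
    by (intro nn_integral_cong) (auto simp: indicator_def)
  also have "\<dots> = ?c * (\<integral>\<^sup>+s. ennreal (s ^ (?k - 1)) * (ennreal (1 / sqrt (1 + s\<^sup>2)) * indicator {..<R} s) * indicator {0..} s \<partial>lborel)"
    by (rule nn_integral_radial) measurable
  also have "(\<integral>\<^sup>+s. ennreal (s ^ (?k - 1)) * (ennreal (1 / sqrt (1 + s\<^sup>2)) * indicator {..<R} s) * indicator {0..} s \<partial>lborel) =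
      (\<integral>\<^sup>+s. ?h s * indicator {0<..<R} s \<partial>lborel)"
  proof (rule nn_integral_cong_AE)
    have "AE s in lborel. s \<noteq> (0::real)" by (rule AE_lborel_singleton)
    then show "AE s in lborel. ennreal (s ^ (?k - 1)) * (ennreal (1 / sqrt (1 + s\<^sup>2)) * indicator {..<R} s) * indicator {0..} s = ?h s * indicator {0<..<R} s"
      by eventually_elim (auto simp: indicator_def divide_inverse simp flip: ennreal_mult')
  qed
  also have "\<dots> = emeasure (density lborel ?h) {0<..<R}"
    by (subst emeasure_density) auto
  also have "{0<..<R} = (\<Union>n. {\<alpha> n..\<beta> n})"
  proof (intro set_eqI iffI)
    fix s assume s: "s \<in> {0<..<R}"
    define m where "m = min s (R - s)"
    have m: "0 < m" using s by (simp add: m_def)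
    obtain n :: nat where n: "R / m < real n" using reals_Archimedean2 by blast
    then have "R < real n * m" using m by (simp add: pos_divide_less_eq)
    also have "\<dots> \<le> (real n + 3) * m" using m by simp
    finally have "R / (real n + 3) < m" by (simp add: pos_divide_less_eq mult.commute)
    then have "s \<in> {\<alpha> n..\<beta> n}" by (auto simp: \<alpha>_def \<beta>_def m_def)
    then show "s \<in> (\<Union>n. {\<alpha> n..\<beta> n})" by blast
  next
    fix s assume "s \<in> (\<Union>n. {\<alpha> n..\<beta> n})"
    then obtain n where "\<alpha> n \<le> s" "s \<le> \<beta> n" by auto
    then show "s \<in> {0<..<R}" using ab[of n] by auto
  qed
  also have "emeasure (density lborel ?h) (\<Union>n. {\<alpha> n..\<beta> n}) = (SUP n. emeasure (density lborel ?h) {\<alpha> n..\<beta> n})"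
  proof (rule SUP_emeasure_incseq[symmetric])
    have "R / (real (Suc n) + 3) \<le> R / (real n + 3)" for n using R by (intro divide_left_mono) auto
    then show "incseq (\<lambda>n. {\<alpha> n..\<beta> n})"
      by (intro incseq_SucI) (auto simp: \<alpha>_def \<beta>_def intro: order_trans)
  qed auto
  also have "?c * \<dots> = (SUP n. ?c * emeasure (density lborel ?h) {\<alpha> n..\<beta> n})"
    by (rule SUP_mult_left_ennreal)
  also have "\<dots> \<le> X"
  proof (rule SUP_least)
    fix n
    have "emeasure (density lborel ?h) {\<alpha> n..\<beta> n} = (\<integral>\<^sup>+s\<in>{\<alpha> n..\<beta> n}. ?h s \<partial>lborel)"
      by (subst emeasure_density) auto
    then show "?c * emeasure (density lborel ?h) {\<alpha> n..\<beta> n} \<le> X" using le[OF ab] by simp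
  qed
  finally show ?thesis .
qed

text \<open>The substitution u = sqrt (1 + s^2), that is s = sinh and u = cosh of the distance to
  p.\<close>

lemma nn_integral_hyperbolic_substitution:
  fixes k :: nat
  assumes "0 < k" "0 < \<alpha>" "\<alpha> < \<beta>"
  shows "(\<integral>\<^sup>+s\<in>{\<alpha>..\<beta>}. ennreal (s ^ (k - 1) / sqrt (1 + s\<^sup>2)) \<partial>lborel) =
    (\<integral>\<^sup>+u\<in>{sqrt (1 + \<alpha>\<^sup>2)..sqrt (1 + \<beta>\<^sup>2)}. ennreal ((u\<^sup>2 - 1) powr (real k / 2 - 1)) \<partial>lborel)"
proof -
  have pos: "0 < 1 + s\<^sup>2" for s :: real by (rule add_pos_nonneg) auto
  let ?f = "\<lambda>u::real. (u\<^sup>2 - 1) powr (real k / 2 - 1)"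
  have "(\<integral>\<^sup>+u\<in>{sqrt (1 + \<alpha>\<^sup>2)..sqrt (1 + \<beta>\<^sup>2)}. ennreal (?f u) \<partial>lborel) =
      (\<integral>\<^sup>+u. ennreal (?f u * indicator {sqrt (1 + \<alpha>\<^sup>2)..sqrt (1 + \<beta>\<^sup>2)} u) \<partial>lborel)"
    by (intro nn_integral_cong) (auto simp: indicator_def)
  also have "\<dots> = (\<integral>\<^sup>+s. ennreal (?f (sqrt (1 + s\<^sup>2)) * (s / sqrt (1 + s\<^sup>2)) * indicator {\<alpha>..\<beta>} s) \<partial>lborel)"
  proof (rule nn_integral_substitution)
    show "set_borel_measurable borel {sqrt (1 + \<alpha>\<^sup>2)..sqrt (1 + \<beta>\<^sup>2)} ?f"
      unfolding set_borel_measurable_def by measurable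
    show "((\<lambda>s. sqrt (1 + s\<^sup>2)) has_real_derivative s / sqrt (1 + s\<^sup>2)) (at s)" for s
      using pos[of s] by (auto intro!: derivative_eq_intros simp: field_simps)
    show "continuous_on {\<alpha>..\<beta>} (\<lambda>s. s / sqrt (1 + s\<^sup>2))"
      using pos by (intro continuous_intros) (auto simp: less_imp_neq[symmetric])
  qed (use assms in auto)
  also have "\<dots> = (\<integral>\<^sup>+s\<in>{\<alpha>..\<beta>}. ennreal (s ^ (k - 1) / sqrt (1 + s\<^sup>2)) \<partial>lborel)"
  proof (intro nn_integral_cong)
    fix s
    have "?f (sqrt (1 + s\<^sup>2)) * s = s ^ (k - 1)" if "\<alpha> \<le> s"
    proof -
      have s: "0 < s" using assms(2) that by simp
      have "?f (sqrt (1 + s\<^sup>2)) * s = (s powr 2) powr (real k / 2 - 1) * s powr 1"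
        using s pos[of s] by (simp add: less_imp_le)
      also have "\<dots> = s powr (real (k - 1))"
        unfolding powr_powr powr_add[symmetric] using assms(1) by (simp add: of_nat_diff algebra_simps)
      finally show ?thesis using s by (simp add: powr_realpow)
    qed
    then show "ennreal (?f (sqrt (1 + s\<^sup>2)) * (s / sqrt (1 + s\<^sup>2)) * indicator {\<alpha>..\<beta>} s) =
        ennreal (s ^ (k - 1) / sqrt (1 + s\<^sup>2)) * indicator {\<alpha>..\<beta>} s"
      by (auto simp: indicator_def)
  qed
  finally show ?thesis by (rule sym)
qed

text \<open>w is the extremal density (u^2 - 1)^(q-1) times a trapezoidal cutoff that is 1 on [a, b]
  and vanishes near 1 and near the upper end; \<Psi> is its tail integral. The bound on w is
  multiplied by u^2 - 1 so that it also makes sense at u = 1.\<close>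

lemma density_profile:
  fixes a b u\<^sub>0 q :: real
  assumes "1 < a" "a < b" "b < u\<^sub>0"
  obtains \<Psi> w u\<^sub>1 where "1 < u\<^sub>1" "u\<^sub>1 < u\<^sub>0"
    "\<And>u. 1 \<le> u \<Longrightarrow> u < u\<^sub>0 \<Longrightarrow> (\<Psi> has_real_derivative - w u) (at u)"
    "continuous_on UNIV w" "\<And>u. 0 \<le> w u" "\<And>u. 1 \<le> u \<Longrightarrow> w u * (u\<^sup>2 - 1) \<le> (u\<^sup>2 - 1) powr q"
    "\<And>u. 1 \<le> u \<Longrightarrow> u < u\<^sub>0 \<Longrightarrow> 0 \<le> \<Psi> u" "\<And>u. u\<^sub>1 \<le> u \<Longrightarrow> u < u\<^sub>0 \<Longrightarrow> \<Psi> u = 0 \<and> w u = 0"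
    "(\<integral>\<^sup>+u\<in>{a..b}. ennreal ((u\<^sup>2 - 1) powr (q - 1)) \<partial>lborel) \<le> ennreal (\<Psi> 1)"
proof -
  define a' b' where "a' = (1 + a) / 2" and "b' = (b + u\<^sub>0) / 2"
  have a': "1 < a'" "a' < a" and b': "b < b'" "b' < u\<^sub>0" using assms by (auto simp: a'_def b'_def)
  define cut where "cut u = max 0 (min 1 (min ((u - a') / (a - a')) ((b' - u) / (b' - b))))" for u
  \<comment> \<open>The maximum keeps the base of the power positive, so w is continuous on the
    whole line even for q < 1. For u \<ge> 1 it differs from u^2 - 1 only where the cutoff
    vanishes.\<close>
  define w where "w u = cut u * (max (a'\<^sup>2 - 1) (u\<^sup>2 - 1)) powr (q - 1)" for u
  have a1: "0 < a'\<^sup>2 - 1" using a'(1) power_strict_mono[of 1 a' 2] by simp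
  have cut: "0 \<le> cut u" "cut u \<le> 1" "u \<le> a' \<Longrightarrow> cut u = 0" "b' \<le> u \<Longrightarrow> cut u = 0" "a \<le> u \<Longrightarrow> u \<le> b \<Longrightarrow> cut u = 1" for u
  proof -
    show "0 \<le> cut u" "cut u \<le> 1" by (auto simp: cut_def)
    show "cut u = 0" if "u \<le> a'"
    proof -
      have "(u - a') / (a - a') \<le> 0" using that a' by (intro divide_nonpos_pos) auto
      then show ?thesis unfolding cut_def by linarith
    qed
    show "cut u = 0" if "b' \<le> u"
    proof -
      have "(b' - u) / (b' - b) \<le> 0" using that b' by (intro divide_nonpos_pos) auto
      then show ?thesis unfolding cut_def by linarith
    qed
    show "cut u = 1" if "a \<le> u" "u \<le> b"
    proof -
      have "1 \<le> (u - a') / (a - a')" "1 \<le> (b' - u) / (b' - b)" using that a' b' by auto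
      then show ?thesis unfolding cut_def by linarith
    qed
  qed
  have mx: "max (a'\<^sup>2 - 1) v \<noteq> 0" for v using a1 by linarith
  have w_cont: "continuous_on UNIV w"
    unfolding w_def cut_def by (intro continuous_intros) (use a' b' mx in auto)
  have w0: "0 \<le> w u" for u by (simp add: w_def cut)
  have w_eq: "w u = cut u * (u\<^sup>2 - 1) powr (q - 1)" if "1 \<le> u" for u
  proof (cases "u \<le> a'")
    case False
    then have "a'\<^sup>2 \<le> u\<^sup>2" using a'(1) by (intro power_mono) auto
    then show ?thesis by (simp add: w_def max_def)
  qed (simp add: w_def cut)
  \<comment> \<open>The interval is larger than needed on both sides, so that W has two-sided
    derivatives at 1 and at the upper end.\<close>
  obtain W where W: "\<And>u. u \<in> {0..u\<^sub>0 + 1} \<Longrightarrow> (W has_vector_derivative w u) (at u within {0..u\<^sub>0 + 1})"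
    by (rule antiderivative_continuous[OF continuous_on_subset[OF w_cont subset_UNIV]]) (rule that)
  have W': "(W has_real_derivative w u) (at u)" if "0 < u" "u < u\<^sub>0 + 1" for u
  proof -
    have "at u within {0..u\<^sub>0 + 1} = at u" using that by (intro at_within_interior) auto
    then show ?thesis using W[of u] that by (simp add: has_real_derivative_iff_has_vector_derivative)
  qed
  define \<Psi> where "\<Psi> u = W u\<^sub>0 - W u" for u
  show thesis
  proof (rule that[of b' \<Psi> w])
    show "1 < b'" "b' < u\<^sub>0" using assms b' by auto
    show "(\<Psi> has_real_derivative - w u) (at u)" if "1 \<le> u" "u < u\<^sub>0" for u
      unfolding \<Psi>_def using that by (auto intro!: derivative_eq_intros W')
    show "continuous_on UNIV w" "0 \<le> w u" for u by (rule w_cont, rule w0)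
    show "w u * (u\<^sup>2 - 1) \<le> (u\<^sup>2 - 1) powr q" if "1 \<le> u" for u
    proof (cases "u = 1")
      case False
      then have "0 < u\<^sup>2 - 1" using that power_strict_mono[of 1 u 2] by simp
      then have "(u\<^sup>2 - 1) powr (q - 1) * (u\<^sup>2 - 1) = (u\<^sup>2 - 1) powr q" by (simp add: powr_diff)
      then have "w u * (u\<^sup>2 - 1) = cut u * (u\<^sup>2 - 1) powr q" using w_eq[OF that] by simp
      then show ?thesis using cut(2)[of u] mult_right_mono[of "cut u" 1] by simp
    qed simp
    show "0 \<le> \<Psi> u" if "1 \<le> u" "u < u\<^sub>0" for u
    proof -
      have "W u \<le> W u\<^sub>0"
        by (rule DERIV_nonneg_imp_nondecreasing[where f = W])
          (use that in \<open>auto intro!: exI[of _ "w _"] W' w0\<close>)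
      then show ?thesis by (simp add: \<Psi>_def)
    qed
    show "\<Psi> u = 0 \<and> w u = 0" if "b' \<le> u" "u < u\<^sub>0" for u
    proof -
      have "w v = 0" if "b' \<le> v" for v using cut(4)[OF that] by (simp add: w_def)
      moreover have "W u\<^sub>0 = W u"
      proof (rule DERIV_isconst_end[where f = W])
        have D: "(W has_real_derivative w v) (at v)" if "u \<le> v" "v \<le> u\<^sub>0" for v
          using that \<open>b' \<le> u\<close> a' b' assms by (intro W') auto
        show "continuous_on {u..u\<^sub>0} W"
          by (intro continuous_at_imp_continuous_on ballI DERIV_isCont[OF D]) auto
        show "(W has_real_derivative 0) (at v)" if "u < v" "v < u\<^sub>0" for v
          using D[of v] cut(4)[of v] that \<open>b' \<le> u\<close> by (simp add: w_def)
      qed (use that in auto)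
      ultimately show ?thesis using that by (simp add: \<Psi>_def)
    qed
    have "(\<integral>\<^sup>+u\<in>{a..b}. ennreal ((u\<^sup>2 - 1) powr (q - 1)) \<partial>lborel) \<le> (\<integral>\<^sup>+u\<in>{1..u\<^sub>0}. ennreal (w u) \<partial>lborel)"
      using assms cut(5) w_eq by (intro nn_integral_mono) (auto simp: indicator_def)
    also have "\<dots> = ennreal (W u\<^sub>0 - W 1)"
    proof (rule nn_integral_FTC_Icc)
      show "w \<in> borel_measurable borel" using w_cont by (rule borel_measurable_continuous_onI)
    qed (use assms w0 W' in \<open>auto intro: DERIV_subset\<close>)
    finally show "(\<integral>\<^sup>+u\<in>{a..b}. ennreal ((u\<^sup>2 - 1) powr (q - 1)) \<partial>lborel) \<le> ennreal (\<Psi> 1)" by (simp add: \<Psi>_def)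
  qed
qed

section \<open>The area of the totally geodesic disc\<close>

definition gram :: "(real^'k \<Rightarrow> (real^'n) \<times> real) \<Rightarrow> real^'k^'k" where
  "gram L = (\<chi> i j. mink (L (axis i 1)) (L (axis j 1)))"

lemma mink_eq_gram:
  assumes "linear L"
  shows "mink (L a) (L b) = a \<bullet> (gram L *v b)"
proof -
  have "mink (L a) (L b) = mink (\<Sum>i\<in>UNIV. a $ i *\<^sub>R L (axis i 1)) (\<Sum>j\<in>UNIV. b $ j *\<^sub>R L (axis j 1))"
    using linear_eq_sum_axis[OF assms] by metis
  also have "\<dots> = (\<Sum>i\<in>UNIV. \<Sum>j\<in>UNIV. b $ i * (a $ j * mink (L (axis j 1)) (L (axis i 1))))"
    by (simp add: mink.sum_left mink.sum_right mink.scaleR_left mink.scaleR_right sum_distrib_left)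
  also have "\<dots> = (\<Sum>j\<in>UNIV. \<Sum>i\<in>UNIV. b $ i * (a $ j * mink (L (axis j 1)) (L (axis i 1))))"
    by (rule sum.swap)
  also have "\<dots> = a \<bullet> (gram L *v b)"
    by (simp add: inner_vec_def matrix_vector_mult_def gram_def sum_distrib_left mult.left_commute mult.commute)
  finally show ?thesis .
qed

lemma gram_eqI:
  assumes "\<And>a b. mink (L a) (L b) = a \<bullet> (B *v b)"
  shows "gram L = B"
  unfolding gram_def assms
  by (simp add: vec_eq_iff inner_axis' matrix_vector_mult_basis column_def)

lemma inner_transpose_matrix: "(a :: real^'k) \<bullet> (transpose A *v c) = (A *v a) \<bullet> c"
  using dot_lmul_matrix[of c A a] by (simp add: transpose_matrix_vector inner_commute)

lemma gram_compose:
  assumes L: "linear L" and T: "linear T"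
  shows "gram (L \<circ> T) = transpose (matrix T) ** gram L ** matrix T"
proof (rule gram_eqI)
  fix a b
  have m: "matrix T *v x = T x" for x using matrix_vector_mul(2)[of T] T by (metis linear_conv_bounded_linear matrix_vector_mul(1))
  have "mink ((L \<circ> T) a) ((L \<circ> T) b) = (matrix T *v a) \<bullet> (gram L *v (matrix T *v b))"
    using mink_eq_gram[OF L] by (simp add: m)
  also have "\<dots> = a \<bullet> (transpose (matrix T) ** gram L ** matrix T *v b)"
    by (simp only: inner_transpose_matrix[symmetric] matrix_vector_mul_assoc matrix_mul_assoc)
  finally show "mink ((L \<circ> T) a) ((L \<circ> T) b) = a \<bullet> (transpose (matrix T) ** gram L ** matrix T *v b)" .
qed

lemma sqrt_det_gram_compose:
  assumes "linear L" "linear T"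
  shows "sqrt (det (gram (L \<circ> T))) = \<bar>det (matrix T)\<bar> * sqrt (det (gram L))"
  by (simp add: gram_compose[OF assms] det_mul det_transpose real_sqrt_mult mult.commute)

text \<open>Rotating y onto a coordinate axis makes the matrix diagonal with a single entry
  different from 1.\<close>

lemma det_identity_minus_rank_one:
  fixes y :: "real^'k"
  assumes B: "\<And>v w. v \<bullet> (B *v w) = v \<bullet> w - s * (y \<bullet> v) * (y \<bullet> w)"
  shows "det B = 1 - s * (norm y)\<^sup>2"
proof -
  define l :: 'k where "l = (SOME i. True)"
  obtain f :: "real^'k \<Rightarrow> real^'k" where f: "orthogonal_transformation f" "f (norm y *\<^sub>R axis l 1) = y"
    using orthogonal_transformation_exists[of "norm y *\<^sub>R axis l 1" y] by (auto simp: norm_axis_1)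
  have lin: "linear f" using f(1) by (rule orthogonal_transformation_linear)
  have inner: "f v \<bullet> f w = v \<bullet> w" for v w using f(1) by (simp add: orthogonal_transformation_def)
  define Q where "Q = matrix f"
  have Q: "Q *v x = f x" for x unfolding Q_def using lin by (metis linear_conv_bounded_linear matrix_vector_mul(1) matrix_vector_mul(2))
  have dQ: "det Q * det Q = 1"
    using det_orthogonal_matrix[of Q] f(1) orthogonal_transformation_matrix[of f] by (auto simp: Q_def)
  have yf: "y \<bullet> f v = norm y * v $ l" for v
    using inner[of "norm y *\<^sub>R axis l 1" v] f(2) by (simp add: inner_axis')
  let ?D = "transpose Q ** B ** Q"
  have D: "v \<bullet> (?D *v w) = v \<bullet> w - s * (norm y)\<^sup>2 * v $ l * w $ l" for v w
  proof -
    have "v \<bullet> (?D *v w) = f v \<bullet> (B *v f w)"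
      by (simp only: inner_transpose_matrix matrix_vector_mul_assoc[symmetric] Q)
    also have "\<dots> = v \<bullet> w - s * (norm y)\<^sup>2 * v $ l * w $ l"
      unfolding B inner yf by (simp add: power2_eq_square)
    finally show ?thesis .
  qed
  have entry: "?D $ i $ j = (if i = j then (if i = l then 1 - s * (norm y)\<^sup>2 else 1) else 0)" for i j
  proof -
    have "?D $ i $ j = axis i 1 \<bullet> (?D *v axis j 1)"
      by (simp add: inner_axis' matrix_vector_mult_basis column_def)
    also have "\<dots> = (if i = j then (if i = l then 1 - s * (norm y)\<^sup>2 else 1) else 0)"
      unfolding D inner_axis_axis by (auto simp: axis_def)
    finally show ?thesis .
  qed
  have "det B = det ?D" using dQ by (simp add: det_mul det_transpose)
  also have "\<dots> = (\<Prod>i\<in>UNIV. ?D $ i $ i)" by (rule det_diagonal) (simp add: entry)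
  also have "\<dots> = (\<Prod>i\<in>UNIV. if i = l then 1 - s * (norm y)\<^sup>2 else 1)" by (simp add: entry)
  also have "\<dots> = 1 - s * (norm y)\<^sup>2" by simp
  finally show ?thesis .
qed

text \<open>Chart images may touch the bounding hyperplane of the half-space, where derivatives are
  one-sided. The hyperplane is a null set, so area integrals can be taken over interior
  points.\<close>

lemma nn_integral_discard_hyperplane:
  fixes g :: "real^'k \<Rightarrow> ennreal"
  assumes "\<And>x. x \<in> S \<longleftrightarrow> x \<in> T \<and> x $ l \<noteq> 0"
  shows "(\<integral>\<^sup>+x\<in>T. g x \<partial>lborel) = (\<integral>\<^sup>+x\<in>S. g x \<partial>lborel)"
proof (rule nn_integral_cong_AE)
  have "negligible {x :: real^'k. axis l 1 \<bullet> x = 0}"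
    by (rule negligible_hyperplane) (simp add: axis_eq_0_iff)
  then have "negligible {x :: real^'k. x $ l = 0}" by (simp add: inner_axis')
  moreover have "closed {x :: real^'k. x $ l = 0}"
    by (intro closed_Collect_eq continuous_intros)
  ultimately have "{x :: real^'k. x $ l = 0} \<in> null_sets lborel"
    using negligible_iff_null_sets null_sets_completion_iff[of _ lborel] by (metis borel_closed sets_lborel)
  then have "AE x in lborel. x \<notin> {x :: real^'k. x $ l = 0}" by (rule AE_not_in)
  then show "AE x in lborel. g x * indicator T x = g x * indicator S x"
    by eventually_elim (use assms in \<open>auto simp: indicator_def\<close>)
qed

lemma openin_half_space_interior:
  fixes V :: "(real^'k) set"
  assumes "openin (top_of_set half_space) V"
  shows "open {x \<in> V. x $ half_index \<noteq> 0}"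
proof -
  obtain T where T: "open T" "V = half_space \<inter> T" using assms by (auto simp: openin_open)
  have "{x \<in> V. x $ half_index \<noteq> 0} = T \<inter> {x. 0 < x $ half_index}"
    unfolding T(2) half_space_def by auto
  moreover have "open {x :: real^'k. 0 < x $ half_index}"
    by (intro open_Collect_less continuous_intros)
  ultimately show ?thesis using T(1) by auto
qed

text \<open>Related to the exponential map by g y = (sinh a / a) v with a = |v|, so geodesic balls
  of radius \<rho> about p become Euclidean balls of radius sinh \<rho>.\<close>

definition hyperbolic_graph :: "(real^'n) \<times> real \<Rightarrow> (real^'k \<Rightarrow> (real^'n) \<times> real) \<Rightarrow> real^'k \<Rightarrow> (real^'n) \<times> real" where
  "hyperbolic_graph p g y = g y + sqrt (1 + (norm y)\<^sup>2) *\<^sub>R p"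

text \<open>As p is timelike and orthogonal to the range of g, the metric of the graph is the
  identity minus the rank-one form y y^T / (1 + |y|^2).\<close>

lemma sqrt_det_gram_hyperbolic_graph:
  assumes g: "linear g" "range g \<subseteq> tangent_space p" "\<And>x y. mink (g x) (g y) = x \<bullet> y" and p: "p \<in> hyperbolic_space"
  shows "(hyperbolic_graph p g has_derivative (\<lambda>v. g v + ((y \<bullet> v) / sqrt (1 + (norm y)\<^sup>2)) *\<^sub>R p)) (at y)"
    and "sqrt (det (gram (\<lambda>v. g v + ((y \<bullet> v) / sqrt (1 + (norm y)\<^sup>2)) *\<^sub>R p))) = 1 / sqrt (1 + (norm y)\<^sup>2)"
proof -
  have pos: "0 < 1 + (norm y)\<^sup>2" by (rule add_pos_nonneg) auto
  show "(hyperbolic_graph p g has_derivative (\<lambda>v. g v + ((y \<bullet> v) / sqrt (1 + (norm y)\<^sup>2)) *\<^sub>R p)) (at y)"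
  proof -
    have "((\<lambda>y. sqrt (1 + y \<bullet> y)) has_derivative (\<lambda>v. (y \<bullet> v) / sqrt (1 + y \<bullet> y))) (at y)"
      using pos by (auto intro!: derivative_eq_intros simp: power2_norm_eq_inner inner_commute field_simps)
    moreover have "(g has_derivative g) (at y)"
      using g(1) by (simp add: bounded_linear_imp_has_derivative linear_conv_bounded_linear)
    ultimately show ?thesis
      unfolding hyperbolic_graph_def[abs_def] power2_norm_eq_inner
      by (intro has_derivative_add has_derivative_scaleR_left)
  qed
  let ?L = "\<lambda>v. g v + ((y \<bullet> v) / sqrt (1 + (norm y)\<^sup>2)) *\<^sub>R p"
  have lin: "linear ?L"
    by (rule linearI) (auto simp: linear_add[OF g(1)] linear_scale[OF g(1)] inner_add_right add_divide_distrib algebra_simps)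
  have pp: "mink p p = -1" using p by (simp add: hyperbolic_space_def)
  have pg: "mink p (g v) = 0" "mink (g v) p = 0" for v
  proof -
    have "g v \<in> tangent_space p" using g(2) by auto
    then show "mink p (g v) = 0" "mink (g v) p = 0" by (simp_all add: tangent_space_def mink_commute)
  qed
  have "v \<bullet> (gram ?L *v w) = v \<bullet> w - (1 / (1 + (norm y)\<^sup>2)) * (y \<bullet> v) * (y \<bullet> w)" for v w
  proof -
    have "v \<bullet> (gram ?L *v w) = mink (?L v) (?L w)" by (rule mink_eq_gram[OF lin, symmetric])
    also have "\<dots> = v \<bullet> w - (y \<bullet> v) * (y \<bullet> w) / (sqrt (1 + (norm y)\<^sup>2) * sqrt (1 + (norm y)\<^sup>2))"
      by (simp add: mink.add_left mink.add_right mink.scaleR_left mink.scaleR_right g(3) pp pg)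
    finally show ?thesis using pos by simp
  qed
  then have "det (gram ?L) = 1 - (1 / (1 + (norm y)\<^sup>2)) * (norm y)\<^sup>2" by (rule det_identity_minus_rank_one)
  also have "\<dots> = 1 / (1 + (norm y)\<^sup>2)" using pos by (simp add: field_simps)
  finally show "sqrt (det (gram ?L)) = 1 / sqrt (1 + (norm y)\<^sup>2)" by (simp add: real_sqrt_divide)
qed

lemma induced_metric_interior:
  assumes "open T" "T \<subseteq> V" "x \<in> T"
  shows "induced_metric V f x = gram (frechet_derivative f (at x))"
  by (simp add: induced_metric_def gram_def partial_interior[OF assms])

text \<open>The induced atlas contains all regular charts of N, so an arbitrary one must be handled.
  The linear map l inverts the graph, so a chart inverse h factors as the graph composed with \<tau>
  = l h. Multiplicativity of Gram determinants and a change of variables by \<tau> then leave the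
  density of the graph. Z may miss part of the image of B because boundary points are
  discarded.\<close>

lemma chart_area_in_graph:
  fixes p :: "(real^'n) \<times> real" and g :: "real^'k \<Rightarrow> (real^'n) \<times> real" and \<phi> :: "_ \<Rightarrow> real^'k"
  assumes p: "p \<in> hyperbolic_space"
    and g: "linear g" "range g \<subseteq> tangent_space p" "\<And>x y. mink (g x) (g y) = x \<bullet> y"
    and f: "linear f" "\<And>y. f (g y) = y"
    and N: "N \<subseteq> hyperbolic_graph p g ` D"
    and chart: "(U, \<phi>) \<in> induced_atlas N" and B: "B \<subseteq> U" "\<phi> ` B \<in> sets borel"
  obtains Z where "Z \<in> sets borel" "Z \<subseteq> (\<lambda>x. f (tangent_proj p x)) ` B"
    "chart_area (\<lambda>x. x) (U, \<phi>) B = (\<integral>\<^sup>+y\<in>Z. ennreal (1 / sqrt (1 + (norm y)\<^sup>2)) \<partial>lborel)"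
proof -
  define V where "V = \<phi> ` U"
  define h where "h = inv_into U \<phi>"
  define \<Gamma> where "\<Gamma> = hyperbolic_graph p g"
  define l where "l x = f (tangent_proj p x)" for x
  define O' where "O' = {x \<in> V. x $ half_index \<noteq> 0}"
  have hom: "homeomorphism U V \<phi> h" and oV: "openin (top_of_set half_space) V" and oU: "openin (top_of_set N) U"
    and imm: "immersion_on V h"
    using chart by (auto simp: induced_atlas_def chart_of_def V_def h_def)
  have opO: "open O'" unfolding O'_def by (rule openin_half_space_interior[OF oV])
  have OV: "O' \<subseteq> V" by (auto simp: O'_def)
  have hU: "h x \<in> U" "\<phi> (h x) = x" if "x \<in> V" for x using hom that by (auto simp: homeomorphism_def)
  have UN: "U \<subseteq> N" using oU by (rule openin_imp_subset)
  have l\<Gamma>: "l (\<Gamma> y) = y" for y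
  proof -
    have "mink p p = -1" "mink p (g y) = 0" using p g(2) by (auto simp: hyperbolic_space_def tangent_space_def)
    then have "tangent_proj p (\<Gamma> y) = g y"
      by (simp add: \<Gamma>_def hyperbolic_graph_def tangent_proj_def mink.add_right mink.scaleR_right)
    then show ?thesis by (simp add: l_def f)
  qed
  have lin_l: "linear l"
    unfolding l_def tangent_proj_def
    by (rule linearI) (auto simp: mink.add_right mink.scaleR_right algebra_simps linear_add[OF f(1)] linear_scale[OF f(1)] linear_diff[OF f(1)])
  define \<tau> where "\<tau> x = l (h x)" for x
  have h\<tau>: "h x = \<Gamma> (\<tau> x)" if "x \<in> V" for x
    using hU(1)[OF that] UN N l\<Gamma> by (force simp: \<tau>_def \<Gamma>_def)
  have inj\<tau>: "inj_on \<tau> V"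
    using h\<tau> hU(2) by (metis inj_onI)
  note sm = smooth_on_derivative[of V h O', OF _ opO OV]
  have smh: "smooth_on V h" using imm by (simp add: immersion_on_def)
  define \<tau>' where "\<tau>' x v = l (frechet_derivative h (at x) v)" for x v
  have bl: "bounded_linear l" using lin_l by (simp add: linear_conv_bounded_linear)
  have \<tau>': "(\<tau> has_derivative \<tau>' x) (at x)" if "x \<in> O'" for x
    unfolding \<tau>_def[abs_def] \<tau>'_def[abs_def]
    by (rule bounded_linear.has_derivative[OF bl sm(1)[OF smh that]])
  have \<tau>'_cont: "continuous_on O' (\<lambda>x. \<tau>' x v)" for v
    unfolding \<tau>'_def by (rule bounded_linear.continuous_on[OF bl sm(2)[OF smh]])
  have \<tau>_cont: "continuous_on O' \<tau>"
    using \<tau>' by (intro continuous_at_imp_continuous_on) (auto intro!: has_derivative_continuous)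
  define S where "S = \<phi> ` B \<inter> O'"
  have S: "S \<in> sets borel" unfolding S_def using B opO by auto
  have SO: "S \<subseteq> O'" by (auto simp: S_def)
  \<comment> \<open>Invariance of domain provides a continuous inverse on an open image; this makes
    the image of the Borel set S a Borel set.\<close>
  obtain \<sigma> where \<sigma>: "homeomorphism O' (\<tau> ` O') \<tau> \<sigma>"
    using invariance_of_domain_homeomorphism[OF opO \<tau>_cont order_refl inj_on_subset[OF inj\<tau> OV]] by auto
  have op\<tau>: "open (\<tau> ` O')"
    using invariance_of_domain[OF \<tau>_cont opO inj_on_subset[OF inj\<tau> OV]] .
  have Z: "\<tau> ` S \<in> sets borel"
  proof -
    have "\<tau> ` S = {y \<in> \<tau> ` O'. \<sigma> y \<in> S}"
      using \<sigma> SO by (auto simp: homeomorphism_def image_iff)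
    also have "\<dots> = \<tau> ` O' \<inter> (\<lambda>y. if y \<in> \<tau> ` O' then \<sigma> y else 0) -` S" by auto
    also have "\<dots> \<in> sets borel"
    proof (rule sets.Int)
      have "(\<lambda>y. if y \<in> \<tau> ` O' then \<sigma> y else 0) \<in> borel_measurable borel"
        using op\<tau> \<sigma> by (intro borel_measurable_continuous_on_if) (auto simp: homeomorphism_def)
      from measurable_sets[OF this S] show "(\<lambda>y. if y \<in> \<tau> ` O' then \<sigma> y else 0) -` S \<in> sets borel" by simp
    qed (use op\<tau> in auto)
    finally show ?thesis .
  qed
  have metric: "sqrt (det (induced_metric V h x)) = \<bar>det (matrix (\<tau>' x))\<bar> * (1 / sqrt (1 + (norm (\<tau> x))\<^sup>2))" if x: "x \<in> O'" for x
  proof -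
    let ?L = "\<lambda>v. g v + ((\<tau> x \<bullet> v) / sqrt (1 + (norm (\<tau> x))\<^sup>2)) *\<^sub>R p"
    note \<Gamma>' = sqrt_det_gram_hyperbolic_graph[OF g p, of "\<tau> x"]
    have "((\<lambda>x. \<Gamma> (\<tau> x)) has_derivative (\<lambda>v. ?L (\<tau>' x v))) (at x)"
      unfolding \<Gamma>_def by (rule has_derivative_compose[OF \<tau>'[OF x] \<Gamma>'(1)])
    then have "(h has_derivative (\<lambda>v. ?L (\<tau>' x v))) (at x)"
      by (rule has_derivative_transform_within_open[OF _ opO x]) (use h\<tau> OV in auto)
    from frechet_derivative_at[OF this, symmetric] have "frechet_derivative h (at x) = ?L \<circ> \<tau>' x"
      by (simp only: o_def)
    then have "sqrt (det (induced_metric V h x)) = sqrt (det (gram (?L \<circ> \<tau>' x)))"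
      by (simp add: induced_metric_interior[OF opO OV x])
    also have "\<dots> = \<bar>det (matrix (\<tau>' x))\<bar> * sqrt (det (gram ?L))"
      by (rule sqrt_det_gram_compose) (use \<Gamma>'(1) \<tau>'[OF x] has_derivative_linear in blast)+
    finally show ?thesis unfolding \<Gamma>'(2) .
  qed
  have "chart_area (\<lambda>x. x) (U, \<phi>) B = (\<integral>\<^sup>+x\<in>\<phi> ` B. ennreal (sqrt (det (induced_metric V h x))) \<partial>lborel)"
    by (simp add: chart_area_def V_def h_def o_def)
  also have "\<dots> = (\<integral>\<^sup>+x\<in>S. ennreal (sqrt (det (induced_metric V h x))) \<partial>lborel)"
    by (rule nn_integral_discard_hyperplane) (use B(1) in \<open>auto simp: S_def O'_def V_def\<close>)
  also have "\<dots> = (\<integral>\<^sup>+x\<in>S. ennreal \<bar>det (matrix (\<tau>' x))\<bar> * ennreal (1 / sqrt (1 + (norm (\<tau> x))\<^sup>2)) \<partial>lborel)"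
  proof (intro nn_integral_cong)
    fix x
    show "ennreal (sqrt (det (induced_metric V h x))) * indicator S x =
        ennreal \<bar>det (matrix (\<tau>' x))\<bar> * ennreal (1 / sqrt (1 + (norm (\<tau> x))\<^sup>2)) * indicator S x"
    proof (cases "x \<in> S")
      case True
      then have "x \<in> O'" using SO by auto
      then show ?thesis by (simp only: metric ennreal_mult' abs_ge_zero)
    qed simp
  qed
  also have "\<dots> = (\<integral>\<^sup>+y\<in>\<tau> ` S. ennreal (1 / sqrt (1 + (norm y)\<^sup>2)) \<partial>lborel)"
  proof (rule nn_integral_differentiable_image[OF S Z])
    show "(\<tau> has_derivative \<tau>' x) (at x within S)" if "x \<in> S" for x
      by (rule has_derivative_at_withinI[OF \<tau>']) (use that SO in auto)
    show "inj_on \<tau> S" using inj_on_subset[OF inj\<tau>] SO OV by blast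
    show "continuous_on S (\<lambda>x. \<tau>' x v)" for v by (rule continuous_on_subset[OF \<tau>'_cont SO])
  qed measurable
  finally have "chart_area (\<lambda>x. x) (U, \<phi>) B = (\<integral>\<^sup>+y\<in>\<tau> ` S. ennreal (1 / sqrt (1 + (norm y)\<^sup>2)) \<partial>lborel)" .
  moreover have "\<tau> ` S \<subseteq> l ` B"
  proof -
    have "h (\<phi> b) = b" if "b \<in> B" for b using hom that B(1) by (auto simp: homeomorphism_def)
    then show ?thesis by (auto simp: S_def \<tau>_def)
  qed
  ultimately show ?thesis using that Z by (simp add: l_def[abs_def])
qed

text \<open>N lies in the graph over the disc, and l is injective on N. So for any admissible family
  the sets Z belonging to disjoint pieces are disjoint subsets of the disc, and their integrals add
  up to at most the integral over the disc.\<close>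

theorem area_totally_geodesic_le:
  fixes p :: "(real^'n) \<times> real" and P :: "((real^'n) \<times> real) set"
  assumes p: "p \<in> hyperbolic_space" and \<rho>: "0 < \<rho>"
    and P: "subspace P" "P \<subseteq> tangent_space p" "dim P = CARD('k::finite)"
  shows "area (induced_atlas (hexp p ` P \<inter> geodesic_ball p \<rho>) :: (_, 'k) chart set) (\<lambda>x. x) \<le>
    (\<integral>\<^sup>+y\<in>ball (0 :: real^'k) (sinh \<rho>). ennreal (1 / sqrt (1 + (norm y)\<^sup>2)) \<partial>lborel)"
proof -
  define N where "N = hexp p ` P \<inter> geodesic_ball p \<rho>"
  obtain f :: "(real^'n) \<times> real \<Rightarrow> real^'k" and g where f: "linear f" and g: "linear g" "range g = P"
    and inner: "\<And>v w. v \<in> P \<Longrightarrow> w \<in> P \<Longrightarrow> mink v w = f v \<bullet> f w" "\<And>x y. mink (g x) (g y) = x \<bullet> y"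
    and gf: "\<And>v. v \<in> P \<Longrightarrow> g (f v) = v" and fg: "\<And>x. f (g x) = x"
    using tangent_subspace_isometry[OF p P(1,2,3)] by metis
  let ?D = "ball (0 :: real^'k) (sinh \<rho>)"
  let ?F = "\<lambda>y :: real^'k. ennreal (1 / sqrt (1 + (norm y)\<^sup>2))"
  define l where "l x = f (tangent_proj p x)" for x
  have gT: "range g \<subseteq> tangent_space p" using g(2) P(2) by simp
  have N: "N \<subseteq> hyperbolic_graph p g ` ?D"
  proof
    fix q assume "q \<in> N"
    then obtain v v' where v: "v \<in> P" "q = hexp p v" and v': "v' \<in> tangent_space p" "hnorm v' < \<rho>" "q = hexp p v'"
      by (auto simp: N_def geodesic_ball_def)
    have vT: "v \<in> tangent_space p" using v P by auto
    define a where "a = hnorm v"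
    have a0: "0 \<le> a" "a\<^sup>2 = mink v v" "0 \<le> hnorm v'"
      using mink_tangent_nonneg[OF p] vT v' by (auto simp: a_def hnorm_def)
    \<comment> \<open>The vector v in P and the vector v' in the ball may differ a priori; both
      represent q, so their lengths have the same cosh and v is short as well.\<close>
    have "cosh a = cosh (hnorm v')" using mink_hexp[OF p vT] mink_hexp[OF p v'(1)] v v' by (simp add: a_def)
    then have a: "a < \<rho>" using a0 v'(2) by simp
    define y where "y = f ((sinh a / a) *\<^sub>R v)"
    have gy: "g y = (sinh a / a) *\<^sub>R v" unfolding y_def by (rule gf) (rule subspace_scale[OF P(1) v(1)])
    have "(norm y)\<^sup>2 = (sinh a / a)\<^sup>2 * a\<^sup>2"
      unfolding power2_norm_eq_inner inner(2)[symmetric] gy a0(2)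
      by (simp add: mink.scaleR_left mink.scaleR_right power2_eq_square)
    also have "\<dots> = (sinh a)\<^sup>2" by (cases "a = 0") (auto simp: power_divide)
    finally have ny: "(norm y)\<^sup>2 = (sinh a)\<^sup>2" .
    then have "norm y = sinh a" using a0(1) by (simp add: power2_eq_iff_nonneg)
    then have "y \<in> ?D" using a by simp
    moreover have "hyperbolic_graph p g y = q"
      using hexp_eq[OF p vT] v(2) ny cosh_square_eq[of a] cosh_real_nonneg[of a]
      by (simp add: hyperbolic_graph_def gy a_def add.commute real_sqrt_unique)
    ultimately show "q \<in> hyperbolic_graph p g ` ?D" by blast
  qed
  have l_graph: "l (hyperbolic_graph p g y) = y" for y
  proof -
    have "mink p p = -1" "mink p (g y) = 0" using p gT by (auto simp: hyperbolic_space_def tangent_space_def)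
    then have "tangent_proj p (hyperbolic_graph p g y) = g y"
      by (simp add: hyperbolic_graph_def tangent_proj_def mink.add_right mink.scaleR_right)
    then show ?thesis by (simp add: l_def fg)
  qed
  have l_inverse: "l x \<in> ?D \<and> hyperbolic_graph p g (l x) = x" if x: "x \<in> N" for x
  proof -
    obtain y where "y \<in> ?D" "x = hyperbolic_graph p g y" using N x by blast
    then show ?thesis using l_graph by simp
  qed
  then have lN: "l ` N \<subseteq> ?D" "inj_on l N"
    by (blast, blast intro: inj_on_inverseI)
  show ?thesis
    unfolding area_def N_def[symmetric]
  proof (rule SUP_least)
    fix \<F> :: "((((real^'n) \<times> real, 'k) chart) \<times> ((real^'n) \<times> real) set) set"
    assume \<F>: "\<F> \<in> borel_pieces (induced_atlas N)"
    then have fin: "finite \<F>" and dis: "disjoint_family_on snd \<F>"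
      and pc: "\<And>U \<phi> B. ((U, \<phi>), B) \<in> \<F> \<Longrightarrow> (U, \<phi>) \<in> induced_atlas N \<and> B \<subseteq> U \<and> \<phi> ` B \<in> sets borel"
      by (auto simp: borel_pieces_def)
    have "\<exists>Z. Z \<in> sets borel \<and> Z \<subseteq> l ` snd x \<and> chart_area (\<lambda>x. x) (fst x) (snd x) = (\<integral>\<^sup>+y\<in>Z. ?F y \<partial>lborel)"
      if "x \<in> \<F>" for x
    proof -
      obtain U \<phi> B where x: "x = ((U, \<phi>), B)" by (metis prod.collapse)
      have c: "(U, \<phi>) \<in> induced_atlas N" "B \<subseteq> U" "\<phi> ` B \<in> sets borel" using pc[of U \<phi> B] that x by auto
      obtain Z where "Z \<in> sets borel" "Z \<subseteq> (\<lambda>x. f (tangent_proj p x)) ` B"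
        "chart_area (\<lambda>x. x) (U, \<phi>) B = (\<integral>\<^sup>+y\<in>Z. ?F y \<partial>lborel)"
        by (rule chart_area_in_graph[OF p g(1) gT inner(2) f fg N c]) (rule that)
      then show ?thesis unfolding x l_def by auto
    qed
    then obtain Z where "\<forall>x\<in>\<F>. Z x \<in> sets borel \<and> Z x \<subseteq> l ` snd x \<and>
        chart_area (\<lambda>x. x) (fst x) (snd x) = (\<integral>\<^sup>+y\<in>Z x. ?F y \<partial>lborel)"
      using bchoice[of \<F> "\<lambda>x Z. Z \<in> sets borel \<and> Z \<subseteq> l ` snd x \<and>
        chart_area (\<lambda>x. x) (fst x) (snd x) = (\<integral>\<^sup>+y\<in>Z. ?F y \<partial>lborel)"] by blast
    then have Z: "\<And>x. x \<in> \<F> \<Longrightarrow> Z x \<in> sets borel" "\<And>x. x \<in> \<F> \<Longrightarrow> Z x \<subseteq> l ` snd x"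
      "\<And>x. x \<in> \<F> \<Longrightarrow> chart_area (\<lambda>x. x) (fst x) (snd x) = (\<integral>\<^sup>+y\<in>Z x. ?F y \<partial>lborel)"
      by blast+
    have sub: "snd x \<subseteq> N" if "x \<in> \<F>" for x
    proof -
      obtain U \<phi> B where x: "x = ((U, \<phi>), B)" by (metis prod.collapse)
      then have "(U, \<phi>) \<in> induced_atlas N" "B \<subseteq> U" using pc that by auto
      then show ?thesis using x by (auto simp: induced_atlas_def chart_of_def dest!: openin_imp_subset)
    qed
    have "(\<Sum>(c, B)\<in>\<F>. chart_area (\<lambda>x. x) c B) = (\<Sum>x\<in>\<F>. \<integral>\<^sup>+y\<in>Z x. ?F y \<partial>lborel)"
      by (intro sum.cong) (auto simp: Z(3) split: prod.splits dest: Z(3))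
    also have "\<dots> = (\<integral>\<^sup>+y. (\<Sum>x\<in>\<F>. ?F y * indicator (Z x) y) \<partial>lborel)"
    proof (rule nn_integral_sum[symmetric])
      fix x assume "x \<in> \<F>"
      then have [measurable]: "Z x \<in> sets borel" by (rule Z(1))
      show "(\<lambda>y. ?F y * indicator (Z x) y) \<in> borel_measurable lborel" by measurable
    qed
    also have "\<dots> \<le> (\<integral>\<^sup>+y\<in>?D. ?F y \<partial>lborel)"
    proof (rule nn_integral_mono)
      fix y
      have "(\<Sum>x\<in>\<F>. indicator (Z x) y) \<le> (indicator ?D y :: ennreal)"
      proof (cases "\<exists>x\<in>\<F>. y \<in> Z x")
        case True
        then obtain x where x: "x \<in> \<F>" "y \<in> Z x" by auto
        have uniq: "x' = x" if x': "x' \<in> \<F>" "y \<in> Z x'" for x'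
        proof (rule ccontr)
          assume "x' \<noteq> x"
          then have "snd x \<inter> snd x' = {}" using dis x x' by (auto simp: disjoint_family_on_def)
          moreover obtain m m' where "m \<in> snd x" "y = l m" "m' \<in> snd x'" "y = l m'"
            using Z(2)[OF x(1)] Z(2)[OF x'(1)] x x' by blast
          moreover have "m = m'" using calculation lN(2) sub x(1) x'(1) by (metis inj_onD subsetD)
          ultimately show False by blast
        qed
        have "(\<Sum>x\<in>\<F>. indicator (Z x) y) = (\<Sum>x'\<in>\<F>. if x' = x then 1 else 0 :: ennreal)"
        proof (rule sum.cong[OF refl])
          fix x' assume "x' \<in> \<F>"
          then show "indicator (Z x') y = (if x' = x then 1 else 0 :: ennreal)"
            using uniq[of x'] x(2) by (cases "y \<in> Z x'") auto
        qed
        also have "\<dots> = 1" using fin x(1) by simp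
        also have "1 = indicator ?D y"
          using Z(2)[OF x(1)] sub[OF x(1)] lN(1) x(2) by (subst indicator_simps(1)) blast+
        finally show ?thesis by simp
      next
        case False
        then show ?thesis by (simp add: indicator_def)
      qed
      then show "(\<Sum>x\<in>\<F>. ?F y * indicator (Z x) y) \<le> ?F y * indicator ?D y"
        unfolding sum_distrib_left[symmetric] by (rule mult_left_mono) simp
    qed
    finally show "(\<Sum>(c, B)\<in>\<F>. chart_area (\<lambda>x. x) c B) \<le> (\<integral>\<^sup>+y\<in>?D. ?F y \<partial>lborel)" .
  qed
qed

section \<open>Minimal submanifolds of hyperbolic space\<close>

context hyperbolic_param
begin

lemma du_inner: "du p x \<bullet> a = - mink p (L x a)"
  by (simp add: L_def du_def mink.sum_right mink.scaleR_right inner_vec_def sum_negf mult.commute)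

text \<open>The form is definite on tangent vectors and \<open>L x\<close> is injective, so duality
  to du determines the gradient. This coordinate-free description yields its behaviour under a
  change of chart.\<close>

lemma grad_unique:
  assumes x: "x \<in> V" and z: "\<And>a. mink (L x a) (L x z) = du p x \<bullet> a"
  shows "z = grad p x"
proof -
  define d where "d = z - grad p x"
  have "mink (L x d) (L x d) = mink (L x d) (L x z) - mink (L x d) (L x (grad p x))"
    using linear_diff[OF linear_L, of x z "grad p x"] by (simp add: d_def mink.diff_right)
  then have "mink (L x (z - grad p x)) (L x (z - grad p x)) = 0"
    using z[of d] mink_L_grad[OF x, of d p] by (simp add: d_def)
  then have "L x (z - grad p x) = 0"
    using mink_tangent_eq_0_iff[OF hyp[OF x] L_tangent[OF x]] by simp
  moreover have "L x 0 = 0" using linear_L by (rule linear_0)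
  moreover have "inj (L x)" using inj[OF x] by (simp add: L_def[abs_def])
  ultimately show ?thesis by (metis eq_iff_diff_eq_0 injD)
qed

lemma gradsq_eq: "x \<in> V \<Longrightarrow> gradsq p x = mink (L x (grad p x)) (L x (grad p x))"
  by (simp add: gradsq_def mink_L_grad)

lemma weight_eq_gram: "weight x = sqrt (det (gram (L x)))"
  by (simp add: weight_def G_def gram_def L_def)

end

section \<open>The part of the submanifold inside the open geodesic ball\<close>

locale minimal_submanifold =
  fixes p :: "(real^'n) \<times> real" and \<rho> :: real
    and M :: "'m::t2_space set" and A :: "('m, 'k::finite) chart set" and F :: "'m \<Rightarrow> (real^'n) \<times> real"
  assumes p: "p \<in> hyperbolic_space" and \<rho>: "0 < \<rho>"
    and manifold: "smooth_manifold M A" and compact_M: "compact M"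
    and immersion: "hyperbolic_immersion M A F" and minimal: "minimal A F"
    and p_in: "p \<in> F ` M"
    and boundary: "F ` manifold_boundary A \<subseteq> geodesic_sphere p \<rho>"
begin

definition height :: "'m \<Rightarrow> real" where "height m = - mink p (F m)"

text \<open>M may leave the ball, but only this part is used. It contains no boundary point, so its
  chart images are open in the coordinate space.\<close>

definition M' :: "'m set" where "M' = {m \<in> M. height m < cosh \<rho>}"

definition par :: "('m, 'k) chart \<Rightarrow> real^'k \<Rightarrow> 'm" where "par c = inv_into (fst c) (snd c)"

definition dom :: "('m, 'k) chart \<Rightarrow> (real^'k) set" where "dom c = snd c ` (fst c \<inter> M')"

definition fc :: "('m, 'k) chart \<Rightarrow> real^'k \<Rightarrow> (real^'n) \<times> real" where "fc c = F \<circ> par c"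

lemma chart:
  assumes "c \<in> A"
  shows "homeomorphism (fst c) (snd c ` fst c) (snd c) (par c)"
    and "openin (top_of_set M) (fst c)" and "openin (top_of_set half_space) (snd c ` fst c)"
    and "immersion_on (snd c ` fst c) (fc c)"
proof -
  obtain U \<phi> where c: "c = (U, \<phi>)" by (metis prod.collapse)
  have "chart_of M c" using manifold assms by (simp add: smooth_manifold_def)
  then show "homeomorphism (fst c) (snd c ` fst c) (snd c) (par c)"
    and "openin (top_of_set M) (fst c)" and "openin (top_of_set half_space) (snd c ` fst c)"
    by (simp_all add: c chart_of_def par_def)
  show "immersion_on (snd c ` fst c) (fc c)"
    using immersion assms unfolding hyperbolic_immersion_def c by (auto simp: fc_def par_def)
qed

lemma par_chart:
  assumes "c \<in> A"
  shows "m \<in> fst c \<Longrightarrow> par c (snd c m) = m" and "x \<in> snd c ` fst c \<Longrightarrow> snd c (par c x) = x"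
    and "x \<in> snd c ` fst c \<Longrightarrow> par c x \<in> fst c"
  using chart(1)[OF assms] by (auto simp: homeomorphism_def)

lemma fst_chart_subset: "c \<in> A \<Longrightarrow> fst c \<subseteq> M"
  using chart(2) openin_imp_subset by blast

lemma M_cover: "m \<in> M \<Longrightarrow> \<exists>c\<in>A. m \<in> fst c"
  using manifold by (auto simp: smooth_manifold_def)

text \<open>Covers boundary points of the chart as well: there continuity is inherited from the
  local smooth extension.\<close>

lemma continuous_F_chart:
  assumes c: "c \<in> A"
  shows "continuous_on (fst c) F"
proof -
  have sm: "smooth_on (snd c ` fst c) (fc c)" using chart(4)[OF c] by (simp add: immersion_on_def)
  have "continuous_on (snd c ` fst c) (fc c)"
  proof (rule continuous_on_eq_continuous_within[THEN iffD2, rule_format])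
    fix x assume x: "x \<in> snd c ` fst c"
    then obtain W g where W: "open W" "x \<in> W" "\<forall>m. Ck_on m W g" "\<forall>y\<in>W \<inter> snd c ` fst c. g y = fc c y"
      using sm[unfolded smooth_on_def, rule_format, OF x] by blast
    have "Ck_on 0 W g" using W(3) by blast
    then have "isCont g x" using W(1,2) by (simp add: continuous_on_eq_continuous_at)
    then have "(g \<longlongrightarrow> g x) (at x within snd c ` fst c)"
      by (auto simp: isCont_def intro: tendsto_within_subset)
    moreover have "\<forall>\<^sub>F y in at x within snd c ` fst c. g y = fc c y"
      using W by (auto simp: eventually_at_topological intro!: exI[of _ W])
    ultimately show "continuous (at x within snd c ` fst c) (fc c)"
      using W(2,4) x by (auto simp: continuous_within tendsto_cong)
  qed
  moreover have "continuous_on (fst c) (snd c)" using chart(1)[OF c] by (simp add: homeomorphism_def)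
  ultimately have "continuous_on (fst c) (fc c \<circ> snd c)" by (intro continuous_on_compose)
  then show ?thesis using par_chart(1)[OF c] by (simp add: fc_def cong: continuous_on_cong)
qed

lemma openin_height:
  assumes "open T"
  shows "openin (top_of_set M) {m \<in> M. height m \<in> T}"
proof -
  have "openin (top_of_set M) {m \<in> fst c. height m \<in> T}" if c: "c \<in> A" for c
  proof -
    have "continuous_on (fst c) height"
      unfolding height_def[abs_def]
      by (intro continuous_intros mink.continuous_on continuous_F_chart[OF c])
    then have "openin (top_of_set (fst c)) (fst c \<inter> height -` T)"
      using assms by (simp add: continuous_openin_preimage_gen)
    moreover have "fst c \<inter> height -` T = {m \<in> fst c. height m \<in> T}" by auto
    ultimately show ?thesis using chart(2)[OF c] openin_trans by metis
  qed
  then have "openin (top_of_set M) (\<Union>c\<in>A. {m \<in> fst c. height m \<in> T})" by (intro openin_Union) auto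
  moreover have "(\<Union>c\<in>A. {m \<in> fst c. height m \<in> T}) = {m \<in> M. height m \<in> T}"
    using M_cover fst_chart_subset by blast
  ultimately show ?thesis by simp
qed

lemma compact_height_le: "compact {m \<in> M. height m \<le> t}"
proof -
  have "openin (top_of_set M) {m \<in> M. height m \<in> {t<..}}" by (rule openin_height) simp
  then have "closedin (top_of_set M) (M - {m \<in> M. height m \<in> {t<..}})" by (simp add: closedin_diff)
  moreover have "M - {m \<in> M. height m \<in> {t<..}} = {m \<in> M. height m \<le> t}" by auto
  ultimately show ?thesis using closedin_compact[OF compact_M] by simp
qed

lemma openin_M': "openin (top_of_set M) M'"
  using openin_height[of "{..<cosh \<rho>}"] by (simp add: M'_def)

text \<open>A boundary point is mapped to the geodesic sphere, so by \<open>mink_hexp\<close> its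
  height is exactly cosh \<rho>.\<close>

lemma interior_M':
  assumes c: "c \<in> A" and m: "m \<in> fst c" "m \<in> M'"
  shows "snd c m $ half_index \<noteq> 0"
proof
  assume "snd c m $ half_index = 0"
  then have "m \<in> manifold_boundary A"
    using c m by (auto simp: manifold_boundary_def intro!: bexI[of _ c] split: prod.splits)
  then obtain v where v: "v \<in> tangent_space p" "hnorm v = \<rho>" "F m = hexp p v"
    using boundary by (auto simp: geodesic_sphere_def image_subset_iff)
  then have "height m = cosh \<rho>" using mink_hexp[OF p v(1)] by (simp add: height_def)
  then show False using m by (simp add: M'_def)
qed

lemma open_chart_image:
  assumes c: "c \<in> A" and W: "openin (top_of_set M) W"
  shows "open (snd c ` (fst c \<inter> M' \<inter> W))"
proof -
  let ?Y = "fst c \<inter> M' \<inter> W"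
  have "openin (top_of_set M) ?Y" using chart(2)[OF c] openin_M' W by (intro openin_Int)
  then have "openin (top_of_set (fst c)) ?Y"
    by (rule openin_subset_trans) (use fst_chart_subset[OF c] in auto)
  then have "openin (top_of_set (snd c ` fst c)) (snd c ` ?Y)"
    by (rule homeomorphism_imp_open_map[OF chart(1)[OF c]])
  then have "openin (top_of_set half_space) (snd c ` ?Y)"
    using chart(3)[OF c] openin_trans by blast
  then have "open {x \<in> snd c ` ?Y. x $ half_index \<noteq> 0}" by (rule openin_half_space_interior)
  moreover have "{x \<in> snd c ` ?Y. x $ half_index \<noteq> 0} = snd c ` ?Y" using interior_M'[OF c] by auto
  ultimately show ?thesis by simp
qed

lemma open_dom: "c \<in> A \<Longrightarrow> open (dom c)"
proof -
  assume c: "c \<in> A"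
  have "fst c \<inter> M' \<inter> M = fst c \<inter> M'" by (auto simp: M'_def)
  then show "open (dom c)" using open_chart_image[OF c openin_subtopology_self] by (simp add: dom_def)
qed

lemma dom_subset: "dom c \<subseteq> snd c ` fst c"
  by (auto simp: dom_def)

lemma par_dom:
  assumes "c \<in> A" "x \<in> dom c"
  shows "par c x \<in> fst c" "par c x \<in> M'" "snd c (par c x) = x"
  using assms par_chart[OF assms(1)] by (auto simp: dom_def)

lemma par_image_dom: "c \<in> A \<Longrightarrow> par c ` dom c = fst c \<inter> M'"
  using par_chart(1) by (simp add: dom_def image_image cong: image_cong_simp)

lemma overlap_eq:
  assumes "c \<in> A" "d \<in> A"
  shows "{x \<in> dom c. par c x \<in> par d ` dom d} = snd c ` (fst c \<inter> M' \<inter> fst d)"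
  unfolding par_image_dom[OF assms(2)] using par_chart(1)[OF assms(1)] by (auto simp: dom_def)

definition Df :: "('m, 'k) chart \<Rightarrow> real^'k \<Rightarrow> real^'k \<Rightarrow> (real^'n) \<times> real" where
  "Df c x = frechet_derivative (fc c) (at x)"

definition E :: "('m, 'k) chart \<Rightarrow> 'k \<Rightarrow> real^'k \<Rightarrow> (real^'n) \<times> real" where
  "E c j x = Df c x (axis j 1)"

definition D2 :: "('m, 'k) chart \<Rightarrow> 'k \<Rightarrow> 'k \<Rightarrow> real^'k \<Rightarrow> (real^'n) \<times> real" where
  "D2 c i j x = frechet_derivative (E c j) (at x) (axis i 1)"

lemma Df:
  assumes c: "c \<in> A" and x: "x \<in> dom c"
  shows "(fc c has_derivative Df c x) (at x)"
proof -
  have sm: "smooth_on (snd c ` fst c) (fc c)" using chart(4)[OF c] by (simp add: immersion_on_def)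
  show ?thesis unfolding Df_def by (rule smooth_on_derivative(1)[OF sm open_dom[OF c] dom_subset x])
qed

lemma linear_Df: "c \<in> A \<Longrightarrow> x \<in> dom c \<Longrightarrow> linear (Df c x)"
  using Df has_derivative_linear by blast

lemma Df_eq_sum: "c \<in> A \<Longrightarrow> x \<in> dom c \<Longrightarrow> Df c x h = (\<Sum>j\<in>UNIV. h $ j *\<^sub>R E c j x)"
  unfolding E_def using linear_eq_sum_axis[OF linear_Df] by blast

lemma hyperbolic_param:
  assumes c: "c \<in> A"
  shows "hyperbolic_param (dom c) (fc c) (E c) (D2 c)"
proof
  have sm: "smooth_on (snd c ` fst c) (fc c)" using chart(4)[OF c] by (simp add: immersion_on_def)
  note d = smooth_on_derivative[OF sm open_dom[OF c] dom_subset]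
  have E_eq: "E c j = (\<lambda>x. frechet_derivative (fc c) (at x) (axis j 1))" for j
    by (simp add: E_def[abs_def] Df_def)
  show "open (dom c)" by (rule open_dom[OF c])
  fix x assume x: "x \<in> dom c"
  show "fc c x \<in> hyperbolic_space"
    using immersion par_dom[OF c x] by (auto simp: fc_def hyperbolic_immersion_def M'_def)
  show "(fc c has_derivative (\<lambda>h. \<Sum>j\<in>UNIV. h $ j *\<^sub>R E c j x)) (at x)"
    using Df[OF c x] Df_eq_sum[OF c x] by (metis (no_types, lifting) ext)
  show "(E c j has_derivative (\<lambda>h. \<Sum>i\<in>UNIV. h $ i *\<^sub>R D2 c i j x)) (at x)" for j
    unfolding D2_def by (rule has_derivative_sum_axis) (use d(3)[OF x] in \<open>simp add: E_eq\<close>)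
  have "at x within snd c ` fst c = at x"
    by (rule at_within_interior[OF interiorI[OF open_dom[OF c] x dom_subset]])
  moreover have "inj (frechet_derivative (fc c) (at x within snd c ` fst c))"
    using chart(4)[OF c] subsetD[OF dom_subset x] unfolding immersion_on_def by blast
  ultimately have "inj (Df c x)" by (simp add: Df_def)
  moreover have "(\<lambda>h. \<Sum>j\<in>UNIV. h $ j *\<^sub>R E c j x) = Df c x" using Df_eq_sum[OF c x] by auto
  ultimately show "inj (\<lambda>h. \<Sum>j\<in>UNIV. h $ j *\<^sub>R E c j x)" by simp
next
  have sm: "smooth_on (snd c ` fst c) (fc c)" using chart(4)[OF c] by (simp add: immersion_on_def)
  note d = smooth_on_derivative[OF sm open_dom[OF c] dom_subset]
  have E_eq: "E c j = (\<lambda>x. frechet_derivative (fc c) (at x) (axis j 1))" for j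
    by (simp add: E_def[abs_def] Df_def)
  show "continuous_on (dom c) (D2 c i j)" for i j
    using d(4)[of "axis j 1" "axis i 1"] by (simp add: D2_def[abs_def] E_eq)
qed

lemma L_eq_Df:
  assumes "c \<in> A" "x \<in> dom c"
  shows "hyperbolic_param.L (E c) x = Df c x"
  using Df_eq_sum[OF assms] by (simp add: fun_eq_iff hyperbolic_param.L_def[OF hyperbolic_param[OF assms(1)]])

lemma induced_metric_eq_G:
  assumes c: "c \<in> A" and x: "x \<in> dom c"
  shows "induced_metric (snd c ` fst c) (fc c) x = hyperbolic_param.G (E c) x"
  by (simp add: induced_metric_interior[OF open_dom[OF c] dom_subset x]
      hyperbolic_param.G_def[OF hyperbolic_param[OF c]] gram_def E_def Df_def)

lemma minimal_chart:
  assumes c: "c \<in> A" and x: "x \<in> dom c"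
  shows "(\<Sum>i\<in>UNIV. \<Sum>j\<in>UNIV. matrix_inv (hyperbolic_param.G (E c) x) $ i $ j *\<^sub>R
      (tangent_proj (fc c x) (D2 c i j x) - (\<Sum>a\<in>UNIV. \<Sum>b\<in>UNIV.
        (matrix_inv (hyperbolic_param.G (E c) x) $ a $ b * mink (tangent_proj (fc c x) (D2 c i j x)) (E c a x)) *\<^sub>R E c b x))) = 0"
proof -
  note part = partial_interior[OF open_dom[OF c] dom_subset x]
  have 1: "partial (snd c ` fst c) i (fc c) x = E c i x" for i by (simp add: part E_def Df_def)
  have 2: "partial (snd c ` fst c) i (partial (snd c ` fst c) j (fc c)) x = D2 c i j x" for i j
    by (simp only: part(2) D2_def E_def[abs_def] Df_def)
  have "mean_curvature (snd c ` fst c) (fc c) x = 0"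
    using minimal c x dom_subset[of c] by (fastforce simp: minimal_def fc_def par_def split: prod.splits)
  then show ?thesis
    unfolding mean_curvature_def second_fundamental_form_def normal_part_def 1 2 induced_metric_eq_G[OF c x] .
qed

section \<open>Behaviour of volume density and gradient under a change of chart\<close>

definition trans :: "('m, 'k) chart \<Rightarrow> ('m, 'k) chart \<Rightarrow> real^'k \<Rightarrow> real^'k" where
  "trans c d = snd d \<circ> par c"

definition Dtrans :: "('m, 'k) chart \<Rightarrow> ('m, 'k) chart \<Rightarrow> real^'k \<Rightarrow> real^'k \<Rightarrow> real^'k" where
  "Dtrans c d x = frechet_derivative (trans c d) (at x)"

abbreviation "overlap c d \<equiv> {x \<in> dom c. par c x \<in> par d ` dom d}"

lemma open_overlap: "c \<in> A \<Longrightarrow> d \<in> A \<Longrightarrow> open (overlap c d)"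
  unfolding overlap_eq by (rule open_chart_image[OF _ chart(2)])

lemma trans:
  assumes c: "c \<in> A" and d: "d \<in> A"
  shows "x \<in> overlap c d \<Longrightarrow> trans c d x \<in> dom d \<and> par d (trans c d x) = par c x"
    and "x \<in> overlap c d \<Longrightarrow> (trans c d has_derivative Dtrans c d x) (at x)"
    and "continuous_on (overlap c d) (\<lambda>x. Dtrans c d x v)"
proof -
  show "x \<in> overlap c d \<Longrightarrow> trans c d x \<in> dom d \<and> par d (trans c d x) = par c x"
    using par_chart(1)[OF d] par_image_dom[OF d] by (auto simp: trans_def dom_def)
  have sm: "smooth_on (snd c ` (fst c \<inter> fst d)) (trans c d)"
    using manifold c d unfolding smooth_manifold_def compatible_charts_def trans_def par_def
    by (metis (no_types, lifting) case_prod_beta)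
  have sub: "overlap c d \<subseteq> snd c ` (fst c \<inter> fst d)" unfolding overlap_eq[OF c d] by auto
  show "x \<in> overlap c d \<Longrightarrow> (trans c d has_derivative Dtrans c d x) (at x)"
    "continuous_on (overlap c d) (\<lambda>x. Dtrans c d x v)"
    unfolding Dtrans_def
    by (erule smooth_on_derivative(1)[OF sm open_overlap[OF c d] sub],
        rule smooth_on_derivative(2)[OF sm open_overlap[OF c d] sub])
qed

lemma Df_trans:
  assumes c: "c \<in> A" and d: "d \<in> A" and x: "x \<in> overlap c d"
  shows "Df c x = Df d (trans c d x) \<circ> Dtrans c d x"
proof -
  have "((\<lambda>x. fc d (trans c d x)) has_derivative (\<lambda>v. Df d (trans c d x) (Dtrans c d x v))) (at x)"
    by (rule has_derivative_compose[OF trans(2)[OF c d x] Df[OF d]]) (use trans(1)[OF c d x] in simp)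
  then have "(fc c has_derivative (\<lambda>v. Df d (trans c d x) (Dtrans c d x v))) (at x)"
    by (rule has_derivative_transform_within_open[OF _ open_overlap[OF c d] x])
       (use trans(1)[OF c d] in \<open>auto simp: fc_def\<close>)
  from frechet_derivative_at[OF this, symmetric] show ?thesis by (simp only: Df_def o_def)
qed

lemma weight_trans:
  assumes c: "c \<in> A" and d: "d \<in> A" and x: "x \<in> overlap c d"
  shows "hyperbolic_param.weight (E c) x = \<bar>det (matrix (Dtrans c d x))\<bar> * hyperbolic_param.weight (E d) (trans c d x)"
proof -
  have t: "trans c d x \<in> dom d" using trans(1)[OF c d x] by simp
  have "linear (Dtrans c d x)" using trans(2)[OF c d x] by (rule has_derivative_linear)
  then show ?thesis
    using sqrt_det_gram_compose[OF linear_Df[OF d t]] x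
    by (simp add: hyperbolic_param.weight_eq_gram[OF hyperbolic_param] c d L_eq_Df t Df_trans[OF c d x])
qed

text \<open>By the chain rule the differential in chart c is that in chart d after the transition
  derivative, which is onto. The transported gradient therefore satisfies the defining duality, and
  \<open>grad_unique\<close> applies.\<close>

lemma grad_trans:
  assumes c: "c \<in> A" and d: "d \<in> A" and x: "x \<in> overlap c d"
  shows "hyperbolic_param.grad (E d) p (trans c d x) = Dtrans c d x (hyperbolic_param.grad (E c) p x)"
    and "hyperbolic_param.gradsq (E d) p (trans c d x) = hyperbolic_param.gradsq (E c) p x"
proof -
  interpret C: hyperbolic_param "dom c" "fc c" "E c" "D2 c" by (rule hyperbolic_param[OF c])
  interpret D: hyperbolic_param "dom d" "fc d" "E d" "D2 d" by (rule hyperbolic_param[OF d])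
  let ?y = "trans c d x" and ?T = "Dtrans c d x"
  have t: "?y \<in> dom d" using trans(1)[OF c d x] by simp
  have xc: "x \<in> dom c" using x by simp
  have L: "C.L x a = D.L ?y (?T a)" for a
    using Df_trans[OF c d x] by (simp add: L_eq_Df c d t xc)
  have lin: "linear ?T" using trans(2)[OF c d x] by (rule has_derivative_linear)
  have "inj (C.L x)" using C.inj[OF xc] by (simp add: C.L_def[abs_def])
  then have "inj ?T" unfolding inj_def L by metis
  then have surj: "surj ?T" using lin linear_injective_imp_surjective by blast
  show eq: "D.grad p ?y = ?T (C.grad p x)"
  proof (rule D.grad_unique[OF t, symmetric])
    fix a
    obtain b where a: "a = ?T b" using surj by (metis surjD)
    show "mink (D.L ?y a) (D.L ?y (?T (C.grad p x))) = D.du p ?y \<bullet> a"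
      using C.mink_L_grad[OF xc, of b p] by (simp add: a L C.du_inner D.du_inner)
  qed
  show "D.gradsq p ?y = C.gradsq p x"
    by (simp add: D.gradsq_eq[OF t] C.gradsq_eq[OF xc] L eq)
qed

end

section \<open>The divergence inequality\<close>

text \<open>Reversed Cauchy-Schwarz inequality: the component of q orthogonal to p has squared
  length (mink p q)^2 - 1, which is nonnegative, and both points lie on the upper sheet, which fixes
  the sign.\<close>

lemma mink_hyperbolic_space_le:
  fixes p q :: "(real^'n) \<times> real"
  assumes p: "p \<in> hyperbolic_space" and q: "q \<in> hyperbolic_space"
  shows "mink p q \<le> - 1"
proof -
  have pp: "mink p p = -1" and qq: "mink q q = -1" using p q by (auto simp: hyperbolic_space_def)
  let ?v = "q + mink p q *\<^sub>R p"
  have "?v \<in> tangent_space p" by (simp add: tangent_space_def mink.add_right mink.scaleR_right pp)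
  then have "0 \<le> mink ?v ?v" by (rule mink_tangent_nonneg[OF p])
  also have "mink ?v ?v = (mink p q)\<^sup>2 - 1"
    by (simp add: mink.add_left mink.add_right mink.scaleR_left mink.scaleR_right pp qq mink_commute[of q p] power2_eq_square)
  finally have "1\<^sup>2 \<le> \<bar>mink p q\<bar>\<^sup>2" by simp
  then have abs: "1 \<le> \<bar>mink p q\<bar>" by (rule power2_le_imp_le) simp
  have "norm (fst x) < snd x" if "x \<in> hyperbolic_space" for x :: "(real^'n) \<times> real"
  proof (rule power2_less_imp_less)
    show "(norm (fst x))\<^sup>2 < (snd x)\<^sup>2"
      unfolding power2_norm_eq_inner power2_eq_square[of "snd x"]
      using that by (simp add: hyperbolic_space_def mink_def)
  qed (use that in \<open>simp add: hyperbolic_space_def\<close>)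
  then have "norm (fst p) * norm (fst q) < snd p * snd q"
    using p q by (intro mult_strict_mono) (auto simp: hyperbolic_space_def)
  then have "mink p q < 0"
    using norm_cauchy_schwarz[of "fst p" "fst q"] by (simp add: mink_def)
  then show ?thesis using abs by simp
qed

lemma integrable_indicator_compact:
  fixes f :: "'a::euclidean_space \<Rightarrow> real"
  assumes "compact C" "continuous_on C f" "S \<in> sets borel" "S \<subseteq> C"
  shows "integrable lborel (\<lambda>x. indicator S x * f x)"
proof -
  have "set_integrable lborel C f"
    unfolding set_integrable_def by (rule borel_integrable_compact[OF assms(1,2)])
  then have "set_integrable lborel S f" by (rule set_integrable_subset) (use assms in auto)
  then show ?thesis by (simp add: set_integrable_def)
qed

text \<open>A profile that vanishes above \<open>u\<^sub>1\<close>, together with finitely many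
  chart balls covering the compact sublevel set that supports the field.\<close>

locale minimal_cover = minimal_submanifold p \<rho> M A F
  for p :: "(real^'n) \<times> real" and \<rho> :: real
    and M :: "'m::t2_space set" and A :: "('m, 'k::finite) chart set" and F :: "'m \<Rightarrow> (real^'n) \<times> real" +
  fixes n :: nat and C :: "nat \<Rightarrow> ('m, 'k) chart" and c :: "nat \<Rightarrow> real^'k" and r :: "nat \<Rightarrow> real"
    and u\<^sub>1 :: real and \<Psi> w :: "real \<Rightarrow> real" and \<epsilon> :: real
  assumes n: "0 < n" and C: "i < n \<Longrightarrow> C i \<in> A" and r: "i < n \<Longrightarrow> 0 < r i"
    and cball_dom: "i < n \<Longrightarrow> cball (c i) (2 * r i) \<subseteq> dom (C i)"
    and cover: "{m \<in> M. height m \<le> u\<^sub>1} \<subseteq> (\<Union>i<n. par (C i) ` ball (c i) (r i))"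
    and \<epsilon>: "0 < \<epsilon>"
    and \<Psi>: "1 \<le> u \<Longrightarrow> u < cosh \<rho> \<Longrightarrow> (\<Psi> has_real_derivative - w u) (at u)"
    and w_cont: "continuous_on UNIV w" and w_nonneg: "0 \<le> w u"
    and w_le: "1 \<le> u \<Longrightarrow> w u * (u\<^sup>2 - 1) \<le> (u\<^sup>2 - 1) powr (real CARD('k) / 2)"
    and \<Psi>_nonneg: "1 \<le> u \<Longrightarrow> u < cosh \<rho> \<Longrightarrow> 0 \<le> \<Psi> u"
    and \<Psi>_eq_0: "u\<^sub>1 \<le> u \<Longrightarrow> u < cosh \<rho> \<Longrightarrow> \<Psi> u = 0 \<and> w u = 0"
begin

definition k :: real where "k = real CARD('k)"

text \<open>In terms of \<open>t\<^sup>2 = u\<^sup>2 - 1\<close>, the field \<open>g (u) \<nabla>u\<close> is the singular field with potential \<open>- \<Psi> t\<^bsup>-k\<^esup>\<close>, regularised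
  at \<open>p\<close> by \<open>\<epsilon>\<close>; the regularisation produces the approximate delta function \<open>\<kappa>\<close> in its divergence.\<close>

definition g :: "real \<Rightarrow> real" where
  "g u = - \<Psi> u * (u\<^sup>2 - 1 + \<epsilon>\<^sup>2) powr (- (k / 2))"

definition \<kappa> :: "real \<Rightarrow> real" where
  "\<kappa> u = \<Psi> u * (k * u * \<epsilon>\<^sup>2 * (u\<^sup>2 - 1 + \<epsilon>\<^sup>2) powr (- (k / 2) - 1))"

definition g' :: "real \<Rightarrow> real" where
  "g' u = w u * (u\<^sup>2 - 1 + \<epsilon>\<^sup>2) powr (- (k / 2)) + \<Psi> u * (k * u * (u\<^sup>2 - 1 + \<epsilon>\<^sup>2) powr (- (k / 2) - 1))"

lemma k_pos: "0 < k" by (simp add: k_def)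

lemma base_pos: "1 \<le> u \<Longrightarrow> 0 < u\<^sup>2 - 1 + \<epsilon>\<^sup>2"
  using one_le_power[of u 2] \<epsilon> zero_less_power[of \<epsilon> 2] by linarith

lemma g': "1 \<le> u \<Longrightarrow> u < cosh \<rho> \<Longrightarrow> (g has_real_derivative g' u) (at u)"
  unfolding g_def[abs_def] g'_def
  using base_pos[of u] \<Psi>[of u]
  by (auto intro!: derivative_eq_intros simp: powr_diff field_simps)

lemma \<Psi>_cont: "continuous_on {1..<cosh \<rho>} \<Psi>"
  by (intro continuous_at_imp_continuous_on ballI DERIV_isCont[OF \<Psi>]) auto

lemma g'_cont: "continuous_on {1..<cosh \<rho>} g'"
  unfolding g'_def[abs_def] using base_pos
  by (intro continuous_intros \<Psi>_cont continuous_on_subset[OF w_cont]) (auto simp: less_imp_neq[symmetric])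

lemma g_cont: "continuous_on {1..<cosh \<rho>} g"
  by (intro continuous_at_imp_continuous_on ballI DERIV_isCont[OF g']) auto

lemma \<kappa>_cont: "continuous_on {1..<cosh \<rho>} \<kappa>"
  unfolding \<kappa>_def[abs_def] using base_pos
  by (intro continuous_intros \<Psi>_cont) (auto simp: less_imp_neq[symmetric])

lemma \<kappa>_nonneg: "1 \<le> u \<Longrightarrow> u < cosh \<rho> \<Longrightarrow> 0 \<le> \<kappa> u"
  unfolding \<kappa>_def using \<Psi>_nonneg k_pos by (intro mult_nonneg_nonneg) auto

lemma g'_nonneg: "1 \<le> u \<Longrightarrow> u < cosh \<rho> \<Longrightarrow> 0 \<le> g' u"
  unfolding g'_def using \<Psi>_nonneg k_pos w_nonneg by (intro add_nonneg_nonneg mult_nonneg_nonneg) auto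

text \<open>With q the squared gradient, the left-hand side is the divergence plus \<kappa>. As g'
  is nonnegative, q may be replaced by u^2 - 1, and the bound on w compares what remains with the
  quotient of u^2 - 1 and Q, raised to the power k/2.\<close>

lemma divergence_le:
  assumes u: "1 \<le> u" "u < cosh \<rho>" and q: "q \<le> u\<^sup>2 - 1"
  shows "g' u * q + g u * (k * u) + \<kappa> u \<le> 1"
proof -
  let ?Q = "u\<^sup>2 - 1 + \<epsilon>\<^sup>2"
  have Q: "0 < ?Q" using base_pos u by blast
  have u2: "0 \<le> u\<^sup>2 - 1" using one_le_power[OF u(1), of 2] by simp
  have split: "?Q powr (- (k / 2)) = ?Q powr (- (k / 2) - 1) * ?Q" using Q by (simp add: powr_diff)
  have "g' u * q \<le> g' u * (u\<^sup>2 - 1)" using q g'_nonneg[OF u] by (rule mult_left_mono)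
  then have "g' u * q + g u * (k * u) + \<kappa> u \<le> g' u * (u\<^sup>2 - 1) + g u * (k * u) + \<kappa> u" by simp
  \<comment> \<open>All terms with \<Psi> cancel: they carry the common factor (u^2 - 1) - Q +
    \<epsilon>^2 = 0.\<close>
  also have "\<dots> = w u * (u\<^sup>2 - 1) * ?Q powr (- (k / 2))"
    unfolding g'_def g_def \<kappa>_def split by (simp add: algebra_simps power2_eq_square)
  also have "\<dots> \<le> (u\<^sup>2 - 1) powr (k / 2) * ?Q powr (- (k / 2))"
    using w_le[OF u(1)] by (intro mult_right_mono) (auto simp: k_def)
  also have "\<dots> \<le> ?Q powr (k / 2) * ?Q powr (- (k / 2))"
    using u2 k_pos by (intro mult_right_mono powr_mono2) auto
  also have "\<dots> = 1" using Q by (simp add: powr_minus)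
  finally show ?thesis .
qed

definition u :: "nat \<Rightarrow> real^'k \<Rightarrow> real" where "u i x = hyperbolic_param.u (fc (C i)) p x"
definition wt :: "nat \<Rightarrow> real^'k \<Rightarrow> real" where "wt i x = hyperbolic_param.weight (E (C i)) x"
definition X :: "nat \<Rightarrow> real^'k \<Rightarrow> real^'k" where "X i x = g (u i x) *\<^sub>R hyperbolic_param.grad (E (C i)) p x"
definition D :: "nat \<Rightarrow> real^'k \<Rightarrow> real" where
  "D i x = g' (u i x) * hyperbolic_param.gradsq (E (C i)) p x + g (u i x) * (k * u i x)"

lemma hp: "i < n \<Longrightarrow> hyperbolic_param (dom (C i)) (fc (C i)) (E (C i)) (D2 (C i))"
  by (rule hyperbolic_param[OF C])

lemma u_eq_height: "i < n \<Longrightarrow> u i x = height (par (C i) x)"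
  unfolding u_def by (subst hyperbolic_param.u_def[OF hp]) (simp_all add: height_def fc_def)

lemma u_bounds:
  assumes i: "i < n" and x: "x \<in> dom (C i)"
  shows "1 \<le> u i x" "u i x < cosh \<rho>"
proof -
  have "fc (C i) x \<in> hyperbolic_space" by (rule hyperbolic_param.hyp[OF hp[OF i] x])
  then show "1 \<le> u i x"
    using mink_hyperbolic_space_le[OF p] by (fastforce simp: u_def hyperbolic_param.u_def[OF hp[OF i]])
  show "u i x < cosh \<rho>" using par_dom[OF C[OF i] x] by (simp add: u_eq_height[OF i] M'_def)
qed

lemma u_cont: "i < n \<Longrightarrow> continuous_on (dom (C i)) (u i)"
  unfolding u_def[abs_def] using C1_on_imp_continuous_on[OF hyperbolic_param.C1_u[OF hp]] .

lemma wt_cont: "i < n \<Longrightarrow> continuous_on (dom (C i)) (wt i)"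
  unfolding wt_def[abs_def] using C1_on_imp_continuous_on[OF hyperbolic_param.C1_weight[OF hp]] .

lemma compose_u_cont:
  assumes "i < n" "continuous_on {1..<cosh \<rho>} h"
  shows "continuous_on (dom (C i)) (\<lambda>x. h (u i x))"
  by (rule continuous_on_compose2[OF assms(2) u_cont[OF assms(1)]]) (use u_bounds[OF assms(1)] in auto)

lemma grad_cont:
  assumes i: "i < n"
  shows "continuous_on (dom (C i)) (hyperbolic_param.grad (E (C i)) p)"
proof -
  have "continuous_on (dom (C i)) (\<lambda>x. \<chi> l. hyperbolic_param.grad (E (C i)) p x $ l)"
    by (intro continuous_on_vec_lambda C1_on_imp_continuous_on[OF hyperbolic_param.C1_grad[OF hp[OF i]]])
  then show ?thesis by simp
qed

lemma gradsq_cont: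
  assumes i: "i < n"
  shows "continuous_on (dom (C i)) (hyperbolic_param.gradsq (E (C i)) p)"
  unfolding hyperbolic_param.gradsq_def[OF hp[OF i], abs_def] inner_vec_def
  by (simp, intro continuous_intros C1_on_imp_continuous_on[OF hyperbolic_param.C1_du[OF hp[OF i]]]
      C1_on_imp_continuous_on[OF hyperbolic_param.C1_grad[OF hp[OF i]]])

sublocale chart_field n "\<lambda>i. dom (C i)" "\<lambda>i. par (C i)" c r "\<lambda>i j. trans (C i) (C j)" "\<lambda>i j. Dtrans (C i) (C j)"
  wt X D "{m \<in> M. height m \<le> u\<^sub>1}"
proof
  fix i assume i: "i < n"
  show "open (dom (C i))" by (rule open_dom[OF C[OF i]])
  show "inj_on (par (C i)) (dom (C i))" using par_dom(3)[OF C[OF i]] by (metis inj_onI)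
  show "0 < r i" "cball (c i) (2 * r i) \<subseteq> dom (C i)" using r cball_dom i by auto
  show "continuous_on (dom (C i)) (wt i)" by (rule wt_cont[OF i])
  show "continuous_on (dom (C i)) (X i)"
    unfolding X_def[abs_def] by (intro continuous_on_scaleR compose_u_cont[OF i g_cont] grad_cont[OF i])
  show "continuous_on (dom (C i)) (D i)"
    unfolding D_def[abs_def]
    by (intro continuous_intros compose_u_cont[OF i g_cont] compose_u_cont[OF i g'_cont] gradsq_cont[OF i] u_cont[OF i])
  show "D i x = 0 \<and> X i x = 0" if x: "x \<in> dom (C i)" "par (C i) x \<notin> {m \<in> M. height m \<le> u\<^sub>1}" for x
  proof -
    have "par (C i) x \<in> M" using par_dom(2)[OF C[OF i] x(1)] by (simp add: M'_def)
    then have "u\<^sub>1 \<le> u i x" using x(2) u_eq_height[OF i] by auto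
    then have "\<Psi> (u i x) = 0 \<and> w (u i x) = 0" using \<Psi>_eq_0 u_bounds[OF i x(1)] by blast
    then show ?thesis by (simp add: D_def X_def g_def g'_def)
  qed
  show "(\<integral>x. indicator (dom (C i)) x * ((\<psi> x * D i x + frechet_derivative \<psi> (at x) (X i x)) * wt i x) \<partial>lborel) = 0"
    if "C1_on (dom (C i)) \<psi>" "compact B" "B \<subseteq> dom (C i)" "\<And>x. x \<in> dom (C i) \<Longrightarrow> x \<notin> B \<Longrightarrow> \<psi> x = 0" for \<psi> B
    unfolding D_def X_def wt_def u_def k_def
  proof (rule hyperbolic_param.integral_div_cutoff[OF hp[OF i] minimal_chart[OF C[OF i]] _ _ that])
    show "(g has_real_derivative g' (hyperbolic_param.u (fc (C i)) p x)) (at (hyperbolic_param.u (fc (C i)) p x))"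
      if "x \<in> dom (C i)" for x
      using g' u_bounds[OF i that] by (simp add: u_def)
    show "continuous_on (hyperbolic_param.u (fc (C i)) p ` dom (C i)) g'"
      by (rule continuous_on_subset[OF g'_cont]) (use u_bounds[OF i] in \<open>auto simp: u_def\<close>)
  qed
  fix j assume j: "j < n"
  note ij = C[OF i] C[OF j]
  show "open {x \<in> dom (C i). par (C i) x \<in> par (C j) ` dom (C j)}" by (rule open_overlap[OF ij])
  show "continuous_on {x \<in> dom (C i). par (C i) x \<in> par (C j) ` dom (C j)} (\<lambda>x. Dtrans (C i) (C j) x v)" for v
    by (rule trans(3)[OF ij])
  show "open {x \<in> dom (C i). par (C i) x \<notin> par (C j) ` cball (c j) (2 * r j)}"
  proof -
    have cont: "continuous_on (dom (C l)) (par (C l))" if "l < n" for l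
    proof -
      have "continuous_on (snd (C l) ` fst (C l)) (par (C l))"
        using chart(1)[OF C[OF that]] by (simp add: homeomorphism_def)
      then show ?thesis by (rule continuous_on_subset[OF _ dom_subset])
    qed
    \<comment> \<open>A compact set in a Hausdorff space is closed, so its preimage under the
      continuous map par (C i) has an open complement in the chart domain.\<close>
    have "compact (par (C j) ` cball (c j) (2 * r j))"
      by (rule compact_continuous_image[OF continuous_on_subset[OF cont[OF j] cball_dom[OF j]]]) simp
    then have "open (- (par (C j) ` cball (c j) (2 * r j)))" by (simp add: compact_imp_closed open_Compl)
    from continuous_open_preimage[OF cont[OF i] open_dom[OF C[OF i]] this]
    show ?thesis by (rule back_subst[where P = "open"]) auto
  qed
  fix x assume "x \<in> dom (C i)" "par (C i) x \<in> par (C j) ` dom (C j)"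
  then have x: "x \<in> overlap (C i) (C j)" by simp
  show t: "trans (C i) (C j) x \<in> dom (C j) \<and> par (C j) (trans (C i) (C j) x) = par (C i) x"
    by (rule trans(1)[OF ij x])
  show "(trans (C i) (C j) has_derivative Dtrans (C i) (C j) x) (at x)" by (rule trans(2)[OF ij x])
  show "wt i x = \<bar>det (matrix (Dtrans (C i) (C j) x))\<bar> * wt j (trans (C i) (C j) x)"
    unfolding wt_def by (rule weight_trans[OF ij x])
  have u: "u j (trans (C i) (C j) x) = u i x" using t by (simp add: u_eq_height i j)
  have lin: "linear (Dtrans (C i) (C j) x)" using trans(2)[OF ij x] by (rule has_derivative_linear)
  show "X j (trans (C i) (C j) x) = Dtrans (C i) (C j) x (X i x)"
    by (simp add: X_def u grad_trans(1)[OF ij x] linear_scale[OF lin])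
  show "D j (trans (C i) (C j) x) = D i x"
    by (simp add: D_def u grad_trans(2)[OF ij x])
qed (rule cover)

lemma \<kappa>_u_cont: "i < n \<Longrightarrow> continuous_on (dom (C i)) (\<lambda>x. \<kappa> (u i x))"
  by (rule compose_u_cont[OF _ \<kappa>_cont])

lemma borel_par_S:
  assumes i: "i < n"
  shows "snd (C i) ` par (C i) ` S i = S i"
proof -
  have "snd (C i) (par (C i) x) = x" if "x \<in> S i" for x
    using par_dom(3)[OF C[OF i]] S_V[OF i] that by blast
  then show ?thesis by (simp add: image_image cong: image_cong_simp)
qed

lemma chart_area_S:
  assumes i: "i < n"
  shows "chart_area F (C i) (par (C i) ` S i) = (\<integral>\<^sup>+x\<in>S i. ennreal (wt i x) \<partial>lborel)"
proof -
  have "chart_area F (C i) (par (C i) ` S i) =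
      (\<integral>\<^sup>+x\<in>S i. ennreal (sqrt (det (induced_metric (snd (C i) ` fst (C i)) (fc (C i)) x))) \<partial>lborel)"
    unfolding chart_area_def case_prod_beta borel_par_S[OF i] by (simp add: fc_def par_def)
  also have "\<dots> = (\<integral>\<^sup>+x\<in>S i. ennreal (wt i x) \<partial>lborel)"
  proof (intro nn_integral_cong)
    fix x
    show "ennreal (sqrt (det (induced_metric (snd (C i) ` fst (C i)) (fc (C i)) x))) * indicator (S i) x =
        ennreal (wt i x) * indicator (S i) x"
    proof (cases "x \<in> S i")
      case True
      then have "x \<in> dom (C i)" using S_V[OF i] by blast
      then show ?thesis
        by (simp add: induced_metric_eq_G[OF C[OF i]] wt_def hyperbolic_param.weight_def[OF hp[OF i]])
    qed simp
  qed
  finally show ?thesis .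
qed

lemma S_pieces_disjoint:
  assumes "i < n" "j < n" "i \<noteq> j"
  shows "par (C i) ` S i \<inter> par (C j) ` S j = {}"
proof -
  have "par (C i) ` S i \<inter> par (C j) ` S j = {}" if "i < j" for i j
  proof -
    have a: "par (C i) ` S i \<subseteq> par (C i) ` ball (c i) (r i)" by (auto simp: S_def)
    have b: "par (C j) y \<notin> par (C i) ` ball (c i) (r i)" if "y \<in> S j" for y
      using that \<open>i < j\<close> by (simp add: S_def)
    show ?thesis
    proof (rule equals0I)
      fix m assume m: "m \<in> par (C i) ` S i \<inter> par (C j) ` S j"
      then obtain y where "y \<in> S j" "m = par (C j) y" by auto
      then show False using a b[of y] m by auto
    qed
  qed
  then show ?thesis using assms(3) by (metis inf_commute linorder_neqE_nat)
qed

text \<open>The pieces S i form one admissible family in the supremum defining the area.\<close>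

lemma sum_S_le_area: "(\<Sum>i<n. \<integral>\<^sup>+x\<in>S i. ennreal (wt i x) \<partial>lborel) \<le> area A F"
proof -
  let ?h = "\<lambda>i. (C i, par (C i) ` S i)"
  let ?\<F> = "?h ` {..<n}"
  have "(\<Sum>i<n. \<integral>\<^sup>+x\<in>S i. ennreal (wt i x) \<partial>lborel) = (\<Sum>i<n. (case ?h i of (c, B) \<Rightarrow> chart_area F c B))"
    by (simp add: chart_area_S)
  also have "\<dots> = (\<Sum>(c, B)\<in>?\<F>. chart_area F c B)"
  \<comment> \<open>Two indices yield the same chart and piece only if that piece is empty, so
    merging them does not change the sum.\<close>
  proof (rule sum.reindex_nontrivial[symmetric, unfolded o_def])
    fix i j assume ij: "i \<in> {..<n}" "j \<in> {..<n}" "i \<noteq> j" "?h i = ?h j"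
    then have "par (C i) ` S i = {}" using S_pieces_disjoint[of i j] by auto
    then show "(case ?h i of (c, B) \<Rightarrow> chart_area F c B) = 0" by (simp add: chart_area_def split: prod.splits)
  qed simp
  also have "\<dots> \<le> area A F"
    unfolding area_def
  proof (rule SUP_upper)
    have "\<forall>((U, \<phi>), B)\<in>?\<F>. (U, \<phi>) \<in> A \<and> B \<subseteq> U \<and> \<phi> ` B \<in> sets borel"
    proof (safe, goal_cases)
      case (1 U \<phi> B i)
      then show ?case using C[of i] by simp
    next
      case (2 U \<phi> B i m x)
      then have "U = fst (C i)" by (metis fst_conv)
      then show ?case using 2 par_dom(1)[OF C[of i], of x] S_V[of i] by auto
    next
      case (3 U \<phi> B i)
      then show ?case using borel_par_S[of i] borel_S[of i] by (metis snd_conv lessThan_iff)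
    qed
    moreover have "disjoint_family_on snd ?\<F>"
      unfolding disjoint_family_on_def
    proof (intro ballI impI)
      fix x y assume "x \<in> ?\<F>" "y \<in> ?\<F>" "x \<noteq> y"
      then obtain i j where "i < n" "j < n" "x = ?h i" "y = ?h j" "i \<noteq> j" by auto
      then show "snd x \<inter> snd y = {}" using S_pieces_disjoint by simp
    qed
    ultimately show "?\<F> \<in> borel_pieces A" unfolding borel_pieces_def by blast
  qed
  finally show ?thesis .
qed

text \<open>Integrate divergence + \<kappa> \<le> 1 over the pieces. The divergences sum to zero,
  and since \<kappa> is nonnegative all pieces but the first may be dropped.\<close>

lemma area_ge_kernel:
  "(\<integral>\<^sup>+x\<in>ball (c 0) (r 0). ennreal (\<kappa> (u 0 x) * wt 0 x) \<partial>lborel) \<le> area A F"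
proof -
  have cont: "continuous_on (dom (C i)) (\<lambda>x. D i x * wt i x)" "continuous_on (dom (C i)) (wt i)"
    "continuous_on (dom (C i)) (\<lambda>x. \<kappa> (u i x) * wt i x)" if "i < n" for i
    by (intro continuous_intros D_cont w_cont \<kappa>_u_cont that)+
  have int: "integrable lborel (\<lambda>x. indicator (S i) x * h x)" if "i < n" "continuous_on (dom (C i)) h" for i and h :: "real^'k \<Rightarrow> real"
    by (rule integrable_indicator_compact[OF compact_cball continuous_on_subset[OF that(2) cball_dom[OF that(1)]]
        borel_S[OF that(1)] S_cball[OF that(1)]])
  have bounds: "0 \<le> \<kappa> (u i x) * wt i x" "0 \<le> wt i x" "D i x * wt i x + \<kappa> (u i x) * wt i x \<le> wt i x" if i: "i < n" and "x \<in> S i" for i x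
  proof -
    have x: "x \<in> dom (C i)" using S_V that by blast
    note u = u_bounds[OF i x]
    show w0: "0 \<le> wt i x" using hyperbolic_param.weight_pos[OF hp[OF i] x] by (simp add: wt_def)
    show "0 \<le> \<kappa> (u i x) * wt i x" using \<kappa>_nonneg[OF u] w0 by (rule mult_nonneg_nonneg)
    have "hyperbolic_param.gradsq (E (C i)) p x \<le> (u i x)\<^sup>2 - 1"
      using hyperbolic_param.gradsq_bounds(2)[OF hp[OF i] x p] by (simp add: u_def)
    then have "D i x + \<kappa> (u i x) \<le> 1" unfolding D_def by (rule divergence_le[OF u])
    from mult_right_mono[OF this w0] show "D i x * wt i x + \<kappa> (u i x) * wt i x \<le> wt i x"
      by (simp add: distrib_right)
  qed
  let ?I = "\<lambda>i h. \<integral>x. indicator (S i) x * h x \<partial>lborel"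
  have piece: "?I i (\<lambda>x. D i x * wt i x) + ?I i (\<lambda>x. \<kappa> (u i x) * wt i x) \<le> ?I i (wt i)" if i: "i < n" for i
  proof -
    have "?I i (\<lambda>x. D i x * wt i x) + ?I i (\<lambda>x. \<kappa> (u i x) * wt i x) =
        (\<integral>x. indicator (S i) x * (D i x * wt i x) + indicator (S i) x * (\<kappa> (u i x) * wt i x) \<partial>lborel)"
      by (rule Bochner_Integration.integral_add[symmetric]) (intro int i cont)+
    also have "\<dots> \<le> ?I i (wt i)"
    proof (rule integral_mono)
      show "integrable lborel (\<lambda>x. indicator (S i) x * (D i x * wt i x) + indicator (S i) x * (\<kappa> (u i x) * wt i x))"
        by (intro Bochner_Integration.integrable_add int i cont)
      show "integrable lborel (\<lambda>x. indicator (S i) x * wt i x)" by (intro int i cont)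
      show "indicator (S i) x * (D i x * wt i x) + indicator (S i) x * (\<kappa> (u i x) * wt i x) \<le> indicator (S i) x * wt i x" for x
        using bounds(3)[OF i, of x] by (cases "x \<in> S i") auto
    qed
    finally show ?thesis .
  qed
  have \<kappa>0: "0 \<le> ?I i (\<lambda>x. \<kappa> (u i x) * wt i x)" if "i < n" for i
    using bounds(1)[OF that] by (intro Bochner_Integration.integral_nonneg) (auto simp: indicator_def)
  have wt0: "0 \<le> ?I i (wt i)" if "i < n" for i
    using bounds(2)[OF that] by (intro Bochner_Integration.integral_nonneg) (auto simp: indicator_def)
  \<comment> \<open>No ball precedes the first one, so nothing is removed from it.\<close>
  have S0: "S 0 = ball (c 0) (r 0)" by (auto simp: S_def)
  have "(\<integral>\<^sup>+x\<in>ball (c 0) (r 0). ennreal (\<kappa> (u 0 x) * wt 0 x) \<partial>lborel) =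
      (\<integral>\<^sup>+x. ennreal (indicator (S 0) x * (\<kappa> (u 0 x) * wt 0 x)) \<partial>lborel)"
    unfolding S0 by (intro nn_integral_cong) (auto simp: indicator_def)
  also have "\<dots> = ennreal (?I 0 (\<lambda>x. \<kappa> (u 0 x) * wt 0 x))"
    by (rule nn_integral_eq_integral[OF int[OF n cont(3)[OF n]]])
       (use bounds(1)[OF n] in \<open>auto simp: indicator_def\<close>)
  also have "\<dots> \<le> ennreal (\<Sum>i<n. ?I i (wt i))"
  proof (rule ennreal_leI)
    have "?I 0 (\<lambda>x. \<kappa> (u 0 x) * wt 0 x) \<le> (\<Sum>i<n. ?I i (\<lambda>x. \<kappa> (u i x) * wt i x))"
      using n \<kappa>0 by (intro member_le_sum) auto
    also have "\<dots> = (\<Sum>i<n. ?I i (\<lambda>x. D i x * wt i x) + ?I i (\<lambda>x. \<kappa> (u i x) * wt i x))"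
      using sum_integral_divergence_eq_0 by (simp add: sum.distrib)
    also have "\<dots> \<le> (\<Sum>i<n. ?I i (wt i))" using piece by (intro sum_mono) auto
    finally show "?I 0 (\<lambda>x. \<kappa> (u 0 x) * wt 0 x) \<le> (\<Sum>i<n. ?I i (wt i))" .
  qed
  also have "\<dots> = (\<Sum>i<n. ennreal (?I i (wt i)))" using wt0 by (intro sum_ennreal[symmetric]) auto
  also have "\<dots> = (\<Sum>i<n. \<integral>\<^sup>+x\<in>S i. ennreal (wt i x) \<partial>lborel)"
  proof (rule sum.cong[OF refl])
    fix i assume "i \<in> {..<n}"
    then have i: "i < n" by simp
    have "ennreal (?I i (wt i)) = (\<integral>\<^sup>+x. ennreal (indicator (S i) x * wt i x) \<partial>lborel)"
      by (rule nn_integral_eq_integral[OF int[OF i cont(2)[OF i]], symmetric])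
         (use bounds(2)[OF i] in \<open>auto simp: indicator_def\<close>)
    also have "\<dots> = (\<integral>\<^sup>+x\<in>S i. ennreal (wt i x) \<partial>lborel)"
      by (intro nn_integral_cong) (auto simp: indicator_def)
    finally show "ennreal (?I i (wt i)) = (\<integral>\<^sup>+x\<in>S i. ennreal (wt i x) \<partial>lborel)" .
  qed
  also have "\<dots> \<le> area A F" by (rule sum_S_le_area)
  finally show ?thesis .
qed

end

section \<open>The density at the centre\<close>

context minimal_submanifold
begin

lemma openin_par_image:
  assumes c: "c \<in> A" and U: "open U" "U \<subseteq> dom c"
  shows "openin (top_of_set M) (par c ` U)"
proof -
  have "U = snd c ` fst c \<inter> U" using U(2) dom_subset[of c] by blast
  then have "openin (top_of_set (snd c ` fst c)) U" using U(1) by (metis openin_open)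
  then have "openin (top_of_set (fst c)) (par c ` U)"
    by (rule homeomorphism_imp_open_map[OF homeomorphism_symD[OF chart(1)[OF c]]])
  then show ?thesis using chart(2)[OF c] openin_trans by blast
qed

text \<open>Compactness of the sublevel set. The given point is placed at the centre of the ball
  with index 0, which is the ball that survives whole in \<open>area_ge_kernel\<close>.\<close>

lemma finite_ball_cover:
  assumes u\<^sub>1: "u\<^sub>1 < cosh \<rho>" and q\<^sub>0: "q\<^sub>0 \<in> M" "height q\<^sub>0 \<le> u\<^sub>1"
  shows "\<exists>(n :: nat) C c r. 0 < n \<and> (\<forall>i<n. C i \<in> A \<and> 0 < r i \<and> cball (c i) (2 * r i) \<subseteq> dom (C i)) \<and>
    {m \<in> M. height m \<le> u\<^sub>1} \<subseteq> (\<Union>i<n. par (C i) ` ball (c i) (r i)) \<and>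
    q\<^sub>0 \<in> fst (C 0) \<and> c 0 = snd (C 0) q\<^sub>0"
proof -
  let ?K = "{m \<in> M. height m \<le> u\<^sub>1}"
  have "\<exists>y. fst y \<in> A \<and> m \<in> fst (fst y) \<and> 0 < snd y \<and> cball (snd (fst y) m) (2 * snd y) \<subseteq> dom (fst y)"
    if m: "m \<in> ?K" for m
  proof -
    have "m \<in> M" using m by simp
    then obtain ch where ch: "ch \<in> A" "m \<in> fst ch" using M_cover by blast
    have "snd ch m \<in> dom ch" using ch m u\<^sub>1 by (auto simp: dom_def M'_def)
    then obtain e where "0 < e" "cball (snd ch m) e \<subseteq> dom ch"
      using open_dom[OF ch(1)] open_contains_cball by blast
    then show ?thesis using ch by (intro exI[of _ "(ch, e / 2)"]) auto
  qed
  then have "\<forall>m\<in>?K. \<exists>y. fst y \<in> A \<and> m \<in> fst (fst y) \<and> 0 < snd y \<and> cball (snd (fst y) m) (2 * snd y) \<subseteq> dom (fst y)"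
    by blast
  from bchoice[OF this] obtain Y where Y: "\<forall>m\<in>?K. fst (Y m) \<in> A \<and> m \<in> fst (fst (Y m)) \<and> 0 < snd (Y m) \<and>
      cball (snd (fst (Y m)) m) (2 * snd (Y m)) \<subseteq> dom (fst (Y m))" ..
  have Y: "fst (Y m) \<in> A \<and> m \<in> fst (fst (Y m)) \<and> 0 < snd (Y m) \<and>
      cball (snd (fst (Y m)) m) (2 * snd (Y m)) \<subseteq> dom (fst (Y m))" if "m \<in> ?K" for m
    by (rule bspec[OF Y that])
  define O' where "O' m = par (fst (Y m)) ` ball (snd (fst (Y m)) m) (snd (Y m))" for m
  have "\<exists>W. open W \<and> O' m = M \<inter> W" if m: "m \<in> ?K" for m
  proof -
    have "ball (snd (fst (Y m)) m) (snd (Y m)) \<subseteq> cball (snd (fst (Y m)) m) (2 * snd (Y m))"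
      using Y[OF m] by auto
    then have "openin (top_of_set M) (O' m)"
      unfolding O'_def using Y[OF m] by (intro openin_par_image) auto
    then show ?thesis by (auto simp: openin_open)
  qed
  then have "\<forall>m\<in>?K. \<exists>W. open W \<and> O' m = M \<inter> W" by blast
  from bchoice[OF this] obtain W where W: "\<forall>m\<in>?K. open (W m) \<and> O' m = M \<inter> W m" ..
  then have W: "open (W m)" "O' m = M \<inter> W m" if "m \<in> ?K" for m
    using bspec[OF W that] by simp_all
  have in_O: "m \<in> O' m" if m: "m \<in> ?K" for m
    unfolding O'_def using par_chart(1)[of "fst (Y m)" m] Y[OF m] by (intro image_eqI[of _ _ "snd (fst (Y m)) m"]) auto
  obtain B where B: "B \<subseteq> ?K" "finite B" "?K \<subseteq> (\<Union>m\<in>B. W m)"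
  proof (rule compactE_image[of ?K ?K W])
    show "compact ?K" by (rule compact_height_le)
    show "open (W m)" if "m \<in> ?K" for m using W(1)[OF that] .
    show "?K \<subseteq> (\<Union>m\<in>?K. W m)" using in_O W(2) by blast
  qed (rule that)
  obtain xs where xs: "set xs = B" using finite_list[OF B(2)] by blast
  \<comment> \<open>Prepending the given point fixes index 0; it may occur again in the list without
    harm.\<close>
  define ms where "ms = q\<^sub>0 # xs"
  have ms: "ms ! i \<in> ?K" if "i < length ms" for i
    using nth_mem[OF that] xs B(1) q\<^sub>0 by (auto simp: ms_def)
  show ?thesis
  proof (rule exI[of _ "length ms"], rule exI[of _ "\<lambda>i. fst (Y (ms ! i))"],
      rule exI[of _ "\<lambda>i. snd (fst (Y (ms ! i))) (ms ! i)"], rule exI[of _ "\<lambda>i. snd (Y (ms ! i))"], intro conjI allI impI)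
    show "0 < length ms" by (simp add: ms_def)
    show "q\<^sub>0 \<in> fst (fst (Y (ms ! 0)))" using Y[of q\<^sub>0] q\<^sub>0 by (simp add: ms_def)
    show "snd (fst (Y (ms ! 0))) (ms ! 0) = snd (fst (Y (ms ! 0))) q\<^sub>0" by (simp add: ms_def)
    show "?K \<subseteq> (\<Union>i<length ms. par (fst (Y (ms ! i))) ` ball (snd (fst (Y (ms ! i))) (ms ! i)) (snd (Y (ms ! i))))"
    proof
      fix m assume m: "m \<in> ?K"
      then obtain b where b: "b \<in> B" "m \<in> W b" using B(3) by blast
      then have "m \<in> O' b" using W(2)[of b] B(1) m by blast
      moreover obtain i where "i < length ms" "ms ! i = b"
        using b(1) xs by (metis ms_def list.set_intros(2) in_set_conv_nth)
      ultimately show "m \<in> (\<Union>i<length ms. par (fst (Y (ms ! i))) ` ball (snd (fst (Y (ms ! i))) (ms ! i)) (snd (Y (ms ! i))))"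
        unfolding O'_def by blast
    qed
  qed (use Y ms in auto)
qed

end

lemma nn_integral_scale_at:
  fixes f :: "'a::euclidean_space \<Rightarrow> ennreal"
  assumes [measurable]: "f \<in> borel_measurable borel" and \<epsilon>: "0 < \<epsilon>"
  shows "(\<integral>\<^sup>+x. f x \<partial>lborel) = (\<integral>\<^sup>+z. ennreal (\<epsilon> ^ DIM('a)) * f (c + \<epsilon> *\<^sub>R z) \<partial>lborel)"
proof -
  have "(\<integral>\<^sup>+x. f x \<partial>lborel) =
      (\<integral>\<^sup>+x. f x \<partial>density (distr lborel borel (\<lambda>x. c + \<epsilon> *\<^sub>R x)) (\<lambda>_. ennreal (\<bar>\<epsilon>\<bar> ^ DIM('a))))"
    using \<epsilon> by (subst lborel_affine[of \<epsilon> c]) auto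
  also have "\<dots> = (\<integral>\<^sup>+x. ennreal (\<bar>\<epsilon>\<bar> ^ DIM('a)) * f x \<partial>distr lborel borel (\<lambda>x. c + \<epsilon> *\<^sub>R x))"
    by (subst nn_integral_density) auto
  also have "\<dots> = (\<integral>\<^sup>+z. ennreal (\<bar>\<epsilon>\<bar> ^ DIM('a)) * f (c + \<epsilon> *\<^sub>R z) \<partial>lborel)"
    by (subst nn_integral_distr) auto
  finally show ?thesis using \<epsilon> by simp
qed

text \<open>A linear change of variables preserves the mass of the kernel, so the blow-up limit
  depends neither on the tangent plane at p nor on the chart.\<close>

lemma nn_integral_kernel_linear:
  fixes B :: "real^'k^'k"
  assumes B: "det B \<noteq> 0"
  shows "(\<integral>\<^sup>+z. ennreal \<bar>det B\<bar> * ennreal (real CARD('k) * (1 + (norm (B *v z))\<^sup>2) powr (- (real CARD('k) / 2) - 1)) \<partial>lborel) =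
    ennreal (unit_ball_vol (real CARD('k)) * real CARD('k))"
proof -
  let ?F = "\<lambda>z :: real^'k. ennreal (real CARD('k) * (1 + (norm z)\<^sup>2) powr (- (real CARD('k) / 2) - 1))"
  have inv: "invertible B" using B by (simp add: invertible_det_nz)
  then have bij: "inj ((*v) B)" "range ((*v) B) = UNIV"
    by (auto simp: inj_matrix_vector_mult invertible_right_inverse matrix_right_invertible_surjective)
  have "(\<integral>\<^sup>+z\<in>UNIV. ennreal \<bar>det (matrix ((*v) B))\<bar> * ?F (B *v z) \<partial>lborel) = (\<integral>\<^sup>+z\<in>range ((*v) B). ?F z \<partial>lborel)"
  proof (rule nn_integral_differentiable_image)
    show "((*v) B has_derivative (*v) B) (at x within UNIV)" for x
      by (simp add: bounded_linear_imp_has_derivative)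
  qed (use bij in \<open>auto intro!: continuous_intros\<close>)
  then show ?thesis unfolding bij(2) by (simp add: nn_integral_kernel)
qed

context minimal_submanifold
begin

text \<open>The cover depends only on \<open>u\<^sub>1\<close>, so chart and ball are fixed before
  \<epsilon>; this uniformity is what permits the limit \<epsilon> to 0.\<close>

lemma kernel_integral_le_area:
  assumes \<Psi>: "\<And>u. 1 \<le> u \<Longrightarrow> u < cosh \<rho> \<Longrightarrow> (\<Psi> has_real_derivative - w u) (at u)"
    and w: "continuous_on UNIV w" "\<And>u. 0 \<le> w u"
      "\<And>u. 1 \<le> u \<Longrightarrow> w u * (u\<^sup>2 - 1) \<le> (u\<^sup>2 - 1) powr (real CARD('k) / 2)"
    and \<Psi>0: "\<And>u. 1 \<le> u \<Longrightarrow> u < cosh \<rho> \<Longrightarrow> 0 \<le> \<Psi> u"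
      "\<And>u. u\<^sub>1 \<le> u \<Longrightarrow> u < cosh \<rho> \<Longrightarrow> \<Psi> u = 0 \<and> w u = 0"
    and u\<^sub>1: "1 < u\<^sub>1" "u\<^sub>1 < cosh \<rho>"
  obtains c x\<^sub>0 r where "c \<in> A" "0 < r" "ball x\<^sub>0 r \<subseteq> dom c" "fc c x\<^sub>0 = p"
    "\<And>\<epsilon>. 0 < \<epsilon> \<Longrightarrow> (\<integral>\<^sup>+x\<in>ball x\<^sub>0 r. ennreal (\<Psi> (- mink p (fc c x)) * (real CARD('k) * (- mink p (fc c x)) * \<epsilon>\<^sup>2 *
        ((- mink p (fc c x))\<^sup>2 - 1 + \<epsilon>\<^sup>2) powr (- (real CARD('k) / 2) - 1)) * hyperbolic_param.weight (E c) x) \<partial>lborel) \<le> area A F"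
proof -
  obtain q\<^sub>0 where q\<^sub>0: "q\<^sub>0 \<in> M" "F q\<^sub>0 = p" using p_in by auto
  then have h0: "height q\<^sub>0 = 1" using p by (simp add: height_def hyperbolic_space_def)
  then have h1: "height q\<^sub>0 \<le> u\<^sub>1" using u\<^sub>1(1) by simp
  from finite_ball_cover[OF u\<^sub>1(2) q\<^sub>0(1) h1] obtain n :: nat and C c r where
    cov: "0 < n \<and> (\<forall>i<n. C i \<in> A \<and> 0 < r i \<and> cball (c i) (2 * r i) \<subseteq> dom (C i)) \<and>
      {m \<in> M. height m \<le> u\<^sub>1} \<subseteq> (\<Union>i<n. par (C i) ` ball (c i) (r i)) \<and>
      q\<^sub>0 \<in> fst (C 0) \<and> c 0 = snd (C 0) q\<^sub>0"
    by blast
  then have n: "0 < n" and C: "\<And>i. i < n \<Longrightarrow> C i \<in> A" and r: "\<And>i. i < n \<Longrightarrow> 0 < r i"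
    and cball: "\<And>i. i < n \<Longrightarrow> cball (c i) (2 * r i) \<subseteq> dom (C i)"
    and cover: "{m \<in> M. height m \<le> u\<^sub>1} \<subseteq> (\<Union>i<n. par (C i) ` ball (c i) (r i))"
    and q\<^sub>0C: "q\<^sub>0 \<in> fst (C 0)" "c 0 = snd (C 0) q\<^sub>0"
    by simp_all
  show thesis
  proof (rule that[of "C 0" "r 0" "c 0"])
    show "C 0 \<in> A" "0 < r 0" using C r n by auto
    have "ball (c 0) (r 0) \<subseteq> cball (c 0) (2 * r 0)" using r[OF n] by auto
    then show "ball (c 0) (r 0) \<subseteq> dom (C 0)" using cball[OF n] by blast
    show "fc (C 0) (c 0) = p" using par_chart(1)[OF C[OF n] q\<^sub>0C(1)] q\<^sub>0 by (simp add: fc_def q\<^sub>0C(2))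
    fix \<epsilon> :: real assume \<epsilon>: "0 < \<epsilon>"
    interpret minimal_cover p \<rho> M A F n C c r u\<^sub>1 \<Psi> w \<epsilon>
      by unfold_locales (use n C r cball cover \<epsilon> \<Psi> w \<Psi>0 in auto)
    show "(\<integral>\<^sup>+x\<in>ball (c 0) (r 0). ennreal (\<Psi> (- mink p (fc (C 0) x)) * (real CARD('k) * (- mink p (fc (C 0) x)) * \<epsilon>\<^sup>2 *
        ((- mink p (fc (C 0) x))\<^sup>2 - 1 + \<epsilon>\<^sup>2) powr (- (real CARD('k) / 2) - 1)) * hyperbolic_param.weight (E (C 0)) x) \<partial>lborel) \<le> area A F"
      using area_ge_kernel
      by (simp only: \<kappa>_def k_def wt_def u_def hyperbolic_param.u_def[OF hp[OF n]])
  qed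
qed

text \<open>y is the component of f orthogonal to p, with \<open>mink (y x) (y x)\<close> equal to
  (mink p (f x))^2 - 1. It vanishes at the centre, and its derivative there is the full differential
  of f, whose values are tangent at p. So y / \<epsilon> at the rescaled points converges to the
  differential.\<close>

lemma blow_up:
  assumes c: "c \<in> A" and x\<^sub>0: "x\<^sub>0 \<in> dom c" "fc c x\<^sub>0 = p" and \<epsilon>: "\<epsilon> \<longlonglongrightarrow> 0" "\<And>j. 0 < \<epsilon> j"
  shows "(\<lambda>j. ((mink p (fc c (x\<^sub>0 + \<epsilon> j *\<^sub>R z)))\<^sup>2 - 1) / (\<epsilon> j)\<^sup>2) \<longlonglongrightarrow> mink (Df c x\<^sub>0 z) (Df c x\<^sub>0 z)"
proof -
  interpret hyperbolic_param "dom c" "fc c" "E c" "D2 c" by (rule hyperbolic_param[OF c])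
  define y where "y x = fc c x + mink p (fc c x) *\<^sub>R p" for x
  have pp: "mink p p = -1" using p by (simp add: hyperbolic_space_def)
  have y0: "y x\<^sub>0 = 0" by (simp add: y_def x\<^sub>0 pp)
  have lin: "linear (Df c x\<^sub>0)" by (rule linear_Df[OF c x\<^sub>0(1)])
  have tan: "mink p (Df c x\<^sub>0 v) = 0" for v
    using L_tangent[OF x\<^sub>0(1), of v] by (simp add: L_eq_Df[OF c x\<^sub>0(1)] x\<^sub>0(2) tangent_space_def)
  have "(y has_derivative (\<lambda>v. Df c x\<^sub>0 v + (mink p (Df c x\<^sub>0 v) + mink 0 (fc c x\<^sub>0)) *\<^sub>R p)) (at x\<^sub>0)"
    unfolding y_def[abs_def]
    by (intro has_derivative_add has_derivative_scaleR_left mink.FDERIV[OF has_derivative_const] Df[OF c x\<^sub>0(1)])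
  then have y': "(y has_derivative Df c x\<^sub>0) (at x\<^sub>0)" by (simp add: tan mink.zero_left)
  have "((\<lambda>t. y (x\<^sub>0 + t *\<^sub>R z)) has_derivative (\<lambda>t. Df c x\<^sub>0 (t *\<^sub>R z))) (at 0)"
  proof (rule has_derivative_compose[where f = "\<lambda>t. x\<^sub>0 + t *\<^sub>R z" and g = y])
    show "((\<lambda>t. x\<^sub>0 + t *\<^sub>R z) has_derivative (\<lambda>t. t *\<^sub>R z)) (at 0)" by (auto intro!: derivative_eq_intros)
  qed (use y' in simp)
  then have "(\<lambda>t. norm (y (x\<^sub>0 + t *\<^sub>R z) - t *\<^sub>R Df c x\<^sub>0 z) / norm t) \<midarrow>0\<rightarrow> 0"
    by (simp add: has_derivative_at y0 linear_scale[OF lin])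
  moreover have "\<forall>\<^sub>F t in at 0. norm (y (x\<^sub>0 + t *\<^sub>R z) - t *\<^sub>R Df c x\<^sub>0 z) / norm t = norm (y (x\<^sub>0 + t *\<^sub>R z) /\<^sub>R t - Df c x\<^sub>0 z)"
  proof (rule eventually_at_topological[THEN iffD2], intro exI[of _ UNIV] conjI ballI impI)
    fix t :: real assume "t \<noteq> 0"
    then have "y (x\<^sub>0 + t *\<^sub>R z) /\<^sub>R t - Df c x\<^sub>0 z = (y (x\<^sub>0 + t *\<^sub>R z) - t *\<^sub>R Df c x\<^sub>0 z) /\<^sub>R t"
      by (simp add: scaleR_diff_right)
    then show "norm (y (x\<^sub>0 + t *\<^sub>R z) - t *\<^sub>R Df c x\<^sub>0 z) / norm t = norm (y (x\<^sub>0 + t *\<^sub>R z) /\<^sub>R t - Df c x\<^sub>0 z)"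
      by (simp add: divide_inverse mult.commute)
  qed auto
  ultimately have "(\<lambda>t. norm (y (x\<^sub>0 + t *\<^sub>R z) /\<^sub>R t - Df c x\<^sub>0 z)) \<midarrow>0\<rightarrow> 0"
    by (rule Lim_transform_eventually)
  then have "((\<lambda>t. y (x\<^sub>0 + t *\<^sub>R z) /\<^sub>R t) \<longlongrightarrow> Df c x\<^sub>0 z) (at 0)"
    by (rule LIM_zero_cancel[OF tendsto_norm_zero_cancel])
  moreover have "filterlim \<epsilon> (at 0) sequentially"
    using \<epsilon> by (auto simp: filterlim_at less_imp_neq[symmetric])
  ultimately have lim: "(\<lambda>j. y (x\<^sub>0 + \<epsilon> j *\<^sub>R z) /\<^sub>R \<epsilon> j) \<longlonglongrightarrow> Df c x\<^sub>0 z"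
    by (rule filterlim_compose)
  have "(\<lambda>j. mink (y (x\<^sub>0 + \<epsilon> j *\<^sub>R z) /\<^sub>R \<epsilon> j) (y (x\<^sub>0 + \<epsilon> j *\<^sub>R z) /\<^sub>R \<epsilon> j)) \<longlonglongrightarrow> mink (Df c x\<^sub>0 z) (Df c x\<^sub>0 z)"
    by (rule mink.tendsto[OF lim lim])
  moreover have "\<forall>\<^sub>F j in sequentially. mink (y (x\<^sub>0 + \<epsilon> j *\<^sub>R z) /\<^sub>R \<epsilon> j) (y (x\<^sub>0 + \<epsilon> j *\<^sub>R z) /\<^sub>R \<epsilon> j) =
      ((mink p (fc c (x\<^sub>0 + \<epsilon> j *\<^sub>R z)))\<^sup>2 - 1) / (\<epsilon> j)\<^sup>2"
  proof -
    have "(\<lambda>j. x\<^sub>0 + \<epsilon> j *\<^sub>R z) \<longlonglongrightarrow> x\<^sub>0 + 0 *\<^sub>R z" by (intro tendsto_intros \<epsilon>)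
    then have "\<forall>\<^sub>F j in sequentially. x\<^sub>0 + \<epsilon> j *\<^sub>R z \<in> dom c"
      by (rule topological_tendstoD) (use open_dom[OF c] x\<^sub>0 in auto)
    then show ?thesis
    proof eventually_elim
      case (elim j)
      let ?q = "fc c (x\<^sub>0 + \<epsilon> j *\<^sub>R z)"
      have qq: "mink ?q ?q = -1" using hyp[OF elim] by (simp add: hyperbolic_space_def)
      have "mink (y (x\<^sub>0 + \<epsilon> j *\<^sub>R z)) (y (x\<^sub>0 + \<epsilon> j *\<^sub>R z)) = (mink p ?q)\<^sup>2 - 1"
        by (simp add: y_def mink.add_left mink.add_right mink.scaleR_left mink.scaleR_right pp qq
            mink_commute[of ?q p] power2_eq_square)
      then show ?case by (simp add: mink.scaleR_left mink.scaleR_right power2_eq_square divide_inverse)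
    qed
  qed
  ultimately show ?thesis by (rule Lim_transform_eventually)
qed

text \<open>After rescaling by \<epsilon> the kernel converges pointwise to \<Psi> 1 times the fixed
  kernel composed with the linear map B, times |det B|. Fatou's lemma turns the uniform bounds into
  one for the limit, whose mass is known.\<close>

theorem area_ge_profile:
  assumes ab: "1 < a" "a < b" "b < cosh \<rho>"
  shows "ennreal (unit_ball_vol (real CARD('k)) * real CARD('k)) *
    (\<integral>\<^sup>+u\<in>{a..b}. ennreal ((u\<^sup>2 - 1) powr (real CARD('k) / 2 - 1)) \<partial>lborel) \<le> area A F"
proof -
  define k where "k = real CARD('k)"
  obtain \<Psi> w u\<^sub>1 where u\<^sub>1: "1 < u\<^sub>1" "u\<^sub>1 < cosh \<rho>"
    and \<Psi>: "\<And>u. 1 \<le> u \<Longrightarrow> u < cosh \<rho> \<Longrightarrow> (\<Psi> has_real_derivative - w u) (at u)"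
    and w: "continuous_on UNIV w" "\<And>u. 0 \<le> w u" "\<And>u. 1 \<le> u \<Longrightarrow> w u * (u\<^sup>2 - 1) \<le> (u\<^sup>2 - 1) powr (k / 2)"
    and \<Psi>0: "\<And>u. 1 \<le> u \<Longrightarrow> u < cosh \<rho> \<Longrightarrow> 0 \<le> \<Psi> u" "\<And>u. u\<^sub>1 \<le> u \<Longrightarrow> u < cosh \<rho> \<Longrightarrow> \<Psi> u = 0 \<and> w u = 0"
    and le: "(\<integral>\<^sup>+u\<in>{a..b}. ennreal ((u\<^sup>2 - 1) powr (k / 2 - 1)) \<partial>lborel) \<le> ennreal (\<Psi> 1)"
    by (rule density_profile[OF ab, of "k / 2"]) (rule that)
  obtain c x\<^sub>0 r where c: "c \<in> A" and r: "0 < r" "ball x\<^sub>0 r \<subseteq> dom c" and fx\<^sub>0: "fc c x\<^sub>0 = p"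
    and kern: "\<And>\<epsilon>. 0 < \<epsilon> \<Longrightarrow> (\<integral>\<^sup>+x\<in>ball x\<^sub>0 r. ennreal (\<Psi> (- mink p (fc c x)) * (k * (- mink p (fc c x)) * \<epsilon>\<^sup>2 *
        ((- mink p (fc c x))\<^sup>2 - 1 + \<epsilon>\<^sup>2) powr (- (k / 2) - 1)) * hyperbolic_param.weight (E c) x) \<partial>lborel) \<le> area A F"
    by (rule kernel_integral_le_area[folded k_def, where \<Psi> = \<Psi> and w = w and u\<^sub>1 = u\<^sub>1])
      (rule \<Psi> w \<Psi>0(1) \<Psi>0(2) u\<^sub>1 that; assumption)+
  interpret P: hyperbolic_param "dom c" "fc c" "E c" "D2 c" by (rule hyperbolic_param[OF c])
  have x\<^sub>0: "x\<^sub>0 \<in> dom c" using r by auto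
  define U where "U x = - mink p (fc c x)" for x
  define W where "W x = P.weight x" for x
  have U0: "U x\<^sub>0 = 1" using p by (simp add: U_def fx\<^sub>0 hyperbolic_space_def)
  have U_bounds: "1 \<le> U x" "U x < cosh \<rho>" if "x \<in> dom c" for x
    using mink_hyperbolic_space_le[OF p P.hyp[OF that]] par_dom(2)[OF c that]
    by (auto simp: U_def M'_def height_def fc_def)
  have contU: "continuous_on (dom c) U"
    using C1_on_imp_continuous_on[OF P.C1_u[of p]] by (simp add: P.u_def[abs_def] U_def[abs_def])
  have contW: "continuous_on (dom c) W"
    using C1_on_imp_continuous_on[OF P.C1_weight] by (simp add: W_def[abs_def])
  define H where "H \<epsilon> x = indicator (ball x\<^sub>0 r) x * (\<Psi> (U x) * (k * U x * \<epsilon>\<^sup>2 * ((U x)\<^sup>2 - 1 + \<epsilon>\<^sup>2) powr (- (k / 2) - 1)) * W x)" for \<epsilon> x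
  have H_le: "(\<integral>\<^sup>+x. ennreal (H \<epsilon> x) \<partial>lborel) \<le> area A F" if "0 < \<epsilon>" for \<epsilon>
  proof -
    have "(\<integral>\<^sup>+x. ennreal (H \<epsilon> x) \<partial>lborel) = (\<integral>\<^sup>+x\<in>ball x\<^sub>0 r. ennreal (\<Psi> (U x) * (k * U x * \<epsilon>\<^sup>2 * ((U x)\<^sup>2 - 1 + \<epsilon>\<^sup>2) powr (- (k / 2) - 1)) * W x) \<partial>lborel)"
      by (intro nn_integral_cong) (auto simp: H_def indicator_def)
    then show ?thesis using kern[OF that] by (simp only: U_def W_def)
  qed
  have H_meas: "H \<epsilon> \<in> borel_measurable borel" if \<epsilon>: "0 < \<epsilon>" for \<epsilon>
  proof -
    have pos: "0 < (U x)\<^sup>2 - 1 + \<epsilon>\<^sup>2" if "x \<in> dom c" for x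
      using one_le_power[OF U_bounds(1)[OF that], of 2] zero_less_power[OF \<epsilon>, of 2] by linarith
    have "continuous_on {1..<cosh \<rho>} \<Psi>"
      by (intro continuous_at_imp_continuous_on ballI DERIV_isCont[OF \<Psi>]) auto
    then have "continuous_on (dom c) (\<lambda>x. \<Psi> (U x))"
      by (rule continuous_on_compose2[OF _ contU]) (use U_bounds in auto)
    then have "continuous_on (ball x\<^sub>0 r) (\<lambda>x. \<Psi> (U x) * (k * U x * \<epsilon>\<^sup>2 * ((U x)\<^sup>2 - 1 + \<epsilon>\<^sup>2) powr (- (k / 2) - 1)) * W x)"
      by (intro continuous_on_subset[OF _ r(2)] continuous_intros contU contW) (use pos in \<open>auto simp: less_imp_neq[symmetric]\<close>)
    from borel_measurable_continuous_on_indicator[OF _ this] show ?thesis by (simp add: H_def[abs_def])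
  qed
  define \<epsilon> where "\<epsilon> j = 1 / real (Suc j)" for j
  have \<epsilon>: "0 < \<epsilon> j" for j by (simp add: \<epsilon>_def)
  have \<epsilon>_lim: "\<epsilon> \<longlonglongrightarrow> 0" unfolding \<epsilon>_def using LIMSEQ_inverse_real_of_nat by (simp add: inverse_eq_divide)
  \<comment> \<open>B is the differential at the centre in orthonormal coordinates: it describes the
    limit metric, and |det B| is the volume density there.\<close>
  obtain B :: "real^'k^'k" where B: "det B \<noteq> 0" "\<And>a b. mink (P.L x\<^sub>0 a) (P.L x\<^sub>0 b) = (B *v a) \<bullet> (B *v b)"
    "P.G x\<^sub>0 = transpose B ** B"
    by (rule P.G_factorization[OF x\<^sub>0]) (rule that)
  have W0: "W x\<^sub>0 = \<bar>det B\<bar>"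
    by (simp add: W_def P.weight_def B(3) det_mul det_transpose)
  define Q where "Q z = \<Psi> 1 * (\<bar>det B\<bar> * (k * (1 + (norm (B *v z))\<^sup>2) powr (- (k / 2) - 1)))" for z
  have lim: "(\<lambda>j. \<epsilon> j ^ CARD('k) * H (\<epsilon> j) (x\<^sub>0 + \<epsilon> j *\<^sub>R z)) \<longlonglongrightarrow> Q z" for z
  proof -
    let ?x = "\<lambda>j. x\<^sub>0 + \<epsilon> j *\<^sub>R z"
    have xlim: "?x \<longlonglongrightarrow> x\<^sub>0"
    proof -
      have "?x \<longlonglongrightarrow> x\<^sub>0 + 0 *\<^sub>R z" by (intro tendsto_intros \<epsilon>_lim)
      then show ?thesis by simp
    qed
    have Ulim: "(\<lambda>j. U (?x j)) \<longlonglongrightarrow> 1"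
      using isCont_tendsto_compose[OF _ xlim, of U] contU open_dom[OF c] x\<^sub>0 U0
      by (simp add: continuous_on_eq_continuous_at)
    have Wlim: "(\<lambda>j. W (?x j)) \<longlonglongrightarrow> \<bar>det B\<bar>"
      using isCont_tendsto_compose[OF _ xlim, of W] contW open_dom[OF c] x\<^sub>0 W0
      by (simp add: continuous_on_eq_continuous_at)
    have "1 < cosh \<rho>" using u\<^sub>1 by simp
    then have "(\<lambda>j. \<Psi> (U (?x j))) \<longlonglongrightarrow> \<Psi> 1"
      using isCont_tendsto_compose[OF DERIV_isCont[OF \<Psi>[of 1]] Ulim] by simp
    moreover have "(\<lambda>j. ((U (?x j))\<^sup>2 - 1) / (\<epsilon> j)\<^sup>2) \<longlonglongrightarrow> (norm (B *v z))\<^sup>2"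
      using blow_up[OF c x\<^sub>0 fx\<^sub>0 \<epsilon>_lim \<epsilon>, of z] B(2)[of z z]
      by (simp add: U_def L_eq_Df[OF c x\<^sub>0] power2_norm_eq_inner)
    moreover have "1 + (norm (B *v z))\<^sup>2 \<noteq> 0" by (smt (verit) zero_le_power2)
    ultimately have "(\<lambda>j. \<Psi> (U (?x j)) * (W (?x j) * (k * U (?x j) * (1 + ((U (?x j))\<^sup>2 - 1) / (\<epsilon> j)\<^sup>2) powr (- (k / 2) - 1)))) \<longlonglongrightarrow>
        \<Psi> 1 * (\<bar>det B\<bar> * (k * 1 * (1 + (norm (B *v z))\<^sup>2) powr (- (k / 2) - 1)))"
      by (intro tendsto_intros Ulim Wlim) auto
    moreover have "\<forall>\<^sub>F j in sequentially. \<Psi> (U (?x j)) * (W (?x j) * (k * U (?x j) * (1 + ((U (?x j))\<^sup>2 - 1) / (\<epsilon> j)\<^sup>2) powr (- (k / 2) - 1))) =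
        \<epsilon> j ^ CARD('k) * H (\<epsilon> j) (?x j)"
    proof -
      have "\<forall>\<^sub>F j in sequentially. ?x j \<in> ball x\<^sub>0 r"
        using xlim by (rule topological_tendstoD) (use r in auto)
      then show ?thesis
      proof eventually_elim
        case (elim j)
        let ?u = "U (?x j)" and ?e = "\<epsilon> j"
        have e: "0 < ?e" by (rule \<epsilon>)
        have "1 \<le> ?u" using U_bounds(1) elim r(2) by blast
        then have "0 \<le> ?u\<^sup>2 - 1" using one_le_power[of ?u 2] by simp
        then have pos: "0 \<le> 1 + (?u\<^sup>2 - 1) / ?e\<^sup>2" by simp
        have "?u\<^sup>2 - 1 + ?e\<^sup>2 = ?e\<^sup>2 * (1 + (?u\<^sup>2 - 1) / ?e\<^sup>2)" using e by (simp add: field_simps)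
        then have "(?u\<^sup>2 - 1 + ?e\<^sup>2) powr (- (k / 2) - 1) = (?e\<^sup>2) powr (- (k / 2) - 1) * (1 + (?u\<^sup>2 - 1) / ?e\<^sup>2) powr (- (k / 2) - 1)"
          using pos by (simp add: powr_mult)
        \<comment> \<open>The powers of \<epsilon> cancel exactly: k from the volume element, 2 from
          \<kappa>, and -k - 2 from the factor taken out of the base.\<close>
        moreover have "?e ^ CARD('k) * ?e\<^sup>2 * (?e\<^sup>2) powr (- (k / 2) - 1) = 1"
        proof -
          have "?e ^ CARD('k) = ?e powr k" using e by (simp add: k_def powr_realpow)
          moreover have e2: "?e\<^sup>2 = ?e powr 2" using e by simp
          moreover have "(?e\<^sup>2) powr (- (k / 2) - 1) = ?e powr (2 * (- (k / 2) - 1))" unfolding e2 by (rule powr_powr)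
          ultimately have "?e ^ CARD('k) * ?e\<^sup>2 * (?e\<^sup>2) powr (- (k / 2) - 1) = ?e powr (k + 2 + 2 * (- (k / 2) - 1))"
            by (simp only: powr_add)
          also have "k + 2 + 2 * (- (k / 2) - 1) = 0" by simp
          finally show ?thesis using e by simp
        qed
        ultimately have "?e ^ CARD('k) * (?e\<^sup>2 * (?u\<^sup>2 - 1 + ?e\<^sup>2) powr (- (k / 2) - 1)) = (1 + (?u\<^sup>2 - 1) / ?e\<^sup>2) powr (- (k / 2) - 1)"
          by (simp add: mult.assoc[symmetric])
        from arg_cong[OF sym[OF this], of "\<lambda>t. \<Psi> ?u * (W (?x j) * (k * ?u * t))"] show ?case
          using elim by (simp add: H_def mult_ac)
      qed
    qed
    ultimately have "(\<lambda>j. \<epsilon> j ^ CARD('k) * H (\<epsilon> j) (?x j)) \<longlonglongrightarrow> \<Psi> 1 * (\<bar>det B\<bar> * (k * 1 * (1 + (norm (B *v z))\<^sup>2) powr (- (k / 2) - 1)))"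
      by (rule Lim_transform_eventually)
    then show ?thesis by (simp add: Q_def)
  qed
  have \<Psi>1: "0 \<le> \<Psi> 1" using \<Psi>0(1)[of 1] u\<^sub>1 by simp
  let ?G = "\<lambda>j z. ennreal (\<epsilon> j ^ CARD('k)) * ennreal (H (\<epsilon> j) (x\<^sub>0 + \<epsilon> j *\<^sub>R z))"
  have G_le: "(\<integral>\<^sup>+z. ?G j z \<partial>lborel) \<le> area A F" for j
  proof -
    have "(\<lambda>x. ennreal (H (\<epsilon> j) x)) \<in> borel_measurable borel"
      by (rule measurable_compose[OF H_meas[OF \<epsilon>] measurable_ennreal])
    from nn_integral_scale_at[where c = x\<^sub>0, OF this \<epsilon>[of j]]
    have "(\<integral>\<^sup>+z. ?G j z \<partial>lborel) = (\<integral>\<^sup>+x. ennreal (H (\<epsilon> j) x) \<partial>lborel)" by simp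
    then show ?thesis using H_le[OF \<epsilon>[of j]] by (simp only:)
  qed
  have "(\<integral>\<^sup>+z. ennreal (Q z) \<partial>lborel) = (\<integral>\<^sup>+z. liminf (\<lambda>j. ?G j z) \<partial>lborel)"
  proof (intro nn_integral_cong)
    fix z
    have "(\<lambda>j. ?G j z) \<longlonglongrightarrow> ennreal (Q z)"
      using tendsto_ennrealI[OF lim[of z]] \<epsilon> by (simp add: ennreal_mult' less_imp_le)
    from lim_imp_Liminf[OF sequentially_bot this] show "ennreal (Q z) = liminf (\<lambda>j. ?G j z)" by (rule sym)
  qed
  \<comment> \<open>Fatou's lemma needs only nonnegativity and measurability, so no bound dominating
    the rescaled kernels is required.\<close>
  also have "\<dots> \<le> liminf (\<lambda>j. \<integral>\<^sup>+z. ?G j z \<partial>lborel)"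
  proof (rule nn_integral_liminf)
    fix j
    note [measurable] = H_meas[OF \<epsilon>[of j]]
    show "(\<lambda>z. ?G j z) \<in> borel_measurable lborel" by measurable
  qed
  also have "\<dots> \<le> area A F"
    using G_le by (intro Liminf_le) auto
  finally have Q_le: "(\<integral>\<^sup>+z. ennreal (Q z) \<partial>lborel) \<le> area A F" .
  have "(\<integral>\<^sup>+z. ennreal (Q z) \<partial>lborel) =
      (\<integral>\<^sup>+z. ennreal (\<Psi> 1) * (ennreal \<bar>det B\<bar> * ennreal (k * (1 + (norm (B *v z))\<^sup>2) powr (- (k / 2) - 1))) \<partial>lborel)"
    by (intro nn_integral_cong) (simp add: Q_def ennreal_mult' \<Psi>1)
  also have "\<dots> = ennreal (\<Psi> 1) * ennreal (unit_ball_vol (real CARD('k)) * real CARD('k))"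
    unfolding nn_integral_kernel_linear[OF B(1), symmetric] k_def
  proof (rule nn_integral_cmult)
    have "continuous_on UNIV (\<lambda>z. real CARD('k) * (1 + (norm (B *v z))\<^sup>2) powr (- (real CARD('k) / 2) - 1))"
      by (intro continuous_intros) (auto simp: add_nonneg_eq_0_iff)
    then have [measurable]: "(\<lambda>z. real CARD('k) * (1 + (norm (B *v z))\<^sup>2) powr (- (real CARD('k) / 2) - 1)) \<in> borel_measurable borel"
      by (rule borel_measurable_continuous_onI)
    show "(\<lambda>z. ennreal \<bar>det B\<bar> * ennreal (real CARD('k) * (1 + (norm (B *v z))\<^sup>2) powr (- (real CARD('k) / 2) - 1))) \<in> borel_measurable lborel"
      by measurable
  qed
  finally have "ennreal (unit_ball_vol (real CARD('k)) * real CARD('k)) * ennreal (\<Psi> 1) \<le> area A F"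
    using Q_le by (simp add: mult.commute)
  with mult_left_mono[OF le] show ?thesis unfolding k_def by (metis (no_types, lifting) order_trans zero_le)
qed

end

theorem theorem1:
  fixes p :: "(real^'n) \<times> real" and \<rho>\<^sub>0 :: real
    and P N\<^sub>0 :: "((real^'n) \<times> real) set"
    and M :: "'m::t2_space set" and A :: "('m, 'k::finite) chart set"
    and F :: "'m \<Rightarrow> (real^'n) \<times> real"
  assumes "CARD('k) \<le> CARD('n)"
    and "p \<in> hyperbolic_space" and "0 < \<rho>\<^sub>0"
    and "subspace P" and "P \<subseteq> tangent_space p" and "dim P = CARD('k)"
    and "N\<^sub>0 = hexp p ` P \<inter> geodesic_ball p \<rho>\<^sub>0"
    and "smooth_manifold M A" and "compact M"
    and "hyperbolic_immersion M A F" and "minimal A F"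
    and "p \<in> F ` M"
    and "F ` manifold_boundary A \<subseteq> geodesic_sphere p \<rho>\<^sub>0"
  shows "area A F \<ge> area (induced_atlas N\<^sub>0 :: (_, 'k) chart set) (\<lambda>x. x)"
proof -
  interpret minimal_submanifold p \<rho>\<^sub>0 M A F using assms by unfold_locales
  have "area (induced_atlas N\<^sub>0 :: (_, 'k) chart set) (\<lambda>x. x) \<le>
      (\<integral>\<^sup>+y\<in>ball (0 :: real^'k) (sinh \<rho>\<^sub>0). ennreal (1 / sqrt (1 + (norm y)\<^sup>2)) \<partial>lborel)"
    unfolding assms(7) by (rule area_totally_geodesic_le) (use assms in auto)
  also have "\<dots> \<le> area A F"
  proof (rule nn_integral_disc_le)
    fix \<alpha> \<beta> :: real assume ab: "0 < \<alpha>" "\<alpha> < \<beta>" "\<beta> < sinh \<rho>\<^sub>0"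
    \<comment> \<open>Under u = sqrt (1 + s^2) the radius sinh \<rho>_0 corresponds to cosh
      \<rho>_0, so annuli strictly inside the disc become intervals strictly between 1 and cosh
      \<rho>_0.\<close>
    have "sqrt (1 + \<beta>\<^sup>2) < sqrt (1 + (sinh \<rho>\<^sub>0)\<^sup>2)" using ab by (simp add: power_strict_mono)
    also have "\<dots> = cosh \<rho>\<^sub>0" by (rule real_sqrt_unique) (simp_all add: cosh_square_eq)
    finally show "ennreal (unit_ball_vol (real CARD('k)) * real CARD('k)) *
        (\<integral>\<^sup>+s\<in>{\<alpha>..\<beta>}. ennreal (s ^ (CARD('k) - 1) / sqrt (1 + s\<^sup>2)) \<partial>lborel) \<le> area A F"
      using ab unfolding nn_integral_hyperbolic_substitution[OF zero_less_card_finite ab(1,2)]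
      by (intro area_ge_profile) (auto simp: power_strict_mono)
  qed (use assms in simp)
  finally show ?thesis .
qed

end
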